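(* Let $\mathcal D\subset\mathbb R^d$ be a bounded domain satisfying the standing assumptions in the context, and let $\mathcal D'\subset\mathcal D$ be a convex subdomain (nonempty, open). Let $(\Xi_1,\Xi_2)$ be the random chord of $\mathcal D$, and let $(\Xi_1',\Xi_2')$ be the chord induced on $\mathcal D'$, i.e. the pair of endpoints (ordered in the direction from $\Xi_1$ to $\Xi_2$) of the intersection of the segment $[\Xi_1,\Xi_2]$ with $\mathcal D'$, conditionally on this intersection being nonempty. Then $(\Xi_1',\Xi_2')$ is the random chord of $\mathcal D'$: it has joint density $|\partial\mathcal D'|^{-1}\tilde K_{\mathcal D'}(x,y)$ with respect to the product of $(d-1)$-dimensional Hausdorff measures on $\partial\mathcal D'\times\partial\mathcal D'$.
   Context: Notation: $d\ge 2$; $\|\cdot\|$ is the Euclidean norm, $\mathcal B(x,\varepsilon)$ the open ball, $\mathbb S^{d-1}$ the unit sphere, $e=(1,0,\dots,0)$, $\mathbb S_e=\{w\in\mathbb S^{d-1}:e\cdot w>0\}$; $|A|$ is the $(d-1)$-dimensional Hausdorff measure for subsets of boundaries. Standing assumptions on a domain $\mathcal D$: $\mathcal D\subset\mathbb R^d$ is open and connected, and (Lipschitz condition) for every $x\in\partial\mathcal D$ there exist $\varepsilon_x>0$, an affine isometry $\mathfrak I_x:\mathbb R^d\to\mathbb R^d$ with $\mathfrak I_x x=0$ and a Lipschitz function $f_x:\mathbb R^{d-1}\to\mathbb R$ with $f_x(0)=0$ such that $\mathfrak I_x(\mathcal D\cap\mathcal B(x,\varepsilon_x))=\{z\in\mathcal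 B(0,\varepsilon_x):z^{(d)}>f_x(z^{(1)},\dots,z^{(d-1)})\}$. Moreover there is a relatively open set $\mathcal R_{\mathcal D}\subset\partial\mathcal D$, with $|\partial\mathcal D\setminus\mathcal R_{\mathcal D}|=0$, such that $\partial\mathcal D$ has a local $C^1$ parametrization at each point of $\mathcal R_{\mathcal D}$. For $x\in\mathcal R_{\mathcal D}$, $\mathbf n(x)$ is the unit normal vector pointing into $\mathcal D$. Random chord of a bounded, open, connected domain $\mathcal D\subset\mathbb R^d$ whose boundary satisfies the Lipschitz condition and has a local $C^1$ parametrization at each point of a relatively open set $\mathcal R_{\mathcal D}\subset\partial\mathcal D$ with $|\partial\mathcal D\setminus\mathcal R_{\mathcal D}|=0$: the pair of random variables $(\Xi_1,\Xi_2)$ in $\partial\mathcal D$ with joint density $|\partial\mathcal D|^{-1}\tilde K_{\mathcal D}(x,y)$ with respect to the product of Hausdorff measures, where $$\tilde K_{\mathcal D}(x,y)=\frac{\gamma_d\big((y-x)\cdot\mathbf n(x)\big)\big((x-y)\cdot\mathbf n(y)\big)}{\|x-y\|^{d+1}}\,\mathbf 1\{x,y\in\mathcal R_{\mathcal D},\ x\leftrightarrow y\},\qquad \gamma_d=\Big(\int_{\mathbb S_e}u\cdot e\,du\Big)^{-1},$$ ($du$ surface measure) and $x\leftrightarrow y$ means that $x\ne y$ and the open segment $(x,y)$ lies in $\mathcal D$. Equivalently, $\Xi_1$ is uniform on $\partial\mathcal D$ and a ray is drawn from $\Xi_1$ in a random inward direction $u$ with density $\gamma_d\,u\cdot\mathbf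 n(\Xi_1)$ until it hits $\partial\mathcal D$ at $\Xi_2$. For $\mathcal D'$, $\tilde K_{\mathcal D'}$ is the same expression with $\mathcal D$ replaced by $\mathcal D'$ (normals and visibility relative to $\mathcal D'$); the boundary of a bounded convex domain automatically satisfies the Lipschitz condition and has a local $C^1$ parametrization at each point of a relatively open subset of full $(d-1)$-dimensional Hausdorff measure.
   Formalization: The boundary of the convex subdomain D' is assumed to have a relatively open part of full measure with local C^1 parametrizations; this is not automatic, since a planar convex domain with corners dense in its boundary has none, and then the kernel of D' is undefined. *)

theory Defs
  imports "HOL-Probability.Probability"
begin

text \<open>
  The space of dimension \<open>d\<close> (with \<open>d \<ge> 2\<close>) is \<open>(real ^ 'm) \<times> real\<close> with \<open>d = CARD('m) + 1\<close>; its norm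
  is the Euclidean one.  For a point \<open>z\<close>, \<open>fst z\<close> consists of the first \<open>d - 1\<close> coordinates and
  \<open>snd z\<close> is the last coordinate.
\<close>

type_synonym 'm pt = "(real ^ 'm) \<times> real"


subsection \<open>Hausdorff measure\<close>

text \<open>
  The normalisation makes the \<open>s\<close>-dimensional measure agree with Lebesgue measure on Euclidean
  spaces of dimension \<open>s\<close>.  The diameter of an unbounded set is an unspecified real, hence the
  boundedness condition on the covering sets.
\<close>

definition hausdorff_gauge :: "nat \<Rightarrow> 'a::metric_space set \<Rightarrow> ennreal" where
  "hausdorff_gauge s C =
     (if C = {} then 0 else ennreal (unit_ball_vol (real s) * (diameter C / 2) ^ s))"

definition hausdorff_content :: "nat \<Rightarrow> real \<Rightarrow> 'a::metric_space set \<Rightarrow> ennreal" where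
  "hausdorff_content s \<delta> A =
     (INF C \<in> {C :: nat \<Rightarrow> 'a set. A \<subseteq> (\<Union>i. C i) \<and> (\<forall>i. bounded (C i) \<and> diameter (C i) \<le> \<delta>)}.
        \<Sum>i. hausdorff_gauge s (C i))"

definition hausdorff_outer :: "nat \<Rightarrow> 'a::metric_space set \<Rightarrow> ennreal" where
  "hausdorff_outer s A = (SUP \<delta> \<in> {0<..}. hausdorff_content s \<delta> A)"

definition hausdorff_measure :: "nat \<Rightarrow> 'a::metric_space measure" where
  "hausdorff_measure s = measure_of UNIV (sets borel) (hausdorff_outer s)"

text \<open>The \<open>(d - 1)\<close>-dimensional Hausdorff measure.\<close>

abbreviation hausdorff_surface :: "'m::finite pt measure" where
  "hausdorff_surface \<equiv> hausdorff_measure CARD('m)"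

text \<open>Hausdorff measure carried by the boundary of \<open>D\<close>, as a Borel measure on the whole space.\<close>

definition boundary_measure :: "'m::finite pt set \<Rightarrow> 'm pt measure" where
  "boundary_measure D = density hausdorff_surface (indicator (frontier D))"


subsection \<open>Regularity of the boundary\<close>

definition affine_isometry :: "('m::finite pt \<Rightarrow> 'm pt) \<Rightarrow> bool" where
  "affine_isometry I \<longleftrightarrow> (\<exists>T a. orthogonal_transformation T \<and> I = (\<lambda>z. T z + a))"

definition lipschitz_boundary :: "'m::finite pt set \<Rightarrow> bool" where
  "lipschitz_boundary D \<longleftrightarrow>
     (\<forall>x \<in> frontier D. \<exists>\<epsilon>>0. \<exists>I. \<exists>f :: real ^ 'm \<Rightarrow> real. \<exists>L.
        affine_isometry I \<and> I x = 0 \<and> L-lipschitz_on UNIV f \<and> f 0 = 0 \<and>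
        I ` (D \<inter> ball x \<epsilon>) = {z \<in> ball 0 \<epsilon>. snd z > f (fst z)})"

text \<open>
  A regular \<open>C\<^sup>1\<close> parametrization \<open>\<phi>\<close>, with derivative \<open>\<phi>'\<close>, of a relatively open piece \<open>\<phi> ` U\<close> of
  the hypersurface \<open>S\<close>.
\<close>

definition C1_parametrization ::
  "'m::finite pt set \<Rightarrow> (real ^ 'm) set \<Rightarrow> (real ^ 'm \<Rightarrow> 'm pt) \<Rightarrow>
     (real ^ 'm \<Rightarrow> (real ^ 'm) \<Rightarrow>\<^sub>L 'm pt) \<Rightarrow> bool" where
  "C1_parametrization S U \<phi> \<phi>' \<longleftrightarrow>
     open U \<and> openin (top_of_set S) (\<phi> ` U) \<and> (\<exists>\<psi>. homeomorphism U (\<phi> ` U) \<phi> \<psi>) \<and>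
     (\<forall>u\<in>U. (\<phi> has_derivative blinfun_apply (\<phi>' u)) (at u)) \<and> continuous_on U \<phi>' \<and>
     (\<forall>u\<in>U. inj (blinfun_apply (\<phi>' u)))"

definition has_local_C1_parametrization :: "'m::finite pt set \<Rightarrow> 'm pt \<Rightarrow> bool" where
  "has_local_C1_parametrization S x \<longleftrightarrow> (\<exists>U \<phi> \<phi>'. C1_parametrization S U \<phi> \<phi>' \<and> x \<in> \<phi> ` U)"

text \<open>\<open>R\<close> is an admissible choice of the set of regular boundary points of \<open>D\<close>.\<close>

definition regular_part :: "'m::finite pt set \<Rightarrow> 'm pt set \<Rightarrow> bool" where
  "regular_part D R \<longleftrightarrow>
     openin (top_of_set (frontier D)) R \<and>
     (\<forall>x\<in>R. has_local_C1_parametrization (frontier D) x) \<and>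
     emeasure hausdorff_surface (frontier D - R) = 0"

definition orthogonal_to_tangent_space :: "'m::finite pt set \<Rightarrow> 'm pt \<Rightarrow> 'm pt \<Rightarrow> bool" where
  "orthogonal_to_tangent_space S x n \<longleftrightarrow>
     (\<exists>U \<phi> \<phi>' u. C1_parametrization S U \<phi> \<phi>' \<and> u \<in> U \<and> \<phi> u = x \<and>
        (\<forall>v. n \<bullet> blinfun_apply (\<phi>' u) v = 0))"

definition is_inner_normal :: "'m::finite pt set \<Rightarrow> 'm pt \<Rightarrow> 'm pt \<Rightarrow> bool" where
  "is_inner_normal D x n \<longleftrightarrow>
     norm n = 1 \<and> orthogonal_to_tangent_space (frontier D) x n \<and>
     (\<exists>\<delta>>0. \<forall>t\<in>{0<..<\<delta>}. x + t *\<^sub>R n \<in> D)"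

definition inner_normal :: "'m::finite pt set \<Rightarrow> 'm pt \<Rightarrow> 'm pt" where
  "inner_normal D x = (THE n. is_inner_normal D x n)"


subsection \<open>The random chord\<close>

definition visible :: "'m::finite pt set \<Rightarrow> 'm pt \<Rightarrow> 'm pt \<Rightarrow> bool" where
  "visible D x y \<longleftrightarrow> x \<noteq> y \<and> open_segment x y \<subseteq> D"

text \<open>
  The constant \<open>\<gamma>\<^sub>d\<close>.  Any unit vector \<open>e\<close> gives the same value, since the surface measure is
  rotation invariant; with the coordinates split as above, the convenient coordinate vector is the
  last one.
\<close>

definition e_vec :: "'m::finite pt" where
  "e_vec = (0, 1)"

definition half_sphere :: "'m::finite pt set" where
  "half_sphere = {w \<in> sphere 0 1. e_vec \<bullet> w > 0}"

definition gamma_const :: "'m::finite itself \<Rightarrow> real" where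
  "gamma_const _ = inverse (LINT u:half_sphere|(hausdorff_surface :: 'm pt measure). u \<bullet> e_vec)"

text \<open>The exponent below is \<open>d + 1\<close>.\<close>

definition K_tilde :: "'m::finite pt set \<Rightarrow> 'm pt set \<Rightarrow> 'm pt \<Rightarrow> 'm pt \<Rightarrow> real" where
  "K_tilde D R x y =
     (if x \<in> R \<and> y \<in> R \<and> visible D x y
      then gamma_const TYPE('m) * ((y - x) \<bullet> inner_normal D x) * ((x - y) \<bullet> inner_normal D y)
             / norm (x - y) ^ (DIM('m pt) + 1)
      else 0)"

definition random_chord ::
  "'w measure \<Rightarrow> 'm::finite pt set \<Rightarrow> 'm pt set \<Rightarrow> ('w \<Rightarrow> 'm pt) \<Rightarrow> ('w \<Rightarrow> 'm pt) \<Rightarrow> bool" where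
  "random_chord M D R X Y \<longleftrightarrow>
     distributed M (boundary_measure D \<Otimes>\<^sub>M boundary_measure D) (\<lambda>\<omega>. (X \<omega>, Y \<omega>))
       (\<lambda>(x, y). ennreal (K_tilde D R x y / measure hausdorff_surface (frontier D)))"

text \<open>
  End points of the intersection of the segment from \<open>x\<close> to \<open>y\<close> with the convex set \<open>E\<close>, in the
  direction from \<open>x\<close> to \<open>y\<close>.  They are meaningful only if the intersection is nonempty.
\<close>

definition segment_times :: "'m::finite pt set \<Rightarrow> 'm pt \<Rightarrow> 'm pt \<Rightarrow> real set" where
  "segment_times E x y = {t \<in> {0..1}. x + t *\<^sub>R (y - x) \<in> E}"

definition entry_point :: "'m::finite pt set \<Rightarrow> 'm pt \<Rightarrow> 'm pt \<Rightarrow> 'm pt" where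
  "entry_point E x y = x + Inf (segment_times E x y) *\<^sub>R (y - x)"

definition exit_point :: "'m::finite pt set \<Rightarrow> 'm pt \<Rightarrow> 'm pt \<Rightarrow> 'm pt" where
  "exit_point E x y = x + Sup (segment_times E x y) *\<^sub>R (y - x)"

definition hits :: "'w measure \<Rightarrow> ('w \<Rightarrow> 'm::finite pt) \<Rightarrow> ('w \<Rightarrow> 'm pt) \<Rightarrow> 'm pt set \<Rightarrow> 'w set" where
  "hits M X Y E = {\<omega> \<in> space M. closed_segment (X \<omega>) (Y \<omega>) \<inter> E \<noteq> {}}"

end

theory Submission
  imports Defs
begin

text \<open>
  A chord of \<open>D\<close> is determined by its line and, along a line that meets \<open>D\<close> in several
  intervals, by one of these.  Parametrise the non-horizontal lines by a direction \<open>(u, 1)\<close> and the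
  point \<open>(v, 0)\<close>.  For fixed \<open>x\<close>, passing from the other end point \<open>y\<close> to \<open>u\<close> absorbs the cosine
  at \<open>y\<close>; for fixed \<open>u\<close>, passing from \<open>x\<close> to \<open>v\<close> absorbs the cosine at \<open>x\<close>.  Hence the law of the
  random chord is a constant times the measure
  \<open>norm (u, 1) ^ - (d + 1) du dv\<close> on oriented lines, which does not depend on the domain.  A line
  that meets the convex set \<open>D'\<close> carries exactly one chord of \<open>D\<close> that meets \<open>D'\<close>, and exactly one
  chord of \<open>D'\<close>; so the chord induced on \<open>D'\<close> and the random chord of \<open>D'\<close> are images of the same
  measure on lines, up to normalisation.  Both changes of variables rest on an area formula on the
  regular part of the boundary; the irregular part is null and so are its Lipschitz images.
\<close>

section \<open>Hausdorff measure\<close>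

text \<open>Two normalising constants are never evaluated. Hausdorff measure on
  \<open>real ^ 'm\<close> is only shown to be a positive multiple of Lebesgue measure; the factor
  does no harm because lines are integrated against Hausdorff measure too. Likewise
  \<open>gamma_const\<close> is not compared with an integral over directions: its value is forced
  by the fact that the law of the given chord has mass 1.

  The power d + 1 arises from \<open>y - x = \<tau> *\<^sub>R (u, 1)\<close>. The Jacobian of the
  passage from \<open>y\<close> to \<open>u\<close> takes up d powers of \<tau> and the cosine at
  \<open>y\<close>, the cosine at \<open>x\<close> gives one power of \<tau> back, and
  \<open>norm (u, 1)\<close> alone is left.

  Directions \<open>(u, 1)\<close> describe only chords that rise in the last coordinate. Falling
  chords are rising ones reversed, and horizontal chords form a null set.

  The boundary has a normal only at regular points, and there continuity is available for the
  modulus of \<open>nv x \<bullet> z\<close>. Hence all densities are written with absolute values,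
  and signs are recovered from visibility.\<close>

lemma diameter_leI:
  assumes "S \<noteq> {}" "\<And>x y. x \<in> S \<Longrightarrow> y \<in> S \<Longrightarrow> dist x y \<le> d"
  shows "diameter S \<le> d"
  unfolding diameter_def using assms by (auto intro!: cSUP_least)

lemma hausdorff_gauge_mono:
  assumes "C \<subseteq> C'" "bounded C'"
  shows "hausdorff_gauge s C \<le> hausdorff_gauge s C'"
  using assms
  by (auto simp: hausdorff_gauge_def intro!: ennreal_leI mult_left_mono power_mono diameter_subset
      diameter_ge_0 intro: bounded_subset)

lemma hausdorff_content_le:
  assumes "A \<subseteq> (\<Union>i. C i)" "\<And>i. bounded (C i)" "\<And>i. diameter (C i) \<le> \<delta>"
  shows "hausdorff_content s \<delta> A \<le> (\<Sum>i. hausdorff_gauge s (C i))"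
  unfolding hausdorff_content_def using assms by (intro INF_lower) auto

lemma hausdorff_content_greatest:
  assumes "\<And>C. A \<subseteq> (\<Union>i. C i) \<Longrightarrow> (\<And>i. bounded (C i)) \<Longrightarrow> (\<And>i. diameter (C i) \<le> \<delta>) \<Longrightarrow>
    c \<le> (\<Sum>i. hausdorff_gauge s (C i))"
  shows "c \<le> hausdorff_content s \<delta> A"
  unfolding hausdorff_content_def using assms by (intro INF_greatest) auto

lemma hausdorff_content_mono: "A \<subseteq> B \<Longrightarrow> hausdorff_content s \<delta> A \<le> hausdorff_content s \<delta> B"
  by (intro hausdorff_content_greatest hausdorff_content_le) auto

lemma hausdorff_content_antimono: "\<delta> \<le> \<delta>' \<Longrightarrow> hausdorff_content s \<delta>' A \<le> hausdorff_content s \<delta> A"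
  by (intro hausdorff_content_greatest hausdorff_content_le) (auto intro: order_trans)

text \<open>Coverings of the \<open>A n\<close> that are optimal up to
  \<open>e * (1/2) ^ Suc n\<close>, enumerated together along \<open>prod_decode\<close>, cover the
  union at total excess \<open>e\<close>.\<close>

lemma hausdorff_content_subadditive:
  "hausdorff_content s \<delta> (\<Union>n. A n) \<le> (\<Sum>n. hausdorff_content s \<delta> (A n))"
proof (rule ennreal_le_epsilon)
  fix e :: real
  assume e: "0 < e" and "(\<Sum>n. hausdorff_content s \<delta> (A n)) < top"
  then have *: "hausdorff_content s \<delta> (A n) < hausdorff_content s \<delta> (A n) + e * (1/2)^Suc n" for n
    by (auto simp add: less_top dest!: ennreal_suminf_lessD)
  have "\<exists>C. A n \<subseteq> (\<Union>i. C i) \<and> (\<forall>i. bounded (C i) \<and> diameter (C i) \<le> \<delta>) \<and>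
      (\<Sum>i. hausdorff_gauge s (C i)) \<le> hausdorff_content s \<delta> (A n) + e * (1/2)^Suc n" for n
    using *[of n] by (subst (asm) hausdorff_content_def) (auto simp: INF_less_iff intro: less_imp_le)
  then obtain B where B: "\<And>n. A n \<subseteq> (\<Union>i. B n i)" "\<And>n i. bounded (B n i)" "\<And>n i. diameter (B n i) \<le> \<delta>"
      and Ble: "\<And>n. (\<Sum>i. hausdorff_gauge s (B n i)) \<le> hausdorff_content s \<delta> (A n) + e * (1/2)^(Suc n)"
    by metis
  define C where "C = case_prod B o prod_decode"
  have "(\<Union>n. A n) \<subseteq> (\<Union>i. C i)"
    using B(1) by (auto simp add: C_def subset_eq) (metis prod.case prod_encode_inverse)
  then have "hausdorff_content s \<delta> (\<Union>n. A n) \<le> (\<Sum>i. hausdorff_gauge s (C i))"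
    using B by (intro hausdorff_content_le) (auto simp: C_def split_def)
  also have "\<dots> = (\<Sum>n. \<Sum>i. hausdorff_gauge s (B n i))"
    unfolding C_def comp_def by (intro suminf_ennreal_2dimen) auto
  also have "\<dots> \<le> (\<Sum>n. hausdorff_content s \<delta> (A n) + e * (1/2) ^ Suc n)"
    by (intro suminf_le suminf_nonneg allI Ble) auto
  also have "... = (\<Sum>n. hausdorff_content s \<delta> (A n)) + (\<Sum>n. ennreal e * ennreal ((1/2) ^ Suc n))"
    using \<open>0 < e\<close> by (subst suminf_add[symmetric])
                     (auto simp del: ennreal_suminf_cmult simp add: ennreal_mult[symmetric])
  also have "\<dots> = (\<Sum>n. hausdorff_content s \<delta> (A n)) + e"
    unfolding ennreal_suminf_cmult
    by (subst suminf_ennreal_eq[OF zero_le_power power_half_series]) auto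
  finally show "hausdorff_content s \<delta> (\<Union>n. A n) \<le> (\<Sum>n. hausdorff_content s \<delta> (A n)) + e" .
qed

lemma hausdorff_content_le_outer: "0 < \<delta> \<Longrightarrow> hausdorff_content s \<delta> A \<le> hausdorff_outer s A"
  unfolding hausdorff_outer_def by (intro SUP_upper) auto

lemma hausdorff_outer_least:
  "(\<And>\<delta>. 0 < \<delta> \<Longrightarrow> hausdorff_content s \<delta> A \<le> c) \<Longrightarrow> hausdorff_outer s A \<le> c"
  unfolding hausdorff_outer_def by (intro SUP_least) auto

lemma hausdorff_outer_mono: "A \<subseteq> B \<Longrightarrow> hausdorff_outer s A \<le> hausdorff_outer s B"
  by (meson hausdorff_outer_least hausdorff_content_le_outer hausdorff_content_mono order_trans)

lemma hausdorff_outer_subadditive: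
  "hausdorff_outer s (\<Union>n. A n) \<le> (\<Sum>n. hausdorff_outer s (A n))"
proof (rule hausdorff_outer_least)
  fix \<delta> :: real assume "0 < \<delta>"
  have "hausdorff_content s \<delta> (\<Union>n. A n) \<le> (\<Sum>n. hausdorff_content s \<delta> (A n))"
    by (rule hausdorff_content_subadditive)
  also have "\<dots> \<le> (\<Sum>n. hausdorff_outer s (A n))"
    by (intro suminf_le hausdorff_content_le_outer \<open>0 < \<delta>\<close>) auto
  finally show "hausdorff_content s \<delta> (\<Union>n. A n) \<le> (\<Sum>n. hausdorff_outer s (A n))" .
qed

lemma hausdorff_outer_empty [simp]: "hausdorff_outer s {} = 0"
proof -
  have "hausdorff_outer s ({} :: 'a set) \<le> 0"
  proof (rule hausdorff_outer_least)
    fix \<delta> :: real assume "0 < \<delta>"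
    then have "hausdorff_content s \<delta> ({} :: 'a set) \<le> (\<Sum>i::nat. hausdorff_gauge s ({} :: 'a set))"
      by (intro hausdorff_content_le[where C = "\<lambda>_. {}"]) auto
    then show "hausdorff_content s \<delta> ({} :: 'a set) \<le> 0" by (simp add: hausdorff_gauge_def)
  qed
  then show ?thesis by simp
qed

section \<open>Additivity on Borel sets by Caratheodory's criterion\<close>

lemma outer_measure_space_hausdorff: "outer_measure_space UNIV (hausdorff_outer s)"
  unfolding outer_measure_space_def positive_def increasing_def countably_subadditive_def
  using hausdorff_outer_mono hausdorff_outer_subadditive by auto

lemma hausdorff_outer_Un_le: "hausdorff_outer s (A \<union> B) \<le> hausdorff_outer s A + hausdorff_outer s B"
proof -
  have "(\<Union>n. binaryset A B n) = A \<union> B" by (simp add: UN_binaryset_eq)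
  moreover have "(\<Sum>n. hausdorff_outer s (binaryset A B n)) = hausdorff_outer s A + hausdorff_outer s B"
    by (simp add: suminf_binaryset_eq)
  ultimately show ?thesis using hausdorff_outer_subadditive[of s "binaryset A B"] by simp
qed

text \<open>A covering set of diameter below \<open>d\<close> meets at most one of \<open>A\<close>
  and \<open>B\<close>, so an admissible covering of the union splits into coverings of the two sets
  without sharing any member.\<close>

lemma hausdorff_content_separated:
  assumes d: "\<And>x y. x \<in> A \<Longrightarrow> y \<in> B \<Longrightarrow> d \<le> dist x y" and \<delta>: "\<delta> < d"
  shows "hausdorff_content s \<delta> A + hausdorff_content s \<delta> B \<le> hausdorff_content s \<delta> (A \<union> B)"
proof (rule hausdorff_content_greatest)
  fix C :: "nat \<Rightarrow> 'a set"
  assume C: "A \<union> B \<subseteq> (\<Union>i. C i)" "\<And>i. bounded (C i)" "\<And>i. diameter (C i) \<le> \<delta>"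
  define CA where "CA i = C i \<inter> A" for i
  define CB where "CB i = C i \<inter> B" for i
  have diam: "diameter (C i \<inter> S) \<le> \<delta>" for i S
    using C diameter_subset[of "C i \<inter> S" "C i"] by (meson inf_le1 order_trans)
  have "hausdorff_content s \<delta> A \<le> (\<Sum>i. hausdorff_gauge s (CA i))"
    using C diam by (intro hausdorff_content_le) (auto simp: CA_def bounded_Int)
  moreover have "hausdorff_content s \<delta> B \<le> (\<Sum>i. hausdorff_gauge s (CB i))"
    using C diam by (intro hausdorff_content_le) (auto simp: CB_def bounded_Int)
  moreover have "hausdorff_gauge s (CA i) + hausdorff_gauge s (CB i) \<le> hausdorff_gauge s (C i)" for i
  proof -
    have "CA i = {} \<or> CB i = {}"
    proof (rule ccontr)
      assume "\<not> ?thesis"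
      then obtain x y where "x \<in> C i" "x \<in> A" "y \<in> C i" "y \<in> B" by (auto simp: CA_def CB_def)
      then have "d \<le> dist x y" "dist x y \<le> diameter (C i)"
        using d C(2) by (auto intro: diameter_bounded_bound)
      then show False using C(3)[of i] \<delta> by linarith
    qed
    moreover have "hausdorff_gauge s (CA i) \<le> hausdorff_gauge s (C i)"
      "hausdorff_gauge s (CB i) \<le> hausdorff_gauge s (C i)"
      using C(2) by (auto intro!: hausdorff_gauge_mono simp: CA_def CB_def)
    moreover have "hausdorff_gauge s ({} :: 'a set) = 0" by (simp add: hausdorff_gauge_def)
    ultimately show ?thesis by auto
  qed
  then have "(\<Sum>i. hausdorff_gauge s (CA i)) + (\<Sum>i. hausdorff_gauge s (CB i)) \<le> (\<Sum>i. hausdorff_gauge s (C i))"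
    by (subst suminf_add) (auto intro!: suminf_le)
  ultimately show "hausdorff_content s \<delta> A + hausdorff_content s \<delta> B \<le> (\<Sum>i. hausdorff_gauge s (C i))"
    by (meson add_mono order_trans)
qed

lemma hausdorff_outer_separated:
  assumes d: "\<And>x y. x \<in> A \<Longrightarrow> y \<in> B \<Longrightarrow> d \<le> dist x y" and "0 < d"
  shows "hausdorff_outer s A + hausdorff_outer s B \<le> hausdorff_outer s (A \<union> B)"
proof -
  \<comment> \<open>With two independent scales the two suprema can be taken one after the
    other.\<close>
  have main: "hausdorff_content s \<delta> A + hausdorff_content s \<delta>' B \<le> hausdorff_outer s (A \<union> B)"
    if "0 < \<delta>" "0 < \<delta>'" for \<delta> \<delta>'
  proof -
    define r where "r = min (min \<delta> \<delta>') (d/2)"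
    have r: "0 < r" "r < d" "r \<le> \<delta>" "r \<le> \<delta>'" using that \<open>0 < d\<close> by (auto simp: r_def)
    have "hausdorff_content s \<delta> A + hausdorff_content s \<delta>' B \<le> hausdorff_content s r A + hausdorff_content s r B"
      using r by (intro add_mono hausdorff_content_antimono)
    also have "\<dots> \<le> hausdorff_content s r (A \<union> B)" using d r by (intro hausdorff_content_separated) auto
    also have "\<dots> \<le> hausdorff_outer s (A \<union> B)" using r by (intro hausdorff_content_le_outer)
    finally show ?thesis .
  qed
  have "hausdorff_outer s A + hausdorff_content s \<delta>' B \<le> hausdorff_outer s (A \<union> B)" if "0 < \<delta>'" for \<delta>'
    unfolding hausdorff_outer_def[of s A] 
    by (subst ennreal_SUP_add_left[symmetric]) (auto intro!: SUP_least main that)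
  then show ?thesis
    unfolding hausdorff_outer_def[of s B]
    by (subst ennreal_SUP_add_right) (auto intro!: SUP_least)
qed

text \<open>The part of a set off a closed set \<open>F\<close> is exhausted by pieces at positive distance from \<open>F\<close>:
  alternate shells around \<open>F\<close> are separated, so the measures of all shells are summable.\<close>

lemma hausdorff_outer_closed_caratheodory:
  fixes F :: "'a::metric_space set"
  assumes "closed F"
  shows "hausdorff_outer s (X \<inter> F) + hausdorff_outer s (X - F) \<le> hausdorff_outer s X"
proof (cases "F = {} \<or> hausdorff_outer s X = \<infinity>")
  case False
  then have F: "F \<noteq> {}" and fin: "hausdorff_outer s X < \<infinity>" by (auto simp: less_top)
  define \<mu> :: "'a set \<Rightarrow> ennreal" where "\<mu> = hausdorff_outer s"
  have mono: "\<mu> A \<le> \<mu> B" if "A \<subseteq> B" for A B :: "'a set" using that by (simp add: \<mu>_def hausdorff_outer_mono)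
  have sep: "\<mu> A + \<mu> B \<le> \<mu> (A \<union> B)" if "\<And>x y. x \<in> A \<Longrightarrow> y \<in> B \<Longrightarrow> d \<le> dist x y" "0 < d" for A B :: "'a set" and d
    unfolding \<mu>_def by (rule hausdorff_outer_separated[OF that])
  define B where "B n = {x\<in>X. infdist x F \<ge> 1 / (real n + 1)}" for n
  define S where "S k = {x\<in>X. 1 / (real k + 2) \<le> infdist x F \<and> infdist x F < 1 / (real k + 1)}" for k
  have infd: "infdist x F - infdist y F \<le> dist x y" for x y
    using infdist_triangle[of x F y] by linarith
  \<comment> \<open>Only every second shell is used: between the shells with \<open>k < K\<close>
    and the shell \<open>2*K+j\<close> lies the whole shell \<open>2*K+j-1\<close>, whose width
    \<open>?e\<close> separates them.\<close>
  have step: "(\<Sum>k<K. \<mu> (S (2*k+j))) \<le> \<mu> (\<Union>k<K. S (2*k+j))" for K j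
  proof (induction K)
    case 0 then show ?case by (simp add: \<mu>_def)
  next
    case (Suc K)
    let ?d = "1 / (2 * real K + real j + 1 ) - 1 / (2 * real K + real j + 2)"
    have "\<mu> (\<Union>k<K. S (2*k+j)) + \<mu> (S (2*K+j)) \<le> \<mu> ((\<Union>k<K. S (2*k+j)) \<union> S (2*K+j))"
      if "K \<noteq> 0"
    proof (rule sep)
      let ?e = "1 / (2 * real K + real j) - 1 / (2 * real K + real j + 1)"
      show "0 < ?e" using that by (simp add: divide_strict_left_mono add_pos_nonneg)
      fix x y assume "x \<in> (\<Union>k<K. S (2*k+j))" "y \<in> S (2*K+j)"
      then obtain k where k: "k < K" "x \<in> S (2*k+j)" by auto
      have "1 / (2 * real K + real j) \<le> 1 / (2 * real k + real j + 2)"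
        using k(1) by (intro divide_left_mono) auto
      then have "1 / (2 * real K + real j) \<le> infdist x F" using k(2) by (auto simp: S_def)
      moreover have "infdist y F < 1 / (2 * real K + real j + 1)" using \<open>y \<in> _\<close> by (auto simp: S_def)
      ultimately show "?e \<le> dist x y" using infd[of x y] by linarith
    qed
    moreover have "(\<Union>k<Suc K. S (2*k+j)) = (\<Union>k<K. S (2*k+j)) \<union> S (2*K+j)" by (auto simp: less_Suc_eq)
    ultimately show ?case using Suc
      by (cases "K = 0") (auto intro: order_trans[OF add_right_mono])
  qed
  have split2: "(\<Sum>k<2*K. \<mu> (S k)) = (\<Sum>k<K. \<mu> (S (2*k+0))) + (\<Sum>k<K. \<mu> (S (2*k+1)))" for K
    by (induction K) (auto simp: algebra_simps)
  \<comment> \<open>The even and the odd shells contribute at most \<open>\<mu> X\<close>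
    each.\<close>
  have sumfin: "(\<Sum>k. \<mu> (S k)) \<le> 2 * \<mu> X"
  proof (rule suminf_le_const)
    fix n
    have "(\<Sum>k<n. \<mu> (S k)) \<le> (\<Sum>k<2*n. \<mu> (S k))" by (intro sum_mono2) auto
    also have "\<dots> \<le> \<mu> X + \<mu> X"
      unfolding split2 by (intro add_mono order_trans[OF step] mono) (auto simp: S_def)
    finally show "(\<Sum>k<n. \<mu> (S k)) \<le> 2 * \<mu> X" by (simp add: mult_2)
  qed simp
  have finS: "(\<Sum>k. \<mu> (S k)) < \<infinity>"
    using sumfin fin by (auto simp: \<mu>_def ennreal_mult_less_top intro: le_less_trans)
  then have "\<mu> (S k) < \<infinity>" for k
    using ennreal_suminf_lessD[of "\<lambda>k. \<mu> (S k)" \<infinity>] by auto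
  then have Sk: "\<mu> (S k) = ennreal (enn2real (\<mu> (S k)))" for k by (simp add: less_top)
  have summ: "summable (\<lambda>k. enn2real (\<mu> (S k)))"
    using finS by (intro summable_suminf_not_top) (auto simp: Sk[symmetric] less_top)
  have XF: "X - F \<subseteq> B n \<union> (\<Union>k. S (k + n))" for n
  proof
    fix x assume x: "x \<in> X - F"
    have pos: "infdist x F > 0" 
      using x F \<open>closed F\<close> by (metis DiffD2 in_closed_iff_infdist_zero infdist_nonneg less_eq_real_def)
    show "x \<in> B n \<union> (\<Union>k. S (k + n))"
    proof (cases "x \<in> B n")
      case False
      then have lt: "infdist x F < 1 / (real n + 1)" using x by (auto simp: B_def)
      \<comment> \<open>The shell of \<open>x\<close> is the first one whose inner radius does not
        exceed the distance of \<open>x\<close> from \<open>F\<close>; since \<open>x\<close> is not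
        in \<open>B n\<close>, its index is at least \<open>n\<close>.\<close>
      define m where "m = (LEAST m. 1 / (real m + 2) \<le> infdist x F)"
      obtain m0 where "1 / (real m0 + 1) < infdist x F"
        using pos reals_Archimedean[of "infdist x F"] by (auto simp: inverse_eq_divide add.commute)
      then have "1 / (real m0 + 2) \<le> infdist x F"
        by (smt (verit) divide_left_mono mult_pos_pos of_nat_0_le_iff)
      then have m: "1 / (real m + 2) \<le> infdist x F" unfolding m_def by (rule LeastI)
      have nm: "n \<le> m"
      proof (rule ccontr)
        assume "\<not> n \<le> m"
        then have "1 / (real n + 1) \<le> 1 / (real m + 2)" by (intro divide_left_mono) auto
        then show False using m lt by linarith
      qed
      have "infdist x F < 1 / (real m + 1)"
      proof (cases "m = n")
        case False
        then obtain m' where m': "m = Suc m'" "n \<le> m'" using nm by (cases m) auto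
        then have "\<not> 1 / (real m' + 2) \<le> infdist x F" unfolding m_def by (metis lessI not_less_Least)
        then show ?thesis using m' by (auto simp: algebra_simps)
      qed (use lt in auto)
      then have "x \<in> S ((m - n) + n)" using m nm x by (auto simp: S_def)
      then show ?thesis by blast
    qed simp
  qed
  have B: "\<mu> (X \<inter> F) + \<mu> (B n) \<le> \<mu> X" for n
  proof -
    have "\<mu> (B n) + \<mu> (X \<inter> F) \<le> \<mu> (B n \<union> (X \<inter> F))"
    proof (rule sep)
      fix x y assume "x \<in> B n" "y \<in> X \<inter> F"
      then have "1 / (real n + 1) \<le> infdist x F" "infdist x F \<le> dist x y"
        by (auto simp: B_def intro: infdist_le)
      then show "1 / (real n + 1) \<le> dist x y" by linarith
    qed auto
    also have "\<dots> \<le> \<mu> X" by (intro mono) (auto simp: B_def)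
    finally show ?thesis by (simp add: add.commute)
  qed
  have "\<mu> (X \<inter> F) + \<mu> (X - F) \<le> \<mu> X"
  proof (rule ennreal_le_epsilon)
    fix e :: real assume "0 < e"
    obtain N where N: "\<And>n. n \<ge> N \<Longrightarrow> norm (\<Sum>i. enn2real (\<mu> (S (i + n)))) < e"
      using suminf_exist_split[OF \<open>0 < e\<close> summ] by auto
    have "\<mu> (X - F) \<le> \<mu> (B N \<union> (\<Union>k. S (k + N)))" using XF by (intro mono)
    also have "\<dots> \<le> \<mu> (B N) + \<mu> (\<Union>k. S (k + N))" unfolding \<mu>_def by (rule hausdorff_outer_Un_le)
    also have "\<dots> \<le> \<mu> (B N) + (\<Sum>k. \<mu> (S (k + N)))"
      unfolding \<mu>_def by (intro add_left_mono hausdorff_outer_subadditive)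
    also have "(\<Sum>k. \<mu> (S (k + N))) = ennreal (\<Sum>k. enn2real (\<mu> (S (k + N))))"
      using summ by (subst Sk) (intro suminf_ennreal2 summable_ignore_initial_segment, auto)
    also have "\<dots> \<le> ennreal e" using N[of N] by (intro ennreal_leI) auto
    finally have "\<mu> (X - F) \<le> \<mu> (B N) + ennreal e" by simp
    then have "\<mu> (X \<inter> F) + \<mu> (X - F) \<le> \<mu> (X \<inter> F) + \<mu> (B N) + ennreal e"
      by (simp add: add.assoc add_left_mono)
    also have "\<dots> \<le> \<mu> X + ennreal e" by (intro add_right_mono B)
    finally show "\<mu> (X \<inter> F) + \<mu> (X - F) \<le> \<mu> X + ennreal e" .
  qed
  then show ?thesis by (simp add: \<mu>_def)
qed auto

lemma borel_subset_hausdorff_lambda_system: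
  "sets (borel :: 'a::metric_space measure) \<subseteq> lambda_system UNIV UNIV (hausdorff_outer s)"
proof -
  interpret L: sigma_algebra UNIV "UNIV :: 'a set set" by (rule sigma_algebra_Pow[of UNIV, simplified])
  have ms: "measure_space UNIV (lambda_system UNIV UNIV (hausdorff_outer s :: 'a set \<Rightarrow> _)) (hausdorff_outer s)"
    using L.caratheodory_lemma[OF outer_measure_space_hausdorff] .
  then have sa: "sigma_algebra UNIV (lambda_system UNIV UNIV (hausdorff_outer s :: 'a set \<Rightarrow> _))"
    by (simp add: measure_space_def)
  have "F \<in> lambda_system UNIV UNIV (hausdorff_outer s)" if "closed F" for F :: "'a set"
  proof -
    have "hausdorff_outer s (X \<inter> F) + hausdorff_outer s (X - F) = hausdorff_outer s X" for X
      using hausdorff_outer_closed_caratheodory[OF that, of s X]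
        hausdorff_outer_Un_le[of s "X \<inter> F" "X - F"] by (simp add: Int_Diff_Un)
    then show ?thesis by (simp add: L.lambda_system_eq)
  qed
  then have "sigma_sets UNIV (Collect closed) \<subseteq> lambda_system UNIV UNIV (hausdorff_outer s :: 'a set \<Rightarrow> _)"
    by (intro sigma_algebra.sigma_sets_subset[OF sa]) auto
  then show ?thesis by (simp add: borel_eq_closed)
qed

lemma space_hausdorff_measure [simp]: "space (hausdorff_measure s) = UNIV"
  by (simp add: hausdorff_measure_def space_measure_of_conv)

lemma sets_hausdorff_measure [simp, measurable_cong]: "sets (hausdorff_measure s) = sets borel"
  unfolding hausdorff_measure_def using sets.sigma_sets_eq[of borel] by (subst sets_measure_of) auto

text \<open>\<open>measure_of\<close> yields the zero measure unless the given function is countably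
  additive on the sigma-algebra, so the definition of \<open>hausdorff_measure\<close> gets its
  content only through the Caratheodory property of Borel sets.\<close>

lemma emeasure_hausdorff_measure:
  fixes A :: "'a::metric_space set"
  assumes "A \<in> sets borel"
  shows "emeasure (hausdorff_measure s) A = hausdorff_outer s A"
proof -
  interpret L: sigma_algebra UNIV "UNIV :: 'a set set" by (rule sigma_algebra_Pow[of UNIV, simplified])
  have ms: "measure_space UNIV (lambda_system UNIV UNIV (hausdorff_outer s :: 'a set \<Rightarrow> _)) (hausdorff_outer s)"
    using L.caratheodory_lemma[OF outer_measure_space_hausdorff] .
  have "measure_space UNIV (sets borel) (hausdorff_outer s :: 'a set \<Rightarrow> _)"
    by (rule measure_down[OF ms _ borel_subset_hausdorff_lambda_system])
       (use sets.sigma_algebra_axioms[of borel] in simp)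
  then show ?thesis
    unfolding hausdorff_measure_def using assms
    by (intro emeasure_measure_of_sigma) (auto simp: measure_space_def)
qed

text \<open>The bound on \<open>f\<close> holds only on \<open>A\<close>, so covering sets are cut
  down to \<open>A\<close> before they are mapped. Dividing by \<open>L ^ s\<close> turns the claim
  into a lower bound for an infimum over coverings.\<close>

lemma hausdorff_content_lipschitz_image:
  fixes f :: "'a::metric_space \<Rightarrow> 'b::metric_space"
  assumes L: "0 < L" and f: "\<And>x y. x \<in> A \<Longrightarrow> y \<in> A \<Longrightarrow> dist (f x) (f y) \<le> L * dist x y"
  shows "hausdorff_content s (L * \<delta>) (f ` A) \<le> ennreal (L ^ s) * hausdorff_content s \<delta> A"
proof -
  have "hausdorff_content s (L * \<delta>) (f ` A) / ennreal (L ^ s) \<le> hausdorff_content s \<delta> A"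
  proof (rule hausdorff_content_greatest)
    fix C :: "nat \<Rightarrow> 'a set"
    assume C: "A \<subseteq> (\<Union>i. C i)" "\<And>i. bounded (C i)" "\<And>i. diameter (C i) \<le> \<delta>"
    have dist: "dist (f x) (f y) \<le> L * diameter (C i)" if "x \<in> C i \<inter> A" "y \<in> C i \<inter> A" for x y i
      using f[of x y] that diameter_bounded_bound[OF C(2), of x i y] L
      by (meson IntD1 IntD2 mult_le_cancel_left_pos order_trans)
    have diam: "diameter (f ` (C i \<inter> A)) \<le> L * diameter (C i)" for i
      using dist L C(2)[of i] diameter_ge_0[OF C(2)[of i]]
      by (cases "C i \<inter> A = {}") (auto intro!: diameter_leI)
    have bdd: "bounded (f ` (C i \<inter> A))" for i
    proof (cases "C i \<inter> A = {}")
      case False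
      then obtain x where x: "x \<in> C i \<inter> A" by auto
      then show ?thesis using dist[OF x] by (auto simp: bounded_def)
    qed auto
    have gauge: "hausdorff_gauge s (f ` (C i \<inter> A)) \<le> ennreal (L ^ s) * hausdorff_gauge s (C i)" for i
    proof (cases "C i \<inter> A = {}")
      case False
      have "unit_ball_vol (real s) * (diameter (f ` (C i \<inter> A)) / 2) ^ s \<le>
          unit_ball_vol (real s) * (L * diameter (C i) / 2) ^ s"
        using diam[of i] bdd[of i] by (intro mult_left_mono power_mono divide_right_mono) 
          (auto intro!: diameter_ge_0)
      also have "\<dots> = L ^ s * (unit_ball_vol (real s) * (diameter (C i) / 2) ^ s)"
        by (simp add: power_mult_distrib power_divide)
      finally have "ennreal (unit_ball_vol (real s) * (diameter (f ` (C i \<inter> A)) / 2) ^ s) \<le>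
          ennreal (L ^ s) * ennreal (unit_ball_vol (real s) * (diameter (C i) / 2) ^ s)"
        using L diameter_ge_0[OF C(2)[of i]] by (subst ennreal_mult[symmetric]) (auto intro!: ennreal_leI)
      then show ?thesis using False by (auto simp: hausdorff_gauge_def)
    qed (simp add: hausdorff_gauge_def)
    have "hausdorff_content s (L * \<delta>) (f ` A) \<le> (\<Sum>i. hausdorff_gauge s (f ` (C i \<inter> A)))"
    proof (rule hausdorff_content_le)
      show "diameter (f ` (C i \<inter> A)) \<le> L * \<delta>" for i
        using diam[of i] C(3)[of i] L by (meson mult_le_cancel_left_pos order_trans)
    qed (use C(1) bdd in \<open>auto, blast\<close>)
    also have "\<dots> \<le> (\<Sum>i. ennreal (L ^ s) * hausdorff_gauge s (C i))"
      by (intro suminf_le gauge) auto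
    finally show "hausdorff_content s (L * \<delta>) (f ` A) / ennreal (L ^ s) \<le> (\<Sum>i. hausdorff_gauge s (C i))"
      using L by (intro divide_le_posI_ennreal) (simp_all add: mult.commute)
  qed
  then have "ennreal (L ^ s) * (hausdorff_content s (L * \<delta>) (f ` A) / ennreal (L ^ s)) \<le>
      ennreal (L ^ s) * hausdorff_content s \<delta> A"
    by (rule mult_left_mono) simp
  then show ?thesis
    using L by (simp add: ennreal_times_divide mult.commute[of "ennreal (L ^ s)"] mult_divide_eq_ennreal)
qed

lemma hausdorff_outer_lipschitz_image:
  fixes f :: "'a::metric_space \<Rightarrow> 'b::metric_space"
  assumes L: "0 < L" and f: "\<And>x y. x \<in> A \<Longrightarrow> y \<in> A \<Longrightarrow> dist (f x) (f y) \<le> L * dist x y"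
  shows "hausdorff_outer s (f ` A) \<le> ennreal (L ^ s) * hausdorff_outer s A"
proof (rule hausdorff_outer_least)
  fix \<delta> :: real assume "0 < \<delta>"
  have "hausdorff_content s (L * (\<delta> / L)) (f ` A) \<le> ennreal (L ^ s) * hausdorff_content s (\<delta> / L) A"
    by (rule hausdorff_content_lipschitz_image[OF assms])
  also have "\<dots> \<le> ennreal (L ^ s) * hausdorff_outer s A"
    using L \<open>0 < \<delta>\<close> by (intro mult_left_mono hausdorff_content_le_outer) auto
  finally show "hausdorff_content s \<delta> (f ` A) \<le> ennreal (L ^ s) * hausdorff_outer s A"
    using L by simp
qed

lemma hausdorff_outer_isometry_image:
  fixes f :: "'a::metric_space \<Rightarrow> 'b::metric_space"
  assumes f: "\<And>x y. x \<in> A \<Longrightarrow> y \<in> A \<Longrightarrow> dist (f x) (f y) = dist x y"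
  shows "hausdorff_outer s (f ` A) = hausdorff_outer s A"
proof (rule antisym)
  show "hausdorff_outer s (f ` A) \<le> hausdorff_outer s A"
    using hausdorff_outer_lipschitz_image[of 1 A f s] f by simp
  have "inj_on f A" using f by (auto simp: inj_on_def) (metis dist_eq_0_iff)
  then have "hausdorff_outer s (the_inv_into A f ` f ` A) \<le> hausdorff_outer s (f ` A)"
    using hausdorff_outer_lipschitz_image[of 1 "f ` A" "the_inv_into A f" s] f
    by (force simp: the_inv_into_f_f)
  then show "hausdorff_outer s A \<le> hausdorff_outer s (f ` A)"
    using \<open>inj_on f A\<close> by (simp add: the_inv_into_onto)
qed

section \<open>Comparison with Lebesgue measure\<close>

text \<open>Coverings are sequences by definition; a finite one is padded with empty sets, whose
  gauge is 0 by convention, also for \<open>s = 0\<close>.\<close>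

lemma hausdorff_content_le_sum:
  assumes I: "finite I" and "A \<subseteq> (\<Union>i\<in>I. C i)" "\<And>i. bounded (C i)" "\<And>i. diameter (C i) \<le> \<delta>" "0 \<le> \<delta>"
  shows "hausdorff_content s \<delta> A \<le> (\<Sum>i\<in>I. hausdorff_gauge s (C i))"
proof -
  obtain e where e: "bij_betw e {..<card I} I"
    using ex_bij_betw_nat_finite[OF I] unfolding atLeast0LessThan by metis
  define C' where "C' n = (if n < card I then C (e n) else {})" for n
  have "(\<Union>i\<in>I. C i) \<subseteq> (\<Union>n. C' n)"
  proof
    fix x assume "x \<in> (\<Union>i\<in>I. C i)"
    then obtain i where i: "i \<in> I" "x \<in> C i" by (rule UN_E)
    then have "i \<in> e ` {..<card I}" by (simp only: bij_betw_imp_surj_on[OF e])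
    then obtain n where "n < card I" "x \<in> C (e n)" using i(2) by (metis imageE lessThan_iff)
    then show "x \<in> (\<Union>n. C' n)" by (intro UN_I[of n]) (auto simp: C'_def)
  qed
  then have "hausdorff_content s \<delta> A \<le> (\<Sum>n. hausdorff_gauge s (C' n))"
    using assms by (intro hausdorff_content_le) (auto simp: C'_def simp del: UN_simps)
  also have "\<dots> = (\<Sum>n<card I. hausdorff_gauge s (C' n))"
    by (intro suminf_finite) (auto simp: C'_def hausdorff_gauge_def)
  also have "\<dots> = (\<Sum>n<card I. hausdorff_gauge s (C (e n)))"
    by (intro sum.cong) (auto simp: C'_def)
  also have "\<dots> = (\<Sum>i\<in>I. hausdorff_gauge s (C i))"
    by (rule sum.reindex_bij_betw[OF e])
  finally show ?thesis .
qed

text \<open>Cutting the cube into \<open>k ^ DIM('a)\<close> equal cubes of diameter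
  \<open>norm One / k\<close> gives the same sum of gauges \<open>c\<close> for every
  \<open>k\<close>, so the bound survives arbitrarily fine scales.\<close>

lemma hausdorff_outer_unit_cube_finite:
  "hausdorff_outer DIM('a) {x::'a::euclidean_space. \<forall>i\<in>Basis. 0 \<le> x \<bullet> i \<and> x \<bullet> i < 1} < \<infinity>"
    (is "hausdorff_outer ?n ?A < _")
proof -
  define c where "c = unit_ball_vol (real ?n) * (norm (One::'a) / 2) ^ ?n"
  have "hausdorff_content ?n \<delta> ?A \<le> ennreal c" if "0 < \<delta>" for \<delta>
  proof -
    obtain k :: nat where k: "norm (One::'a) / \<delta> < k" using reals_Archimedean2 by blast
    moreover have "0 \<le> norm (One::'a) / \<delta>" using that by simp
    ultimately have k0: "0 < real k" by linarith
    define I where "I = (Basis::'a set) \<rightarrow>\<^sub>E {..<k}"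
    define p where "p f = (\<Sum>i\<in>(Basis::'a set). (real (f i) / k) *\<^sub>R i)" for f :: "'a \<Rightarrow> nat"
    define C where "C f = cbox (p f) (p f + (1/k) *\<^sub>R One)" for f
    have diam: "diameter (C f) = norm (One::'a) / k" for f
      unfolding C_def using k0 by (subst diameter_cbox) (auto simp: inner_add_left dist_norm)
    have cov: "?A \<subseteq> (\<Union>f\<in>I. C f)"
    proof
      fix x assume x: "x \<in> ?A"
      define f where "f = (\<lambda>i\<in>Basis. nat \<lfloor>k * (x \<bullet> i)\<rfloor>)"
      have f: "real (f i) \<le> k * (x \<bullet> i)" "k * (x \<bullet> i) < real (f i) + 1" "f i < k" if "i \<in> Basis" for i
      proof -
        have "0 \<le> k * (x \<bullet> i)" "k * (x \<bullet> i) < k" using x that k0 by auto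
        then show "real (f i) \<le> k * (x \<bullet> i)" "k * (x \<bullet> i) < real (f i) + 1" "f i < k"
          using that unfolding f_def by (auto simp: of_nat_nat) linarith+
      qed
      have "f \<in> I" using f by (auto simp: I_def f_def)
      moreover have "x \<in> C f"
        using f k0 by (auto simp: C_def mem_box p_def inner_add_left field_simps less_imp_le)
      ultimately show "x \<in> (\<Union>f\<in>I. C f)" by blast
    qed
    have "hausdorff_content ?n \<delta> ?A \<le> (\<Sum>f\<in>I. hausdorff_gauge ?n (C f))"
    proof (intro hausdorff_content_le_sum cov)
      show "finite I" by (simp add: I_def finite_PiE)
      show "bounded (C f)" for f by (simp add: C_def)
      show "diameter (C f) \<le> \<delta>" for f using k k0 that by (simp add: diam field_simps)
    qed (use that in simp)
    also have "\<dots> \<le> (\<Sum>f\<in>I. ennreal (unit_ball_vol (real ?n) * (norm (One::'a) / k / 2) ^ ?n))"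
      by (intro sum_mono) (auto simp: hausdorff_gauge_def diam)
    also have "\<dots> = ennreal (real (k ^ ?n) * (unit_ball_vol (real ?n) * (norm (One::'a) / k / 2) ^ ?n))"
      by (simp add: I_def card_PiE ennreal_mult'' ennreal_of_nat_eq_real_of_nat flip: ennreal_power)
    also have "real (k ^ ?n) * (unit_ball_vol (real ?n) * (norm (One::'a) / k / 2) ^ ?n) = c"
      using k0 by (simp add: c_def power_divide)
    finally show ?thesis .
  qed
  then have "hausdorff_outer ?n ?A \<le> ennreal c" by (rule hausdorff_outer_least)
  then show ?thesis by (simp add: le_less_trans)
qed

lemma hausdorff_outer_bounded_finite:
  fixes B :: "'a::euclidean_space set"
  assumes "bounded B"
  shows "hausdorff_outer DIM('a) B < \<infinity>"
proof -
  let ?A = "{x::'a. \<forall>i\<in>Basis. 0 \<le> x \<bullet> i \<and> x \<bullet> i < 1}"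
  obtain r where r: "0 < r" "\<And>x. x \<in> B \<Longrightarrow> norm x < r"
    using assms bounded_pos_less by blast
  let ?f = "\<lambda>x::'a. (2 * r) *\<^sub>R x - r *\<^sub>R One"
  have "B \<subseteq> ?f ` ?A"
  proof
    fix x assume x: "x \<in> B"
    have "0 \<le> x \<bullet> i + r \<and> x \<bullet> i + r < 2 * r" if "i \<in> Basis" for i
      using r(2)[OF x] Basis_le_norm[OF that, of x] by linarith
    then have "(x + r *\<^sub>R One) /\<^sub>R (2 * r) \<in> ?A"
      using r(1) by (auto simp: inner_add_left divide_simps)
    moreover have "x = ?f ((x + r *\<^sub>R One) /\<^sub>R (2 * r))" using r(1) by simp
    ultimately show "x \<in> ?f ` ?A" by (rule rev_image_eqI)
  qed
  then have "hausdorff_outer DIM('a) B \<le> hausdorff_outer DIM('a) (?f ` ?A)"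
    by (rule hausdorff_outer_mono)
  also have "\<dots> \<le> ennreal ((2 * r) ^ DIM('a)) * hausdorff_outer DIM('a) ?A"
    using r(1) by (intro hausdorff_outer_lipschitz_image)
      (auto simp: dist_norm simp flip: scaleR_diff_right)
  also have "\<dots> < \<infinity>"
    using hausdorff_outer_unit_cube_finite[where 'a='a] by (simp add: ennreal_mult_less_top)
  finally show ?thesis .
qed

text \<open>A set lies in the ball around any of its points whose radius is its diameter. That ball
  has \<open>2 ^ DIM('a)\<close> times the volume assigned by the gauge. The crude factor is enough
  to exclude that Hausdorff measure vanishes; the sharp factor 1 would require the isodiametric
  inequality.\<close>

lemma emeasure_lborel_le_hausdorff_outer:
  fixes A :: "'a::euclidean_space set"
  shows "emeasure lborel A \<le> ennreal (2 ^ DIM('a)) * hausdorff_outer DIM('a) A"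
proof (cases "A \<in> sets borel")
  case True
  let ?n = "DIM('a)"
  have "emeasure lborel A / ennreal (2 ^ ?n) \<le> hausdorff_content ?n 1 A"
  proof (rule hausdorff_content_greatest)
    fix C :: "nat \<Rightarrow> 'a set"
    assume C: "A \<subseteq> (\<Union>i. C i)" "\<And>i. bounded (C i)" "\<And>i. diameter (C i) \<le> 1"
    define B where "B i = (if C i = {} then {} else cball (SOME x. x \<in> C i) (diameter (C i)))" for i
    have CB: "C i \<subseteq> B i" for i
    proof
      fix x assume x: "x \<in> C i"
      then have "(SOME x. x \<in> C i) \<in> C i" by (rule someI)
      then show "x \<in> B i" using x diameter_bounded_bound[OF C(2)] by (auto simp: B_def)
    qed
    have Bb: "B i \<in> sets borel" for i by (simp add: B_def)
    have "A \<subseteq> (\<Union>i. B i)" using C(1) CB by blast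
    then have "emeasure lborel A \<le> emeasure lborel (\<Union>i. B i)"
      by (rule emeasure_mono) (use Bb in auto)
    also have "\<dots> \<le> (\<Sum>i. emeasure lborel (B i))"
      by (intro emeasure_subadditive_countably) (use Bb in auto)
    also have "\<dots> = (\<Sum>i. ennreal (2 ^ ?n) * hausdorff_gauge ?n (C i))"
    proof (intro suminf_cong)
      fix i
      show "emeasure lborel (B i) = ennreal (2 ^ ?n) * hausdorff_gauge ?n (C i)"
        using diameter_ge_0[OF C(2)[of i]]
        by (auto simp: B_def hausdorff_gauge_def emeasure_cball power_divide field_simps simp flip: ennreal_mult)
    qed
    finally show "emeasure lborel A / ennreal (2 ^ ?n) \<le> (\<Sum>i. hausdorff_gauge ?n (C i))"
      by (intro divide_le_posI_ennreal) (simp_all add: mult.commute)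
  qed
  also have "\<dots> \<le> hausdorff_outer ?n A" by (rule hausdorff_content_le_outer) simp
  finally have "ennreal (2 ^ ?n) * (emeasure lborel A / ennreal (2 ^ ?n)) \<le> ennreal (2 ^ ?n) * hausdorff_outer ?n A"
    by (rule mult_left_mono) simp
  then show ?thesis
    by (simp add: ennreal_times_divide mult.commute[of "ennreal (2 ^ ?n)"] mult_divide_eq_ennreal)
qed (simp add: emeasure_notin_sets)

text \<open>Both sides are \<open>\<integral>\<integral> 1\<^sub>A(x) 1\<^sub>B(x + y) dM(x) dy\<close>, computed in the two orders of integration.\<close>

lemma translation_invariant_measure_unique:
  fixes M :: "'a::euclidean_space measure"
  assumes [measurable_cong]: "sets M = sets borel" and "sigma_finite_measure M"
    and inv: "\<And>a A. A \<in> sets borel \<Longrightarrow> emeasure M {x. x + a \<in> A} = emeasure M A"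
    and [measurable]: "A \<in> sets borel" "B \<in> sets borel"
  shows "emeasure M A * emeasure lborel B = emeasure M B * emeasure lborel A"
proof -
  have sp [simp]: "space M = UNIV" using sets_eq_imp_space_eq[OF assms(1)] by simp
  interpret M: sigma_finite_measure M by fact
  interpret P: pair_sigma_finite M lborel by standard
  have reg: "emeasure lborel {y::'a. x + y \<in> B} = emeasure lborel B" if [measurable]: "B \<in> sets borel" for B x
  proof -
    have "emeasure lborel B = emeasure (distr lborel borel ((+) x)) B" by (simp add: lborel_distr_plus)
    also have "\<dots> = emeasure lborel {y. x + y \<in> B}" by (subst emeasure_distr) (auto simp: vimage_def)
    finally show ?thesis by simp
  qed
  have refl: "emeasure lborel {y::'a. x - y \<in> B} = emeasure lborel B" if [measurable]: "B \<in> sets borel" for B x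
  proof -
    have "(lborel :: 'a measure) = distr lborel borel (\<lambda>y. x - y)"
      using lborel_affine[of "-1" x] by (simp add: density_1)
    then have "emeasure lborel B = emeasure (distr lborel borel (\<lambda>y. x - y)) B" by metis
    also have "\<dots> = emeasure lborel {y. x - y \<in> B}" by (subst emeasure_distr) (auto simp: vimage_def)
    finally show ?thesis by simp
  qed
  \<comment> \<open>Here the invariance of \<open>M\<close> enters, with the shift \<open>y\<close>
    held fixed; \<open>reg\<close> and \<open>refl\<close> are the invariance of Lebesgue measure
    under translations and point reflections.\<close>
  have shift: "(\<integral>\<^sup>+x. indicator A (x - y) * indicator B x \<partial>M) = (\<integral>\<^sup>+x. indicator A x * indicator B (x + y) \<partial>M)" for y
  proof -
    have "(\<integral>\<^sup>+x. indicator A (x - y) * indicator B x \<partial>M) =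
        (\<integral>\<^sup>+x. indicator {x. x - y \<in> A \<and> x \<in> B} x \<partial>M)"
      by (intro nn_integral_cong) (auto simp: indicator_def)
    also have "\<dots> = emeasure M {x. x - y \<in> A \<and> x \<in> B}"
      by (rule nn_integral_indicator) measurable
    also have "\<dots> = emeasure M {x. x + y \<in> {x. x - y \<in> A \<and> x \<in> B}}" by (rule inv[symmetric]) measurable
    also have "\<dots> = (\<integral>\<^sup>+x. indicator {x. x + y \<in> {x. x - y \<in> A \<and> x \<in> B}} x \<partial>M)"
      by (rule nn_integral_indicator[symmetric]) measurable
    also have "\<dots> = (\<integral>\<^sup>+x. indicator A x * indicator B (x + y) \<partial>M)"
      by (intro nn_integral_cong) (auto simp: indicator_def)
    finally show ?thesis .
  qed
  have ind1: "(\<integral>\<^sup>+y. indicator B (x + y) \<partial>lborel) = emeasure lborel {y. x + y \<in> B}" for x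
    by (rule trans[OF nn_integral_cong nn_integral_indicator]) (auto simp: indicator_def)
  have ind2: "(\<integral>\<^sup>+y. indicator A (x - y) \<partial>lborel) = emeasure lborel {y. x - y \<in> A}" for x
    by (rule trans[OF nn_integral_cong nn_integral_indicator]) (auto simp: indicator_def)
  have "emeasure M A * emeasure lborel B = (\<integral>\<^sup>+x. indicator A x * emeasure lborel {y. x + y \<in> B} \<partial>M)"
    by (simp add: reg nn_integral_multc)
  also have "\<dots> = (\<integral>\<^sup>+x. \<integral>\<^sup>+y. indicator A x * indicator B (x + y) \<partial>lborel \<partial>M)"
    by (subst nn_integral_cmult) (simp_all add: ind1)
  also have "\<dots> = (\<integral>\<^sup>+y. \<integral>\<^sup>+x. indicator A x * indicator B (x + y) \<partial>M \<partial>lborel)"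
    by (intro P.Fubini'[symmetric]) measurable
  also have "\<dots> = (\<integral>\<^sup>+y. \<integral>\<^sup>+x. indicator A (x - y) * indicator B x \<partial>M \<partial>lborel)"
    by (simp add: shift)
  also have "\<dots> = (\<integral>\<^sup>+x. \<integral>\<^sup>+y. indicator A (x - y) * indicator B x \<partial>lborel \<partial>M)"
    by (intro P.Fubini') measurable
  also have "\<dots> = (\<integral>\<^sup>+x. emeasure lborel {y. x - y \<in> A} * indicator B x \<partial>M)"
    by (subst nn_integral_multc) (simp_all add: ind2)
  also have "\<dots> = emeasure M B * emeasure lborel A"
    by (simp add: refl nn_integral_multc nn_integral_cmult mult.commute[of _ "emeasure lborel A"])
  finally show ?thesis .
qed

lemma sigma_finite_hausdorff_measure:
  "sigma_finite_measure (hausdorff_measure DIM('a) :: 'a::euclidean_space measure)"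
proof (rule sigma_finite_measure.intro, intro exI conjI ballI)
  let ?A = "range (\<lambda>n::nat. cball (0::'a) (real n))"
  show "countable ?A" "?A \<subseteq> sets (hausdorff_measure DIM('a))" by auto
  show "\<Union> ?A = space (hausdorff_measure DIM('a))" using real_arch_simple by auto
  show "emeasure (hausdorff_measure DIM('a)) a \<noteq> \<infinity>" if "a \<in> ?A" for a
    using that hausdorff_outer_bounded_finite[of a] by (auto simp: emeasure_hausdorff_measure less_top)
qed

text \<open>Hausdorff measure is translation invariant, finite on bounded sets and positive on the
  unit cube. The factor \<open>c\<close> is left open: later statements compare Hausdorff measures
  with each other, so it cancels.\<close>

theorem hausdorff_measure_eq_lborel:
  "\<exists>c>0. (hausdorff_measure DIM('a) :: 'a::euclidean_space measure) = scale_measure (ennreal c) lborel"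
proof -
  let ?H = "hausdorff_measure DIM('a) :: 'a measure"
  let ?Q = "cbox 0 One :: 'a set"
  have fin: "emeasure ?H B < \<infinity>" if "bounded B" "B \<in> sets borel" for B
    using that hausdorff_outer_bounded_finite[of B] by (simp add: emeasure_hausdorff_measure)
  have "sigma_finite_measure ?H" by (rule sigma_finite_hausdorff_measure)
  moreover have "emeasure ?H {x. x + a \<in> A} = emeasure ?H A" if [measurable]: "A \<in> sets borel" for A a
  proof -
    have "hausdorff_outer DIM('a) ((+) a ` {x. x + a \<in> A}) = hausdorff_outer DIM('a) {x. x + a \<in> A}"
      by (rule hausdorff_outer_isometry_image) simp
    moreover have "(+) a ` {x. x + a \<in> A} = A"
    proof (intro equalityI subsetI)
      fix y assume "y \<in> A"
      then show "y \<in> (+) a ` {x. x + a \<in> A}" by (intro image_eqI[of _ _ "y - a"]) auto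
    qed (auto simp: add.commute)
    moreover have "{x. x + a \<in> A} \<in> sets borel" by measurable
    ultimately show ?thesis by (simp add: emeasure_hausdorff_measure)
  qed
  ultimately have eq: "emeasure ?H A = emeasure ?H ?Q * emeasure lborel A" if "A \<in> sets borel" for A
    using translation_invariant_measure_unique[of ?H A ?Q] that by simp
  have Q1: "emeasure lborel ?Q = 1" by simp
  have "1 \<le> ennreal (2 ^ DIM('a)) * emeasure ?H ?Q"
    using emeasure_lborel_le_hausdorff_outer[of ?Q] Q1 by (simp add: emeasure_hausdorff_measure)
  then have "emeasure ?H ?Q \<noteq> 0" by auto
  moreover have "emeasure ?H ?Q < \<infinity>" by (rule fin) auto
  ultimately obtain c where c: "emeasure ?H ?Q = ennreal c" "c > 0"
    by (cases "emeasure ?H ?Q") (auto simp: less_top)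
  have "?H = scale_measure (ennreal c) lborel"
    by (rule measure_eqI) (auto simp: eq[unfolded c(1)])
  then show ?thesis using c by blast
qed

section \<open>Linear images and orthogonal maps\<close>

lemma inj_linear_image_borel:
  fixes f :: "'a::euclidean_space \<Rightarrow> 'b::euclidean_space"
  assumes "linear f" "inj f" and [measurable]: "A \<in> sets borel"
  shows "f ` A \<in> sets borel"
proof -
  obtain g where g: "linear g" "g \<circ> f = id"
    using linear_injective_left_inverse[OF assms(1,2)] by blast
  have [measurable]: "f \<in> borel_measurable borel" "g \<in> borel_measurable borel"
    using assms(1) g(1) by (auto intro!: borel_measurable_continuous_onI linear_continuous_on simp: linear_linear)
  have "f ` A = {z. f (g z) = z \<and> g z \<in> A}"
    using g(2) by (auto simp: fun_eq_iff image_iff) metis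
  also have "\<dots> \<in> sets borel" by measurable
  finally show ?thesis .
qed

text \<open>Hausdorff measure depends on the metric alone, so it is invariant under isometries, and
  Lebesgue measure inherits this as a multiple of it.\<close>

lemma emeasure_lborel_orthogonal_image:
  fixes T :: "'a::euclidean_space \<Rightarrow> 'a"
  assumes T: "orthogonal_transformation T" and A: "A \<in> sets borel"
  shows "emeasure lborel (T ` A) = emeasure lborel A"
proof -
  obtain c where c: "c > 0" "(hausdorff_measure DIM('a) :: 'a measure) = scale_measure (ennreal c) lborel"
    using hausdorff_measure_eq_lborel by blast
  have "T ` A \<in> sets borel"
    using T A by (intro inj_linear_image_borel) (auto simp: orthogonal_transformation_linear orthogonal_transformation_inj)
  moreover have "hausdorff_outer DIM('a) (T ` A) = hausdorff_outer DIM('a) A"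
    using T by (intro hausdorff_outer_isometry_image) (simp add: orthogonal_transformation_isometry)
  ultimately have "ennreal c * emeasure lborel (T ` A) = ennreal c * emeasure lborel A"
    using A c(2) by (metis emeasure_hausdorff_measure emeasure_scale_measure)
  then show ?thesis using c(1) by (simp add: ennreal_mult_cancel_left)
qed

text \<open>The Householder reflection along \<open>n - m\<close>. That it is an involution is
  recorded because it then serves as its own inverse and adjoint in every later change of
  coordinates.\<close>

lemma orthogonal_reflection_exists:
  fixes n m :: "'a::real_inner"
  assumes "norm n = 1" "norm m = 1"
  obtains R where "orthogonal_transformation R" "R n = m" "\<And>z. R (R z) = z"
proof (cases "n = m")
  case True
  then show ?thesis using that[of "\<lambda>z. z"] by simp
next
  case False
  define k where "k = n - m"
  have kk: "k \<bullet> k \<noteq> 0" using False by (simp add: k_def)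
  have nn: "n \<bullet> n = 1" "m \<bullet> m = 1" using assms by (simp_all add: norm_eq_1)
  have k2: "k \<bullet> k = 2 * (n \<bullet> k)"
    unfolding k_def by (simp add: inner_diff nn inner_commute algebra_simps)
  define R where "R z = z - (2 * (z \<bullet> k) / (k \<bullet> k)) *\<^sub>R k" for z
  have lin: "linear R"
    by (rule linearI) (auto simp: R_def inner_add_left algebra_simps add_divide_distrib)
  have "R v \<bullet> R w = v \<bullet> w" for v w
    unfolding R_def using kk by (simp add: inner_diff inner_commute field_simps)
  then have "orthogonal_transformation R" using lin by (simp add: orthogonal_transformation_def)
  moreover have "R n = m" using kk by (simp add: R_def k2) (simp add: k_def)
  moreover have "R (R z) = z" for z
    unfolding R_def using kk by (simp add: inner_diff_left algebra_simps)
  ultimately show ?thesis by (rule that)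
qed

section \<open>Projections of hyperplanes along a direction\<close>

text \<open>The foot, in the hyperplane of height 0, of the line through \<open>z\<close> with
  direction \<open>(u, 1)\<close>.\<close>

definition hproj :: "(real ^ 'm::finite) \<Rightarrow> 'm pt \<Rightarrow> real ^ 'm" where
  "hproj u z = fst z - snd z *\<^sub>R u"

lemma linear_hproj: "linear (hproj u)"
  by (rule linearI) (auto simp: hproj_def algebra_simps)

lemma continuous_vimage_borel:
  assumes "continuous_on UNIV f" "A \<in> sets borel"
  shows "f -` A \<in> sets borel"
  using measurable_sets_borel[OF borel_measurable_continuous_onI[OF assms(1)] assms(2)] .

lemma norm_e_vec [simp]: "norm e_vec = 1"
  by (simp add: e_vec_def norm_Pair)

lemma inner_e_vec: "e_vec \<bullet> z = snd z" "z \<bullet> e_vec = snd z"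
  by (cases z, simp add: e_vec_def)+

lemma emeasure_lborel_slices_fst:
  fixes X :: "('a::euclidean_space \<times> 'b::euclidean_space) set"
  assumes "X \<in> sets borel"
  shows "emeasure lborel X = (\<integral>\<^sup>+a. emeasure lborel {s. (a, s) \<in> X} \<partial>lborel)"
proof -
  have "X \<in> sets (lborel \<Otimes>\<^sub>M lborel)" using assms by (metis lborel_prod sets_lborel)
  then show ?thesis
    using lborel.emeasure_pair_measure_alt[of X lborel] by (simp add: lborel_prod vimage_def)
qed

lemma emeasure_lborel_slices_snd:
  fixes X :: "('a::euclidean_space \<times> 'b::euclidean_space) set"
  assumes "X \<in> sets borel"
  shows "emeasure lborel X = (\<integral>\<^sup>+s. emeasure lborel {a. (a, s) \<in> X} \<partial>lborel)"
proof -
  have "X \<in> sets (lborel \<Otimes>\<^sub>M lborel)" using assms by (metis lborel_prod sets_lborel)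
  then show ?thesis
    using lborel_pair.emeasure_pair_measure_alt2[of X] by (simp add: lborel_prod vimage_def)
qed

lemma emeasure_lborel_translate:
  fixes A :: "'a::euclidean_space set"
  assumes "A \<in> sets borel"
  shows "emeasure lborel {x. x + a \<in> A} = emeasure lborel A"
proof -
  have "emeasure lborel A = emeasure (distr lborel borel ((+) a)) A" by (simp add: lborel_distr_plus)
  also have "\<dots> = emeasure lborel {x. x + a \<in> A}"
    using assms by (subst emeasure_distr) (auto simp: vimage_def add.commute)
  finally show ?thesis by simp
qed

text \<open>
  Compare the volumes of the oblique cylinder \<open>{R(b, 0) + t (u, 1) | b \<in> C, 0 \<le> t \<le> 1}\<close> as seen in
  the coordinates of the hyperplane and in the sheared coordinates \<open>(hproj u, snd)\<close>.
\<close>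

lemma emeasure_lborel_hproj_hyperplane:
  fixes C :: "(real ^ 'm::finite) set" and R :: "'m pt \<Rightarrow> 'm pt"
  assumes R: "orthogonal_transformation R" "\<And>z. R (R z) = z"
    and C [measurable]: "C \<in> sets borel" and h: "snd (R (u, 1)) \<noteq> 0"
  defines "Q \<equiv> \<lambda>b. hproj u (R (b, 0))"
  shows "emeasure lborel (Q ` C) = ennreal \<bar>snd (R (u, 1))\<bar> * emeasure lborel C" "inj Q" "linear Q"
proof -
  obtain p h where ph: "R (u, 1) = (p, h)" by (cases "R (u, 1)") auto
  have h0: "h \<noteq> 0" using h ph by simp
  have linR: "linear R" using R(1) by (rule orthogonal_transformation_linear)
  have [measurable]: "R \<in> borel_measurable borel"
    using linR by (auto intro!: borel_measurable_continuous_onI linear_continuous_on simp: linear_linear)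
  have Ru: "R (p, h) = (u, 1)" using R(2)[of "(u, 1)"] ph by simp
  have "linear (\<lambda>b::real ^ 'm. (b, 0::real))" by (rule linearI) auto
  then have linQ: "linear Q"
    using linear_compose[OF linear_compose[OF _ linR] linear_hproj, of "\<lambda>b. (b, 0)" u]
    by (simp add: Q_def comp_def)
  show "linear Q" by (rule linQ)
  have Q0: "b = 0" if "Q b = 0" for b
  proof -
    obtain a s where as: "R (b, 0) = (a, s)" by (cases "R (b, 0)") auto
    then have "a = s *\<^sub>R u" using that by (simp add: Q_def hproj_def)
    then have "R (b, 0) = s *\<^sub>R (u, 1)" using as by simp
    then have "(b, 0) = s *\<^sub>R R (u, 1)" by (metis R(2) linear_cmul[OF linR])
    then show ?thesis using ph h0 by simp
  qed
  then show injQ: "inj Q" using linQ by (simp add: linear_injective_0)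
  obtain g where g: "linear g" "g \<circ> Q = id"
    using linear_injective_left_inverse[OF linQ injQ] by blast
  have gQ: "g (Q b) = b" for b using g(2) by (metis comp_apply id_apply)
  have [measurable]: "g \<in> borel_measurable borel"
    using g(1) by (auto intro!: borel_measurable_continuous_onI linear_continuous_on simp: linear_linear)
  have QC [measurable]: "Q ` C \<in> sets borel" using linQ injQ C by (rule inj_linear_image_borel)
  \<comment> \<open>The oblique cylinder is the image of \<open>Z1\<close> under \<open>R\<close>.
    Up to the shear \<open>(a, s)\<close> to \<open>(a + s *\<^sub>R u, s)\<close>, which preserves
    volume slice by slice, it is also \<open>Z2\<close>.\<close>
  define Z1 :: "'m pt set" where "Z1 = {z. snd z / h \<in> {0..1} \<and> fst z - (snd z / h) *\<^sub>R p \<in> C}"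
  define Z2 :: "'m pt set" where "Z2 = {z. fst z \<in> Q ` C \<and> snd z - snd (R (g (fst z), 0)) \<in> {0..1}}"
  have [measurable]: "Z1 \<in> sets borel" "Z2 \<in> sets borel"
  proof -
    have contR: "continuous_on S R" and contg: "continuous_on S' g" for S S'
      using linR g(1) by (simp_all add: linear_continuous_on linear_linear)
    have "Z1 = (\<lambda>z. snd z / h) -` {0..1} \<inter> (\<lambda>z. fst z - (snd z / h) *\<^sub>R p) -` C"
      by (auto simp: Z1_def)
    also have "\<dots> \<in> sets borel"
      using h0 by (intro sets.Int continuous_vimage_borel continuous_intros C) auto
    finally show "Z1 \<in> sets borel" .
    have "Z2 = fst -` (Q ` C) \<inter> (\<lambda>z. snd z - snd (R (g (fst z), 0))) -` {0..1}"
      by (auto simp: Z2_def)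
    also have "\<dots> \<in> sets borel"
      by (intro sets.Int continuous_vimage_borel continuous_intros QC continuous_on_compose2[OF contR[of UNIV]]
          continuous_on_compose2[OF contg[of UNIV]]) auto
    finally show "Z2 \<in> sets borel" .
  qed
  \<comment> \<open>The horizontal slices of \<open>Z1\<close> are translates of \<open>C\<close>
    over an interval of length \<open>\<bar>h\<bar>\<close>; the vertical fibres of
    \<open>Z2\<close> are unit intervals over the image of \<open>C\<close> under \<open>Q\<close>.
    Equating the volumes gives the claim.\<close>
  have "emeasure lborel Z1 = (\<integral>\<^sup>+s. emeasure lborel C * indicator {s. s / h \<in> {0..1}} s \<partial>lborel)"
  proof (subst emeasure_lborel_slices_snd, simp, intro nn_integral_cong)
    fix s
    show "emeasure lborel {a. (a, s) \<in> Z1} = emeasure lborel C * indicator {s. s / h \<in> {0..1}} s"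
      using emeasure_lborel_translate[OF C, of "- (s / h) *\<^sub>R p"] by (auto simp: Z1_def indicator_def)
  qed
  also have "\<dots> = emeasure lborel C * emeasure lborel {s. s / h \<in> {0..1}}"
    by (rule nn_integral_cmult_indicator) measurable
  also have "{s. s / h \<in> {0..1}} = (if h > 0 then {0..h} else {h..0})"
    using h0 by (auto simp: field_simps)
  also have "emeasure lborel \<dots> = ennreal \<bar>h\<bar>" using h0 by auto
  finally have vol1: "emeasure lborel Z1 = emeasure lborel C * ennreal \<bar>h\<bar>" .
  have "emeasure lborel Z2 = (\<integral>\<^sup>+a. indicator (Q ` C) a \<partial>lborel)"
  proof (subst emeasure_lborel_slices_fst, simp, intro nn_integral_cong)
    fix a
    show "emeasure lborel {s. (a, s) \<in> Z2} = indicator (Q ` C) a"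
      using emeasure_lborel_translate[of "{0..1::real}" "- snd (R (g a, 0))"]
      by (auto simp: Z2_def indicator_def)
  qed
  then have vol2: "emeasure lborel Z2 = emeasure lborel (Q ` C)" by simp
  have RZ: "(a + s *\<^sub>R u, s) \<in> R ` Z1 \<longleftrightarrow> (a, s) \<in> Z2" for a s
  proof -
    obtain b t where bt: "R (a + s *\<^sub>R u, s) = (b, t)" by (cases "R (a + s *\<^sub>R u, s)") auto
    define c where "c = b - (t / h) *\<^sub>R p"
    have "(a + s *\<^sub>R u, s) \<in> R ` Z1 \<longleftrightarrow> R (a + s *\<^sub>R u, s) \<in> Z1"
      by (metis (no_types, lifting) R(2) imageE imageI)
    also have "\<dots> \<longleftrightarrow> t / h \<in> {0..1} \<and> c \<in> C" by (simp add: bt Z1_def c_def)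
    finally have 1: "(a + s *\<^sub>R u, s) \<in> R ` Z1 \<longleftrightarrow> t / h \<in> {0..1} \<and> c \<in> C" .
    have "(b, t) = (c, 0) + (t / h) *\<^sub>R (p, h)" using h0 by (simp add: c_def)
    then have "R (b, t) = R (c, 0) + (t / h) *\<^sub>R (u, 1)"
      by (metis Ru linear_add[OF linR] linear_cmul[OF linR])
    moreover have "R (b, t) = (a + s *\<^sub>R u, s)" using R(2) bt by metis
    ultimately have Rc: "R (c, 0) = (a + s *\<^sub>R u, s) - (t / h) *\<^sub>R (u, 1)" by (simp add: algebra_simps)
    have Qc: "Q c = a" unfolding Q_def Rc by (simp add: hproj_def algebra_simps)
    have "snd (R (g a, 0)) = s - t / h" using gQ[of c] Rc Qc by simp
    moreover have "a \<in> Q ` C \<longleftrightarrow> c \<in> C" using Qc injQ by (auto simp: inj_def)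
    ultimately show ?thesis using 1 by (auto simp: Z2_def)
  qed
  have RZ1 [measurable]: "R ` Z1 \<in> sets borel"
    by (rule inj_linear_image_borel) (use linR R(1) orthogonal_transformation_inj in auto)
  have "emeasure lborel (R ` Z1) = (\<integral>\<^sup>+s. emeasure lborel {a. (a, s) \<in> Z2} \<partial>lborel)"
  proof (subst emeasure_lborel_slices_snd, simp, intro nn_integral_cong)
    fix s
    have "{a. (a, s) \<in> R ` Z1} \<in> sets borel"
      by (rule measurable_sets_borel[OF _ RZ1, of "\<lambda>a. (a, s)", unfolded vimage_def])
         (auto intro!: borel_measurable_continuous_onI continuous_intros)
    then show "emeasure lborel {a. (a, s) \<in> R ` Z1} = emeasure lborel {a. (a, s) \<in> Z2}"
      using emeasure_lborel_translate[of "{a. (a, s) \<in> R ` Z1}" "s *\<^sub>R u"] by (simp add: RZ)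
  qed
  also have "\<dots> = emeasure lborel Z2" by (rule emeasure_lborel_slices_snd[symmetric]) simp
  finally have "emeasure lborel Z2 = emeasure lborel (R ` Z1)" by simp
  also have "\<dots> = emeasure lborel Z1" by (rule emeasure_lborel_orthogonal_image[OF R(1)]) simp
  finally show "emeasure lborel (Q ` C) = ennreal \<bar>snd (R (u, 1))\<bar> * emeasure lborel C"
    using vol1 vol2 ph by (simp add: mult.commute)
qed

text \<open>Reflecting \<open>n\<close> to \<open>e_vec\<close> identifies the hyperplane orthogonal
  to \<open>n\<close> isometrically with \<open>real ^ 'm\<close>, where the factor is known for
  Lebesgue measure.\<close>

lemma hausdorff_outer_hproj:
  fixes B :: "'m::finite pt set"
  assumes n: "norm n = 1" and B [measurable]: "B \<in> sets borel" and Bn: "\<And>z. z \<in> B \<Longrightarrow> n \<bullet> z = 0"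
    and h: "n \<bullet> (u, 1) \<noteq> 0"
  shows "hausdorff_outer CARD('m) (hproj u ` B) = ennreal \<bar>n \<bullet> (u, 1)\<bar> * hausdorff_outer CARD('m) B"
proof -
  obtain R where R: "orthogonal_transformation R" "R n = e_vec" "\<And>z. R (R z) = z"
    using orthogonal_reflection_exists[OF n norm_e_vec] by metis
  have snd_R: "snd (R z) = n \<bullet> z" for z
  proof -
    have "snd (R z) = R n \<bullet> R z" by (simp add: R(2) inner_e_vec)
    then show ?thesis using R(1) unfolding orthogonal_transformation_def by metis
  qed
  have [measurable]: "R \<in> borel_measurable borel"
    using R(1) by (auto intro!: borel_measurable_continuous_onI linear_continuous_on
        simp: linear_linear orthogonal_transformation_linear)
  define C where "C = (\<lambda>b. R (b, 0)) -` B"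
  have C [measurable]: "C \<in> sets borel"
    unfolding C_def
    by (rule measurable_sets_borel[OF _ B])
       (auto intro!: borel_measurable_continuous_onI continuous_intros linear_continuous_on_compose
          orthogonal_transformation_linear R(1))
  have BC: "B = (\<lambda>b. R (b, 0)) ` C"
  proof (intro equalityI subsetI)
    fix z assume "z \<in> B"
    then have "R z = (fst (R z), 0)" using Bn snd_R by (metis prod.collapse)
    then have "z = R (fst (R z), 0)" by (metis R(3))
    then show "z \<in> (\<lambda>b. R (b, 0)) ` C" using \<open>z \<in> B\<close> unfolding C_def
      by (metis image_eqI vimage_eq)
  qed (auto simp: C_def)
  have "hausdorff_outer CARD('m) B = hausdorff_outer CARD('m) C"
    unfolding BC using R(1)
    by (intro hausdorff_outer_isometry_image)
       (simp add: orthogonal_transformation_isometry dist_Pair_Pair)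
  moreover have Q: "hproj u ` B = (\<lambda>b. hproj u (R (b, 0))) ` C"
    by (subst BC) (simp add: image_image)
  have hne: "snd (R (u, 1)) \<noteq> 0" using h by (simp add: snd_R)
  note * = emeasure_lborel_hproj_hyperplane[OF R(1,3) C hne]
  \<comment> \<open>The unknown ratio \<open>c\<close> of the two measures occurs on both sides and
    cancels.\<close>
  obtain c where c: "c > 0" "(hausdorff_measure CARD('m) :: (real ^ 'm) measure) = scale_measure (ennreal c) lborel"
    using hausdorff_measure_eq_lborel[where 'a="real ^ 'm"] by auto
  have "hproj u ` B \<in> sets borel" unfolding Q by (rule inj_linear_image_borel) (use * C in auto)
  then have "hausdorff_outer CARD('m) (hproj u ` B) = ennreal c * emeasure lborel (hproj u ` B)"
    using c(2) by (metis emeasure_hausdorff_measure emeasure_scale_measure)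
  moreover have "hausdorff_outer CARD('m) C = ennreal c * emeasure lborel C"
    using c(2) C by (metis emeasure_hausdorff_measure emeasure_scale_measure)
  ultimately show ?thesis
    using *(1) by (simp add: Q snd_R mult_ac)
qed

lemma hausdorff_outer_scaled_hproj:
  fixes B :: "'m::finite pt set" and T :: "'m pt \<Rightarrow> 'm pt"
  assumes T: "orthogonal_transformation T" and n: "norm n = 1" and B: "B \<in> sets borel"
    and Bn: "\<And>z. z \<in> B \<Longrightarrow> n \<bullet> z = 0"
    and h: "T n \<bullet> (u, 1) \<noteq> 0" and \<kappa>: "0 < \<kappa>"
  shows "hausdorff_outer CARD('m) ((\<lambda>z. \<kappa> *\<^sub>R hproj u (T z)) ` B) =
    ennreal (\<kappa> ^ CARD('m) * \<bar>T n \<bullet> (u, 1)\<bar>) * hausdorff_outer CARD('m) B"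
proof -
  have scale: "hausdorff_outer CARD('m) ((\<lambda>z. k *\<^sub>R z) ` A) \<le> ennreal (k ^ CARD('m)) * hausdorff_outer CARD('m) A"
    if "0 < k" for k and A :: "(real ^ 'm) set"
    using that by (intro hausdorff_outer_lipschitz_image) (auto simp: dist_norm simp flip: scaleR_diff_right)
  let ?A = "hproj u ` T ` B"
  have TB: "T ` B \<in> sets borel"
    using T B by (intro inj_linear_image_borel) (auto simp: orthogonal_transformation_linear orthogonal_transformation_inj)
  have "hausdorff_outer CARD('m) ?A = ennreal \<bar>T n \<bullet> (u, 1)\<bar> * hausdorff_outer CARD('m) (T ` B)"
  proof -
    have "norm (T n) = 1" using T n by (simp add: orthogonal_transformation_norm)
    moreover have "T n \<bullet> z = 0" if "z \<in> T ` B" for z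
      using that T Bn unfolding orthogonal_transformation_def by (metis imageE)
    ultimately show ?thesis using hausdorff_outer_hproj[OF _ TB _ h] by blast
  qed
  also have "hausdorff_outer CARD('m) (T ` B) = hausdorff_outer CARD('m) B"
    using T unfolding orthogonal_transformation_isometry by (intro hausdorff_outer_isometry_image) blast
  finally have A: "hausdorff_outer CARD('m) ?A = ennreal \<bar>T n \<bullet> (u, 1)\<bar> * hausdorff_outer CARD('m) B" .
  \<comment> \<open>The lower bound for the scaled set is the upper bound for the inverse
    scaling.\<close>
  have "hausdorff_outer CARD('m) ?A \<le> ennreal ((1/\<kappa>) ^ CARD('m)) * hausdorff_outer CARD('m) ((\<lambda>z. \<kappa> *\<^sub>R z) ` ?A)"
    using scale[of "1/\<kappa>" "(\<lambda>z. \<kappa> *\<^sub>R z) ` ?A"] \<kappa> by (simp add: image_image)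
  then have "ennreal (\<kappa> ^ CARD('m)) * hausdorff_outer CARD('m) ?A \<le>
      ennreal (\<kappa> ^ CARD('m)) * (ennreal ((1/\<kappa>) ^ CARD('m)) * hausdorff_outer CARD('m) ((\<lambda>z. \<kappa> *\<^sub>R z) ` ?A))"
    by (rule mult_left_mono) simp
  also have "\<dots> = hausdorff_outer CARD('m) ((\<lambda>z. \<kappa> *\<^sub>R z) ` ?A)"
    using \<kappa> by (simp add: mult.assoc[symmetric] ennreal_mult[symmetric] power_mult_distrib[symmetric])
  finally have "hausdorff_outer CARD('m) ((\<lambda>z. \<kappa> *\<^sub>R z) ` ?A) = ennreal (\<kappa> ^ CARD('m)) * hausdorff_outer CARD('m) ?A"
    using scale[OF \<kappa>, of ?A] by (intro antisym)
  then show ?thesis using \<kappa> A by (simp add: image_image ennreal_mult mult.assoc)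
qed

section \<open>Images under continuously differentiable maps\<close>

lemma hausdorff_outer_zero_mono: "hausdorff_outer s B = 0 \<Longrightarrow> A \<subseteq> B \<Longrightarrow> hausdorff_outer s A = 0"
  using hausdorff_outer_mono[of A B s] by simp

lemma hausdorff_outer_zero_UN:
  "(\<And>n::nat. hausdorff_outer s (A n) = 0) \<Longrightarrow> hausdorff_outer s (\<Union>n. A n) = 0"
  using hausdorff_outer_subadditive[of s A] by simp

lemma hausdorff_outer_zero_countable_Union:
  assumes "countable F" "\<And>A. A \<in> F \<Longrightarrow> hausdorff_outer s A = 0"
  shows "hausdorff_outer s (\<Union>F) = 0"
proof (cases "F = {}")
  case False
  then have "\<Union>F = (\<Union>n. from_nat_into F n)"
    using assms(1) by (simp add: range_from_nat_into)
  then show ?thesis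
    using hausdorff_outer_zero_UN[of s "from_nat_into F"] assms(2) from_nat_into[OF False] by simp
qed simp

lemma hausdorff_outer_zero_lipschitz_image:
  assumes "hausdorff_outer s A = 0" "\<And>x y. x \<in> A \<Longrightarrow> y \<in> A \<Longrightarrow> dist (f x) (f y) \<le> L * dist x y"
  shows "hausdorff_outer s (f ` A) = 0"
proof -
  have "dist (f x) (f y) \<le> max L 1 * dist x y" if "x \<in> A" "y \<in> A" for x y
    using assms(2)[OF that] by (smt (verit) mult_right_mono zero_le_dist)
  then show ?thesis
    using hausdorff_outer_lipschitz_image[of "max L 1" A f s] assms(1) by (simp add: less_max_iff_disj)
qed

text \<open>Replace the sets of economical coverings by their closures.\<close>

lemma hausdorff_outer_zero_imp_null_superset:
  assumes "hausdorff_outer s A = 0"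
  obtains B where "B \<in> null_sets (hausdorff_measure s)" "A \<subseteq> B"
proof -
  have "\<exists>C. A \<subseteq> (\<Union>i. C i) \<and> (\<forall>i. bounded (C i) \<and> diameter (C i) \<le> 1 / real (Suc n)) \<and>
      (\<Sum>i::nat. hausdorff_gauge s (C i)) < ennreal (1 / real (Suc n))" for n
  proof -
    have "hausdorff_content s (1 / real (Suc n)) A \<le> 0"
      using hausdorff_content_le_outer[of "1 / real (Suc n)" s A] assms by simp
    then have "hausdorff_content s (1 / real (Suc n)) A < ennreal (1 / real (Suc n))" by simp
    then show ?thesis unfolding hausdorff_content_def INF_less_iff by auto
  qed
  then obtain C where C: "\<And>n. A \<subseteq> (\<Union>i. C n i)" "\<And>n i. bounded (C n i)"
      "\<And>n i. diameter (C n i) \<le> 1 / real (Suc n)"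
      "\<And>n. (\<Sum>i::nat. hausdorff_gauge s (C n i)) < ennreal (1 / real (Suc n))"
    by metis
  define B where "B = (\<Inter>n. \<Union>i. closure (C n i))"
  have B: "B \<in> sets borel" unfolding B_def by auto
  have "hausdorff_outer s B \<le> 0"
  proof (rule hausdorff_outer_least)
    fix \<delta> :: real assume "0 < \<delta>"
    show "hausdorff_content s \<delta> B \<le> 0"
    proof (rule ennreal_le_epsilon)
      fix e :: real assume "0 < e"
      then obtain n where n: "inverse (real (Suc n)) < min e \<delta>"
        using reals_Archimedean[of "min e \<delta>"] \<open>0 < \<delta>\<close> by auto
      have "hausdorff_content s \<delta> B \<le> (\<Sum>i. hausdorff_gauge s (closure (C n i)))"
      proof (rule hausdorff_content_le)
        show "B \<subseteq> (\<Union>i. closure (C n i))" by (auto simp: B_def)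
        show "bounded (closure (C n i))" for i using C(2) by auto
        show "diameter (closure (C n i)) \<le> \<delta>" for i
          using C(3)[of n i] n C(2) by (simp add: diameter_closure inverse_eq_divide)
      qed
      also have "\<dots> = (\<Sum>i. hausdorff_gauge s (C n i))"
        using C(2) by (intro suminf_cong) (simp add: hausdorff_gauge_def diameter_closure)
      also have "\<dots> \<le> ennreal (1 / real (Suc n))" using C(4)[of n] by simp
      also have "\<dots> \<le> ennreal e" using n by (intro ennreal_leI) (simp add: inverse_eq_divide)
      finally show "hausdorff_content s \<delta> B \<le> 0 + ennreal e" by simp
    qed
  qed
  then have "B \<in> null_sets (hausdorff_measure s)"
    using B by (intro null_setsI) (auto simp: emeasure_hausdorff_measure)
  moreover have "A \<subseteq> B"
  proof -
    have "A \<subseteq> (\<Union>i. closure (C n i))" for n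
      by (rule order_trans[OF C(1)[of n] UN_mono[OF order_refl closure_subset]])
    then show ?thesis unfolding B_def by (intro INT_greatest)
  qed
  ultimately show ?thesis by (rule that)
qed

text \<open>The mean value inequality is applied to \<open>h - h' p\<close>, whose derivative is
  small near \<open>p\<close> by continuity of \<open>h'\<close>. Unlike differentiability at
  \<open>p\<close> alone, this controls differences between any two nearby points.\<close>

lemma C1_strict_derivative:
  fixes h :: "'a::real_normed_vector \<Rightarrow> 'b::real_normed_vector" and h' :: "'a \<Rightarrow> 'a \<Rightarrow>\<^sub>L 'b"
  assumes "open U" "p \<in> U" and der: "\<And>u. u \<in> U \<Longrightarrow> (h has_derivative blinfun_apply (h' u)) (at u)"
    and cont: "continuous_on U h'" and "0 < \<eta>"
  obtains r where "0 < r" "ball p r \<subseteq> U"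
    "\<And>a b. a \<in> ball p r \<Longrightarrow> b \<in> ball p r \<Longrightarrow> norm (h a - h b - h' p (a - b)) \<le> \<eta> * norm (a - b)"
proof -
  obtain r1 where r1: "0 < r1" "ball p r1 \<subseteq> U" using \<open>open U\<close> \<open>p \<in> U\<close> openE by blast
  obtain r2 where r2: "0 < r2" "\<And>u. u \<in> U \<Longrightarrow> dist u p < r2 \<Longrightarrow> dist (h' u) (h' p) < \<eta>"
    using cont \<open>p \<in> U\<close> \<open>0 < \<eta>\<close> unfolding continuous_on_iff by metis
  define r where "r = min r1 r2"
  have sub: "ball p r \<subseteq> U" using r1 by (auto simp: r_def)
  show ?thesis
  proof (rule that[OF _ sub])
    show "0 < r" using r1 r2 by (simp add: r_def)
    fix a b assume ab: "a \<in> ball p r" "b \<in> ball p r"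
    define F where "F u = h u - h' p u" for u
    have "norm (F a - F b) \<le> \<eta> * norm (a - b)"
    proof (rule differentiable_bound[where S = "ball p r" and f' = "\<lambda>u. blinfun_apply (h' u - h' p)"])
      fix u assume u: "u \<in> ball p r"
      have "(h has_derivative blinfun_apply (h' u)) (at u within ball p r)"
        using der u sub has_derivative_at_withinI by blast
      moreover have "(blinfun_apply (h' p) has_derivative blinfun_apply (h' p)) (at u within ball p r)"
        by (rule bounded_linear_imp_has_derivative) (rule blinfun.bounded_linear_right)
      ultimately have "(F has_derivative (\<lambda>x. h' u x - h' p x)) (at u within ball p r)"
        unfolding F_def by (rule has_derivative_diff)
      then show "(F has_derivative blinfun_apply (h' u - h' p)) (at u within ball p r)"
        by (simp add: blinfun.diff_left[abs_def])
      have "u \<in> U" "dist u p < r2" using u sub by (auto simp: r_def dist_commute)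
      then have "norm (h' u - h' p) \<le> \<eta>"
        using r2(2)[of u] by (simp add: dist_norm)
      then show "onorm (blinfun_apply (h' u - h' p)) \<le> \<eta>" by (simp add: norm_blinfun.rep_eq)
    qed (use ab in auto)
    then show "norm (h a - h b - h' p (a - b)) \<le> \<eta> * norm (a - b)"
      by (simp add: F_def blinfun.diff_right algebra_simps)
  qed
qed

text \<open>Injectivity of \<open>h' p\<close> bounds it below by some \<open>m > 0\<close>. So a
  linearisation error that is small against \<open>norm (a - b)\<close> is small against
  \<open>dist (h' p a) (h' p b)\<close> as well.\<close>

lemma C1_bilipschitz:
  fixes h :: "'a::euclidean_space \<Rightarrow> 'b::euclidean_space" and h' :: "'a \<Rightarrow> 'a \<Rightarrow>\<^sub>L 'b"
  assumes "open U" "p \<in> U" "\<And>u. u \<in> U \<Longrightarrow> (h has_derivative blinfun_apply (h' u)) (at u)"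
    "continuous_on U h'" and inj: "inj (blinfun_apply (h' p))" and \<epsilon>: "0 < \<epsilon>"
  obtains r where "0 < r" "ball p r \<subseteq> U"
    "\<And>a b. a \<in> ball p r \<Longrightarrow> b \<in> ball p r \<Longrightarrow> dist (h' p a) (h' p b) \<le> (1 + \<epsilon>) * dist (h a) (h b)"
    "\<And>a b. a \<in> ball p r \<Longrightarrow> b \<in> ball p r \<Longrightarrow> dist (h a) (h b) \<le> (1 + \<epsilon>) * dist (h' p a) (h' p b)"
proof -
  have "linear (blinfun_apply (h' p))" by (simp add: blinfun.bounded_linear_right bounded_linear.linear)
  then obtain m where m: "m > 0" "\<And>x. m * norm x \<le> norm (h' p x)"
    using linear_inj_bounded_below_pos inj by blast
  \<comment> \<open>This value makes \<open>1 / (1 - q)\<close> equal to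
    \<open>1 + \<epsilon>\<close>, the constant wanted in the first estimate, while
    \<open>1 + q\<close> stays below the one wanted in the second.\<close>
  define q where "q = \<epsilon> / (1 + \<epsilon>)"
  have q: "0 < q" "q \<le> \<epsilon>" "(1 - q) * (1 + \<epsilon>) = 1" using \<epsilon> by (auto simp: q_def field_simps)
  obtain r where r: "0 < r" "ball p r \<subseteq> U"
    "\<And>a b. a \<in> ball p r \<Longrightarrow> b \<in> ball p r \<Longrightarrow> norm (h a - h b - h' p (a - b)) \<le> m * q * norm (a - b)"
    using C1_strict_derivative[of U p h h' "m * q"] assms(1-4) m(1) q(1) by (metis mult_pos_pos)
  show ?thesis
  proof (rule that[OF r(1,2)])
    fix a b assume ab: "a \<in> ball p r" "b \<in> ball p r"
    have eq: "h' p (a - b) = h' p a - h' p b" by (simp add: blinfun.diff_right)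
    have "norm (h a - h b - h' p (a - b)) \<le> q * norm (h' p (a - b))"
    proof -
      have "m * q * norm (a - b) = q * (m * norm (a - b))" by simp
      also have "\<dots> \<le> q * norm (h' p (a - b))" using q(1) by (intro mult_left_mono m(2)) auto
      finally show ?thesis using r(3)[OF ab] by linarith
    qed
    then have *: "norm ((h a - h b) - (h' p a - h' p b)) \<le> q * dist (h' p a) (h' p b)"
      by (simp add: eq dist_norm)
    have "(1 - q) * dist (h' p a) (h' p b) \<le> dist (h a) (h b)"
      using * norm_triangle_ineq2[of "h' p a - h' p b" "h a - h b"]
      by (simp add: dist_norm norm_minus_commute algebra_simps)
    then have "(1 + \<epsilon>) * ((1 - q) * dist (h' p a) (h' p b)) \<le> (1 + \<epsilon>) * dist (h a) (h b)"
      using \<epsilon> by (intro mult_left_mono) auto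
    then show "dist (h' p a) (h' p b) \<le> (1 + \<epsilon>) * dist (h a) (h b)"
      using q(3) by (simp add: mult.assoc[symmetric] mult.commute)
    have "dist (h a) (h b) \<le> (1 + q) * dist (h' p a) (h' p b)"
      using * norm_triangle_ineq2[of "h a - h b" "h' p a - h' p b"]
      by (simp add: dist_norm algebra_simps)
    also have "\<dots> \<le> (1 + \<epsilon>) * dist (h' p a) (h' p b)" using q by (intro mult_right_mono) auto
    finally show "dist (h a) (h b) \<le> (1 + \<epsilon>) * dist (h' p a) (h' p b)" .
  qed
qed

text \<open>By the bound, equal values of \<open>g\<close> force equal values of \<open>f\<close>;
  so on \<open>A\<close> the map \<open>f\<close> factors through \<open>g\<close>, and the second
  factor is Lipschitz.\<close>

lemma hausdorff_outer_image_le: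
  fixes f :: "'c \<Rightarrow> 'a::metric_space" and g :: "'c \<Rightarrow> 'b::metric_space"
  assumes L: "0 < L" and fg: "\<And>x y. x \<in> A \<Longrightarrow> y \<in> A \<Longrightarrow> dist (f x) (f y) \<le> L * dist (g x) (g y)"
  shows "hausdorff_outer s (f ` A) \<le> ennreal (L ^ s) * hausdorff_outer s (g ` A)"
proof -
  let ?k = "\<lambda>z. f (inv_into A g z)"
  have in_A: "inv_into A g (g x) \<in> A" "g (inv_into A g (g x)) = g x" if "x \<in> A" for x
    using that by (auto intro: inv_into_into f_inv_into_f)
  have k: "?k (g x) = f x" if "x \<in> A" for x
    using fg[OF in_A(1)[OF that] that] in_A(2)[OF that] by simp
  then have "?k ` g ` A = f ` A" by (force simp: image_image)
  moreover have "hausdorff_outer s (?k ` g ` A) \<le> ennreal (L ^ s) * hausdorff_outer s (g ` A)"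
    by (rule hausdorff_outer_lipschitz_image[OF L]) (auto simp: k fg)
  ultimately show ?thesis by simp
qed

text \<open>The map scales the direction \<open>v\<close> by \<open>t\<close> and fixes the
  orthogonal complement. After a reflection that takes \<open>v\<close> to a basis vector it is
  diagonal, with determinant \<open>t\<close>.\<close>

lemma hausdorff_outer_contraction:
  fixes v :: "'a::euclidean_space"
  assumes v: "norm v = 1" and t: "0 < t" and A: "A \<in> sets borel"
  shows "hausdorff_outer DIM('a) ((\<lambda>x. x + ((t - 1) * (x \<bullet> v)) *\<^sub>R v) ` A) = ennreal t * hausdorff_outer DIM('a) A"
proof -
  obtain i :: 'a where i: "i \<in> Basis" using nonempty_Basis by blast
  then have ni: "norm i = 1" by simp
  obtain R where R: "orthogonal_transformation R" "R v = i" "\<And>z. R (R z) = z"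
    using orthogonal_reflection_exists[OF v ni] by metis
  have Rinner: "R x \<bullet> R y = x \<bullet> y" for x y
    using R(1) unfolding orthogonal_transformation_def by metis
  have Rlin: "linear R" using R(1) by (rule orthogonal_transformation_linear)
  have Rinj: "inj R" using R(1) by (rule orthogonal_transformation_inj)
  have iso: "hausdorff_outer DIM('a) (R ` X) = hausdorff_outer DIM('a) X" for X
    using R(1) unfolding orthogonal_transformation_isometry by (intro hausdorff_outer_isometry_image) blast
  define T where "T x = x + ((t - 1) * (x \<bullet> i)) *\<^sub>R i" for x
  have "R (T (R x)) = x + ((t - 1) * (x \<bullet> v)) *\<^sub>R v" for x
  proof -
    have "R (T (R x)) = R (R x) + ((t - 1) * (R x \<bullet> i)) *\<^sub>R R i"
      unfolding T_def by (simp add: linear_add[OF Rlin] linear_cmul[OF Rlin])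
    moreover have "R x \<bullet> i = x \<bullet> v" using Rinner[of x v] R(2) by simp
    moreover have "R i = v" using R(2,3) by metis
    ultimately show ?thesis using R(3) by simp
  qed
  then have "(\<lambda>x. x + ((t - 1) * (x \<bullet> v)) *\<^sub>R v) ` A = R ` T ` R ` A" by (simp add: image_image)
  then have 1: "hausdorff_outer DIM('a) ((\<lambda>x. x + ((t - 1) * (x \<bullet> v)) *\<^sub>R v) ` A) = hausdorff_outer DIM('a) (T ` R ` A)"
    using iso[of "T ` R ` A"] by simp
  have Tlin: "linear T" by (rule linearI) (auto simp: T_def inner_add_left algebra_simps)
  have Ti: "T x \<bullet> i = t * (x \<bullet> i)" for x using i by (simp add: T_def inner_add_left algebra_simps)
  have Tinj: "inj T"
  proof (subst linear_injective_0[OF Tlin], intro allI impI)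
    fix x assume x: "T x = 0"
    then have "x \<bullet> i = 0" using Ti[of x] t by simp
    then show "x = 0" using x by (simp add: T_def)
  qed
  define c where "c j = (if j = i then t else 1)" for j
  have Tc: "T = (\<lambda>x. 0 + (\<Sum>j\<in>Basis. (c j * (x \<bullet> j)) *\<^sub>R j))"
  proof
    fix x
    have "T x \<bullet> b = (\<Sum>j\<in>Basis. (c j * (x \<bullet> j)) *\<^sub>R j) \<bullet> b" if b: "b \<in> Basis" for b
    proof -
      have "(\<Sum>j\<in>Basis. (c j * (x \<bullet> j)) *\<^sub>R j) \<bullet> b = c b * (x \<bullet> b)" using b by simp
      moreover have "T x \<bullet> b = c b * (x \<bullet> b)"
        using Ti[of x] b i by (cases "b = i") (auto simp: c_def T_def inner_add_left inner_not_same_Basis)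
      ultimately show ?thesis by simp
    qed
    then show "T x = 0 + (\<Sum>j\<in>Basis. (c j * (x \<bullet> j)) *\<^sub>R j)"
      by (simp add: euclidean_eq_iff[of "T x"])
  qed
  have leb: "emeasure lborel (T ` B) = ennreal t * emeasure lborel B" if B: "B \<in> sets borel" for B
  proof -
    have TB: "T ` B \<in> sets borel" using Tlin Tinj B by (rule inj_linear_image_borel)
    have Tm: "T \<in> borel_measurable borel"
      using Tlin by (auto intro!: borel_measurable_continuous_onI linear_continuous_on simp: linear_linear)
    have "lborel = density (distr lborel borel T) (\<lambda>_. \<Prod>j\<in>Basis. \<bar>c j\<bar>)"
      unfolding Tc by (rule lborel_affine_euclidean) (use t in \<open>auto simp: c_def\<close>)
    also have "(\<Prod>j\<in>(Basis::'a set). \<bar>c j\<bar>) = t"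
      using i t by (simp add: c_def prod.If_cases if_distrib cong: if_cong)
    finally have "emeasure lborel (T ` B) = emeasure (density (distr lborel borel T) (\<lambda>_. ennreal t)) (T ` B)"
      by metis
    also have "\<dots> = ennreal t * emeasure lborel (T -` (T ` B))"
      using TB Tm by (simp add: emeasure_density nn_integral_cmult_indicator emeasure_distr)
    also have "T -` (T ` B) = B" by (rule inj_vimage_image_eq[OF Tinj])
    finally show ?thesis .
  qed
  obtain k where k: "k > 0" "(hausdorff_measure DIM('a) :: 'a measure) = scale_measure (ennreal k) lborel"
    using hausdorff_measure_eq_lborel by blast
  have RA: "R ` A \<in> sets borel" using Rlin Rinj A by (rule inj_linear_image_borel)
  have hk: "hausdorff_outer DIM('a) X = ennreal k * emeasure lborel X" if "X \<in> sets borel" for X :: "'a set"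
    using that k(2) by (metis emeasure_hausdorff_measure emeasure_scale_measure)
  have TRA: "T ` R ` A \<in> sets borel" using Tlin Tinj RA by (rule inj_linear_image_borel)
  have "hausdorff_outer DIM('a) (T ` R ` A) = ennreal t * hausdorff_outer DIM('a) (R ` A)"
    by (simp add: hk TRA RA leb mult_ac)
  then show ?thesis using 1 iso by simp
qed

text \<open>
  The easy case of Sard's theorem: near a critical point, with \<open>v\<close> in the kernel of the derivative,
  the map is dominated by a linear map that contracts in the direction \<open>v\<close>.
\<close>

lemma hausdorff_outer_critical_image:
  fixes h :: "'a::euclidean_space \<Rightarrow> 'a" and h' :: "'a \<Rightarrow> 'a \<Rightarrow>\<^sub>L 'a"
  assumes U: "open U" and der: "\<And>u. u \<in> U \<Longrightarrow> (h has_derivative blinfun_apply (h' u)) (at u)"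
    and cont: "continuous_on U h'" and E: "E \<subseteq> U"
    and crit: "\<And>p. p \<in> E \<Longrightarrow> \<exists>v. v \<noteq> 0 \<and> h' p v = 0"
  shows "hausdorff_outer DIM('a) (h ` E) = 0"
proof -
  let ?n = "DIM('a)"
  \<comment> \<open>On each \<open>E' k\<close> the constant of the local estimate and the volume of
    the region to be covered are bounded uniformly.\<close>
  define E' where "E' k = {p \<in> E. norm p \<le> real k \<and> norm (h' p) \<le> real k}" for k
  have local: "\<exists>r>0. \<forall>A B. A \<subseteq> B \<and> B \<subseteq> ball p r \<and> B \<in> sets borel \<longrightarrow>
      hausdorff_outer ?n (h ` A) \<le> ennreal (3 ^ ?n * (real k + 1) ^ (?n - 1) * \<eta>) * hausdorff_outer ?n B"
    if p: "p \<in> E' k" and \<eta>: "0 < \<eta>" "\<eta> \<le> 1" for p k \<eta>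
  proof -
    have pE: "p \<in> E" "norm (h' p) \<le> real k" "p \<in> U" using p E by (auto simp: E'_def)
    obtain w where w: "w \<noteq> 0" "h' p w = 0" using crit[OF pE(1)] by auto
    define v where "v = w /\<^sub>R norm w"
    have v: "norm v = 1" "h' p v = 0" using w by (auto simp: v_def blinfun.scaleR_right)
    have vv: "v \<bullet> v = 1" using v by (simp add: norm_eq_1)
    define K where "K = norm (h' p) + \<eta>"
    have K: "0 < K" "K \<le> real k + 1" using \<eta> pE by (auto simp: K_def add_nonneg_pos)
    \<comment> \<open>Near \<open>p\<close> the map \<open>h\<close> moves points at rate at most
      \<open>\<eta>\<close> along \<open>v\<close> and at most \<open>K\<close> across it. Both are
      dominated by a multiple of \<open>K\<close> times \<open>T\<close>, which contracts along
      \<open>v\<close> by \<open>\<eta> / K\<close>. The volume factor is then of order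
      \<open>K ^ (?n - 1) * \<eta>\<close> and vanishes with \<eta>.\<close>
    define T where "T x = x + ((\<eta> / K - 1) * (x \<bullet> v)) *\<^sub>R v" for x
    have Tdiff: "T x - T y = T (x - y)" for x y by (simp add: T_def inner_diff_left algebra_simps)
    obtain r where r: "0 < r" "ball p r \<subseteq> U"
      "\<And>a b. a \<in> ball p r \<Longrightarrow> b \<in> ball p r \<Longrightarrow> norm (h a - h b - h' p (a - b)) \<le> \<eta> * norm (a - b)"
      using C1_strict_derivative[OF U pE(3) der cont \<eta>(1)] by blast
    have key: "dist (h a) (h b) \<le> 3 * K * dist (T a) (T b)" if "a \<in> ball p r" "b \<in> ball p r" for a b
    proof -
      define x where "x = a - b"
      define s where "s = x \<bullet> v"
      define y where "y = x - s *\<^sub>R v"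
      have xy: "x = y + s *\<^sub>R v" by (simp add: y_def)
      have Tx: "T x = y + (\<eta> / K * s) *\<^sub>R v" by (simp add: T_def y_def s_def algebra_simps)
      have "v \<bullet> T x = \<eta> / K * s"
        by (simp add: Tx y_def s_def inner_add_right inner_diff_right vv inner_commute)
      then have s1: "\<bar>\<eta> / K * s\<bar> \<le> norm (T x)"
        using Cauchy_Schwarz_ineq2[of v "T x"] v(1) by simp
      have "norm y \<le> norm (T x) + norm ((\<eta> / K * s) *\<^sub>R v)"
        using norm_triangle_ineq4[of "T x" "(\<eta> / K * s) *\<^sub>R v"] by (simp add: Tx)
      also have "norm ((\<eta> / K * s) *\<^sub>R v) = \<bar>\<eta> / K * s\<bar>" by (simp add: v(1))
      finally have y1: "norm y \<le> 2 * norm (T x)" using s1 by simp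
      have "norm (h a - h b) \<le> norm (h' p x) + \<eta> * norm x"
        using r(3)[OF that] norm_triangle_ineq2[of "h a - h b" "h' p (a - b)"] by (simp add: x_def)
      also have "norm (h' p x) = norm (h' p y)"
        by (subst xy) (simp add: blinfun.add_right blinfun.scaleR_right v(2))
      also have "\<dots> \<le> norm (h' p) * norm y" by (rule norm_blinfun)
      also have "\<eta> * norm x \<le> \<eta> * (norm y + \<bar>s\<bar>)"
        using \<eta> norm_triangle_ineq[of y "s *\<^sub>R v"] v(1) by (intro mult_left_mono) (auto simp: xy[symmetric])
      finally have "norm (h a - h b) \<le> K * norm y + \<eta> * \<bar>s\<bar>" by (simp add: K_def algebra_simps)
      also have "\<eta> * \<bar>s\<bar> = K * \<bar>\<eta> / K * s\<bar>" using K \<eta> by (simp add: abs_mult)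
      also have "K * norm y + K * \<bar>\<eta> / K * s\<bar> \<le> K * (2 * norm (T x)) + K * norm (T x)"
        using K y1 s1 by (intro add_mono mult_left_mono) auto
      finally show ?thesis using Tdiff[of a b] by (simp add: dist_norm x_def algebra_simps)
    qed
    have "hausdorff_outer ?n (h ` A) \<le> ennreal (3 ^ ?n * (real k + 1) ^ (?n - 1) * \<eta>) * hausdorff_outer ?n B"
      if AB: "A \<subseteq> B" "B \<subseteq> ball p r" "B \<in> sets borel" for A B
    proof -
      have "hausdorff_outer ?n (h ` A) \<le> hausdorff_outer ?n (h ` B)" using AB by (intro hausdorff_outer_mono) auto
      also have "\<dots> \<le> ennreal ((3 * K) ^ ?n) * hausdorff_outer ?n (T ` B)"
        using K by (intro hausdorff_outer_image_le key subsetD[OF AB(2)]) auto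
      also have "hausdorff_outer ?n (T ` B) = ennreal (\<eta> / K) * hausdorff_outer ?n B"
        unfolding T_def using K \<eta> by (intro hausdorff_outer_contraction v(1) AB(3)) auto
      also have "ennreal ((3 * K) ^ ?n) * (ennreal (\<eta> / K) * hausdorff_outer ?n B) =
          ennreal ((3 * K) ^ ?n * (\<eta> / K)) * hausdorff_outer ?n B"
        using K \<eta> by (subst ennreal_mult) (simp_all only: mult.assoc, auto)
      also have "(3 * K) ^ ?n * (\<eta> / K) = 3 ^ ?n * K ^ (?n - 1) * \<eta>"
        using K by (simp add: power_mult_distrib power_diff field_simps)
      also have "ennreal (3 ^ ?n * K ^ (?n - 1) * \<eta>) * hausdorff_outer ?n B \<le>
          ennreal (3 ^ ?n * (real k + 1) ^ (?n - 1) * \<eta>) * hausdorff_outer ?n B"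
        using K \<eta> by (intro mult_right_mono ennreal_leI mult_left_mono power_mono) auto
      finally show ?thesis .
    qed
    then show ?thesis using r(1) by auto
  qed
  have "hausdorff_outer ?n (h ` E' k) = 0" for k
  proof -
    define Q where "Q = hausdorff_outer ?n (cball (0::'a) (real k))"
    have Qfin: "Q < \<infinity>" unfolding Q_def by (rule hausdorff_outer_bounded_finite) simp
    have le: "hausdorff_outer ?n (h ` E' k) \<le> ennreal (3 ^ ?n * (real k + 1) ^ (?n - 1) * \<eta>) * Q"
      if \<eta>: "0 < \<eta>" "\<eta> \<le> 1" for \<eta>
    proof (cases "E' k = {}")
      case False
      define good where "good p r \<longleftrightarrow> 0 < r \<and> (\<forall>A B. A \<subseteq> B \<and> B \<subseteq> ball p r \<and> B \<in> sets borel \<longrightarrow>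
          hausdorff_outer ?n (h ` A) \<le> ennreal (3 ^ ?n * (real k + 1) ^ (?n - 1) * \<eta>) * hausdorff_outer ?n B)" for p r
      have "\<exists>r. good p r" if "p \<in> E' k" for p
        using local[OF that \<eta>] unfolding good_def .
      then obtain r where good: "\<And>p. p \<in> E' k \<Longrightarrow> good p (r p)" by metis
      have r: "\<And>p. p \<in> E' k \<Longrightarrow> 0 < r p" "\<And>p A B. p \<in> E' k \<Longrightarrow> A \<subseteq> B \<Longrightarrow> B \<subseteq> ball p (r p) \<Longrightarrow> B \<in> sets borel \<Longrightarrow>
          hausdorff_outer ?n (h ` A) \<le> ennreal (3 ^ ?n * (real k + 1) ^ (?n - 1) * \<eta>) * hausdorff_outer ?n B"
        using good unfolding good_def by simp_all
      obtain F where F: "F \<subseteq> (\<lambda>p. ball p (r p)) ` E' k" "countable F" "\<Union>F = (\<Union>p\<in>E' k. ball p (r p))"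
        by (rule Lindelof[of "(\<lambda>p. ball p (r p)) ` E' k"]) auto
      have cover: "E' k \<subseteq> \<Union>F" unfolding F(3) using r(1) by force
      then have "F \<noteq> {}" using False by auto
      define G where "G = from_nat_into F"
      have GF: "G n \<in> F" for n unfolding G_def by (rule from_nat_into[OF \<open>F \<noteq> {}\<close>])
      have UG: "(\<Union>n. G n) = \<Union>F" using F(2) \<open>F \<noteq> {}\<close> by (simp add: G_def)
      \<comment> \<open>Disjoint Borel pieces keep the sum of the local bounds below a multiple of
        the measure of a single ball, however much the neighbourhoods overlap.\<close>
      define B where "B n = disjointed G n \<inter> cball 0 (real k)" for n
      have Gb: "G n \<in> sets borel" for n using GF[of n] F(1) by auto
      have Bb: "B n \<in> sets borel" for n
        unfolding B_def using sets.range_disjointed_sets[of G borel] Gb by (intro sets.Int) auto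
      have "E' k \<subseteq> (\<Union>n. B n)"
      proof
        fix x assume x: "x \<in> E' k"
        then have "x \<in> (\<Union>n. disjointed G n)" using cover UG by (auto simp: UN_disjointed_eq)
        moreover have "x \<in> cball 0 (real k)" using x by (simp add: E'_def)
        ultimately show "x \<in> (\<Union>n. B n)" by (auto simp: B_def)
      qed
      then have "h ` E' k \<subseteq> (\<Union>n. h ` (B n \<inter> E' k))" by blast
      then have "hausdorff_outer ?n (h ` E' k) \<le> hausdorff_outer ?n (\<Union>n. h ` (B n \<inter> E' k))"
        by (rule hausdorff_outer_mono)
      also have "\<dots> \<le> (\<Sum>n. hausdorff_outer ?n (h ` (B n \<inter> E' k)))" by (rule hausdorff_outer_subadditive)
      also have "\<dots> \<le> (\<Sum>n. ennreal (3 ^ ?n * (real k + 1) ^ (?n - 1) * \<eta>) * hausdorff_outer ?n (B n))"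
      proof (intro suminf_le)
        fix n
        obtain p where p: "p \<in> E' k" "G n = ball p (r p)" using GF[of n] F(1) by auto
        have "B n \<subseteq> ball p (r p)" using p(2) disjointed_subset[of G n] by (auto simp: B_def)
        then show "hausdorff_outer ?n (h ` (B n \<inter> E' k)) \<le>
            ennreal (3 ^ ?n * (real k + 1) ^ (?n - 1) * \<eta>) * hausdorff_outer ?n (B n)"
          by (intro r(2)[OF p(1)] Bb) auto
      qed auto
      also have "\<dots> = ennreal (3 ^ ?n * (real k + 1) ^ (?n - 1) * \<eta>) * (\<Sum>n. emeasure (hausdorff_measure ?n) (B n))"
        using Bb by (simp add: ennreal_suminf_cmult emeasure_hausdorff_measure)
      also have "(\<Sum>n. emeasure (hausdorff_measure ?n) (B n)) = emeasure (hausdorff_measure ?n) (\<Union>n. B n)"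
        using Bb disjoint_family_disjointed[of G]
        by (intro suminf_emeasure) (auto simp: B_def disjoint_family_on_def)
      also have "\<dots> = hausdorff_outer ?n (\<Union>n. B n)"
        by (intro emeasure_hausdorff_measure sets.countable_UN) (use Bb in auto)
      also have "\<dots> \<le> Q"
        unfolding Q_def by (rule hausdorff_outer_mono) (auto simp: B_def)
      finally show ?thesis by (simp add: mult_left_mono)
    qed simp
    obtain q where q: "Q = ennreal q" "q \<ge> 0" using Qfin by (cases Q) auto
    define c where "c = 3 ^ ?n * (real k + 1) ^ (?n - 1) * q"
    have c: "c \<ge> 0" using q by (simp add: c_def)
    have "hausdorff_outer ?n (h ` E' k) \<le> 0"
    proof (rule ennreal_le_epsilon)
      fix e :: real assume e: "0 < e"
      define \<eta> where "\<eta> = min 1 (e / (c + 1))"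
      have \<eta>: "0 < \<eta>" "\<eta> \<le> 1" "\<eta> \<le> e / (c + 1)" using e c by (auto simp: \<eta>_def)
      have "\<eta> * c \<le> e / (c + 1) * c" using \<eta> c by (intro mult_right_mono) auto
      also have "\<dots> \<le> e" using e c by (simp add: field_simps)
      finally have "\<eta> * c \<le> e" .
      have "hausdorff_outer ?n (h ` E' k) \<le> ennreal (3 ^ ?n * (real k + 1) ^ (?n - 1) * \<eta>) * ennreal q"
        using le[OF \<eta>(1,2)] q by simp
      also have "\<dots> = ennreal (\<eta> * c)"
        using \<eta> q by (simp add: ennreal_mult[symmetric] c_def mult_ac)
      also have "\<dots> \<le> ennreal e" using \<open>\<eta> * c \<le> e\<close> by (rule ennreal_leI)
      finally show "hausdorff_outer ?n (h ` E' k) \<le> 0 + ennreal e" by simp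
    qed
    then show ?thesis by simp
  qed
  then have "hausdorff_outer ?n (\<Union>k. h ` E' k) = 0" by (rule hausdorff_outer_zero_UN)
  moreover have "h ` E \<subseteq> (\<Union>k. h ` E' k)"
  proof
    fix z assume "z \<in> h ` E"
    then obtain p where p: "p \<in> E" "z = h p" by auto
    obtain k :: nat where "max (norm p) (norm (h' p)) \<le> real k" using real_arch_simple by blast
    then have "p \<in> E' k" using p by (simp add: E'_def)
    then show "z \<in> (\<Union>k. h ` E' k)" using p by blast
  qed
  ultimately show ?thesis by (rule hausdorff_outer_zero_mono)
qed

section \<open>The area formula on a hypersurface\<close>

lemma hausdorff_outer_zero_locally:
  fixes f :: "'a::{second_countable_topology} \<Rightarrow> 'b::metric_space"
  assumes "\<And>x. x \<in> E \<Longrightarrow> \<exists>G. open G \<and> x \<in> G \<and> hausdorff_outer s (f ` (E \<inter> G)) = 0"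
  shows "hausdorff_outer s (f ` E) = 0"
proof -
  let ?F = "{G. open G \<and> hausdorff_outer s (f ` (E \<inter> G)) = 0}"
  obtain F where F: "F \<subseteq> ?F" "countable F" "\<Union>F = \<Union>?F"
    by (rule Lindelof[of ?F]) auto
  have "E \<subseteq> \<Union>F" unfolding F(3) using assms by blast
  then have "f ` E \<subseteq> \<Union>((\<lambda>G. f ` (E \<inter> G)) ` F)" by blast
  moreover have "hausdorff_outer s (\<Union>((\<lambda>G. f ` (E \<inter> G)) ` F)) = 0"
    using F(1,2) by (intro hausdorff_outer_zero_countable_Union) auto
  ultimately show ?thesis by (rule hausdorff_outer_zero_mono[rotated])
qed

lemma hausdorff_outer_zero_C1_image:
  fixes h :: "'a::euclidean_space \<Rightarrow> 'b::euclidean_space" and h' :: "'a \<Rightarrow> 'a \<Rightarrow>\<^sub>L 'b"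
  assumes U: "open U" and der: "\<And>u. u \<in> U \<Longrightarrow> (h has_derivative blinfun_apply (h' u)) (at u)"
    and cont: "continuous_on U h'" and E: "E \<subseteq> U" "hausdorff_outer s E = 0"
  shows "hausdorff_outer s (h ` E) = 0"
proof (rule hausdorff_outer_zero_locally)
  fix p assume p: "p \<in> E"
  obtain r where r: "0 < r" "ball p r \<subseteq> U"
    "\<And>a b. a \<in> ball p r \<Longrightarrow> b \<in> ball p r \<Longrightarrow> norm (h a - h b - h' p (a - b)) \<le> 1 * norm (a - b)"
    using C1_strict_derivative[OF U _ der cont, of p 1] p E(1) by (metis subsetD zero_less_one)
  have lip: "dist (h a) (h b) \<le> (norm (h' p) + 1) * dist a b" if "a \<in> ball p r" "b \<in> ball p r" for a b
    using r(3)[OF that] norm_triangle_ineq2[of "h a - h b" "h' p (a - b)"] norm_blinfun[of "h' p" "a - b"]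
    by (simp add: dist_norm algebra_simps)
  have "hausdorff_outer s (h ` (E \<inter> ball p r)) = 0"
    using lip by (intro hausdorff_outer_zero_lipschitz_image[where L = "norm (h' p) + 1"]
      hausdorff_outer_zero_mono[OF E(2)]) auto
  then show "\<exists>G. open G \<and> p \<in> G \<and> hausdorff_outer s (h ` (E \<inter> G)) = 0"
    using r(1) by (intro exI[of _ "ball p r"]) auto
qed

lemma borel_vimage_continuous_on:
  assumes f: "continuous_on X f" and X: "X \<in> sets borel" and A: "A \<in> sets borel"
  shows "{x \<in> X. f x \<in> A} \<in> sets borel"
proof -
  have "f \<in> borel_measurable (restrict_space borel X)"
    using f by (rule borel_measurable_continuous_on_restrict)
  from measurable_sets[OF this A] show ?thesis
    using X by (simp add: sets_restrict_space_iff space_restrict_space vimage_def Int_def conj_commute)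
qed

text \<open>Invariance of domain makes the inverse continuous on the image of \<open>X\<close>,
  which is open; so the image of \<open>A\<close> is a preimage under a continuous map.\<close>

lemma borel_image_inj_continuous:
  fixes h :: "'a::euclidean_space \<Rightarrow> 'a"
  assumes "open X" "continuous_on X h" "inj_on h X" "A \<subseteq> X" "A \<in> sets borel"
  shows "h ` A \<in> sets borel"
proof -
  obtain k where k: "homeomorphism X (h ` X) h k"
    using invariance_of_domain_homeomorphism[OF assms(1,2) _ assms(3)] by auto
  have "open (h ` X)" using assms(1-3) by (intro invariance_of_domain)
  have "h ` A = {z \<in> h ` X. k z \<in> A}"
    using k assms(4) by (auto simp: homeomorphism_def image_iff subset_iff)
  also have "\<dots> \<in> sets borel"
    using k assms(5) \<open>open (h ` X)\<close> by (intro borel_vimage_continuous_on) (auto simp: homeomorphism_def)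
  finally show ?thesis .
qed

lemma power_close_to_one:
  fixes \<epsilon> :: real
  assumes "0 < \<epsilon>"
  obtains \<delta> where "0 < \<delta>" "(1 + \<delta>) ^ n \<le> 1 + \<epsilon>"
proof -
  have "((\<lambda>x. (1 + x) ^ n) \<longlongrightarrow> (1 + 0) ^ n) (at_right (0::real))" by (intro tendsto_intros)
  then have "eventually (\<lambda>x. (1 + x) ^ n < 1 + \<epsilon>) (at_right (0::real))"
    using assms by (intro order_tendstoD) auto
  then obtain b where b: "0 < b" "\<And>x. 0 < x \<Longrightarrow> x < b \<Longrightarrow> (1 + x) ^ n < 1 + \<epsilon>"
    unfolding eventually_at_right_field by auto
  then show ?thesis by (intro that[of "b / 2"]) (auto intro: less_imp_le)
qed

lemma ennreal_le_of_le_factor: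
  fixes x y :: ennreal
  assumes "\<And>\<epsilon>::real. 0 < \<epsilon> \<Longrightarrow> x \<le> ennreal (1 + \<epsilon>) * y"
  shows "x \<le> y"
proof (cases y)
  case (real r)
  show ?thesis
  proof (rule ennreal_le_epsilon)
    fix e :: real assume e: "0 < e"
    define \<epsilon> where "\<epsilon> = e / (r + 1)"
    have \<epsilon>: "0 < \<epsilon>" "\<epsilon> * r \<le> e" using e real by (auto simp: \<epsilon>_def field_simps)
    have "x \<le> ennreal (1 + \<epsilon>) * ennreal r" using assms[OF \<epsilon>(1)] real by simp
    also have "\<dots> = ennreal (r + \<epsilon> * r)" using \<epsilon> real by (simp add: ennreal_mult[symmetric] algebra_simps)
    also have "\<dots> \<le> ennreal (r + e)" using \<epsilon> by (intro ennreal_leI) auto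
    also have "\<dots> = y + ennreal e" using real e by simp
    finally show "x \<le> y + ennreal e" .
  qed
qed simp

text \<open>
  \<open>w\<close> is the Jacobian along \<open>S\<close> of the map \<open>g\<close> of the ambient space to \<open>real ^ 'm\<close>, characterised
  by its effect on subsets of the tangent hyperplanes.
\<close>

locale hypersurface_map =
  fixes S Y Z :: "'m::finite pt set" and g :: "'m pt \<Rightarrow> real ^ 'm"
    and g' :: "'m pt \<Rightarrow> 'm pt \<Rightarrow>\<^sub>L (real ^ 'm)" and w :: "'m pt \<Rightarrow> real"
  assumes open_Z: "open Z"
    and g_der: "\<And>y. y \<in> Z \<Longrightarrow> (g has_derivative blinfun_apply (g' y)) (at y)"
    and g'_cont: "continuous_on Z g'"
    and Y_borel: "Y \<in> sets borel" and Y_sub: "Y \<subseteq> S \<inter> Z"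
    and param: "\<And>y. y \<in> Y \<Longrightarrow> has_local_C1_parametrization S y"
    and w_nonneg: "\<And>y. y \<in> Y \<Longrightarrow> 0 \<le> w y" and w_cont: "continuous_on Y w"
    and jacobian: "\<And>U \<phi> \<phi>' u B. C1_parametrization S U \<phi> \<phi>' \<Longrightarrow> u \<in> U \<Longrightarrow> \<phi> u \<in> Y \<Longrightarrow> 0 < w (\<phi> u) \<Longrightarrow>
        B \<in> sets borel \<Longrightarrow> B \<subseteq> range (blinfun_apply (\<phi>' u)) \<Longrightarrow>
        hausdorff_outer CARD('m) (g' (\<phi> u) ` B) = ennreal (w (\<phi> u)) * hausdorff_outer CARD('m) B"
    and jacobian_inj: "\<And>U \<phi> \<phi>' u. C1_parametrization S U \<phi> \<phi>' \<Longrightarrow> u \<in> U \<Longrightarrow> \<phi> u \<in> Y \<Longrightarrow> 0 < w (\<phi> u) \<Longrightarrow>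
        inj (\<lambda>v. g' (\<phi> u) (\<phi>' u v))"
    and critical: "\<And>U \<phi> \<phi>' u. C1_parametrization S U \<phi> \<phi>' \<Longrightarrow> u \<in> U \<Longrightarrow> \<phi> u \<in> Y \<Longrightarrow> w (\<phi> u) = 0 \<Longrightarrow>
        \<exists>v. v \<noteq> 0 \<and> g' (\<phi> u) (\<phi>' u v) = 0"
begin

text \<open>The measure that \<open>g\<close> carries to Hausdorff measure on
  \<open>real ^ 'm\<close>, as long as \<open>g\<close> is injective and \<open>w\<close>
  positive.\<close>

definition \<nu> :: "'m pt measure" where
  "\<nu> = density hausdorff_surface (\<lambda>y. ennreal (indicator Y y * w y))"

lemma g_cont: "continuous_on Z g"
  using g_der by (meson continuous_at_imp_continuous_on has_derivative_continuous)

lemma weight_measurable [measurable]: "(\<lambda>y. indicator Y y * w y) \<in> borel_measurable borel"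
  using borel_measurable_continuous_on_indicator[OF Y_borel w_cont] by simp

lemma sets_\<nu> [simp, measurable_cong]: "sets \<nu> = sets borel"
  by (simp add: \<nu>_def)

lemma emeasure_\<nu>:
  assumes "A \<in> sets borel" "A \<subseteq> Y"
  shows "emeasure \<nu> A = (\<integral>\<^sup>+y\<in>A. ennreal (w y) \<partial>hausdorff_surface)"
proof -
  have "emeasure \<nu> A = (\<integral>\<^sup>+y\<in>A. ennreal (indicator Y y * w y) \<partial>hausdorff_surface)"
    unfolding \<nu>_def using assms(1) by (intro emeasure_density) auto
  also have "\<dots> = (\<integral>\<^sup>+y\<in>A. ennreal (w y) \<partial>hausdorff_surface)"
    using assms(2) by (intro nn_integral_cong) (auto split: split_indicator)
  finally show ?thesis .
qed

lemma emeasure_\<nu>_le: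
  assumes "A \<in> sets borel" "A \<subseteq> Y" "\<And>y. y \<in> A \<Longrightarrow> w y \<le> c"
  shows "emeasure \<nu> A \<le> ennreal c * hausdorff_outer CARD('m) A"
proof -
  have "emeasure \<nu> A \<le> (\<integral>\<^sup>+y. ennreal c * indicator A y \<partial>hausdorff_surface)"
    unfolding emeasure_\<nu>[OF assms(1,2)] using assms(3)
    by (intro nn_integral_mono) (auto split: split_indicator intro: ennreal_leI)
  also have "\<dots> = ennreal c * hausdorff_outer CARD('m) A"
    using assms(1) by (simp add: nn_integral_cmult_indicator emeasure_hausdorff_measure)
  finally show ?thesis .
qed

lemma emeasure_\<nu>_ge:
  assumes "A \<in> sets borel" "A \<subseteq> Y" "\<And>y. y \<in> A \<Longrightarrow> c \<le> w y"
  shows "ennreal c * hausdorff_outer CARD('m) A \<le> emeasure \<nu> A"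
proof -
  have "ennreal c * hausdorff_outer CARD('m) A = (\<integral>\<^sup>+y. ennreal c * indicator A y \<partial>hausdorff_surface)"
    using assms(1) by (simp add: nn_integral_cmult_indicator emeasure_hausdorff_measure)
  also have "\<dots> \<le> emeasure \<nu> A"
    unfolding emeasure_\<nu>[OF assms(1,2)] using assms(3)
    by (intro nn_integral_mono) (auto split: split_indicator intro: ennreal_leI)
  finally show ?thesis .
qed

lemma composed_derivative:
  assumes P: "C1_parametrization S U \<phi> \<phi>'"
  defines "X \<equiv> {u \<in> U. \<phi> u \<in> Z}" and "k \<equiv> \<lambda>u. g' (\<phi> u) o\<^sub>L \<phi>' u"
  shows "open X" "\<And>u. u \<in> X \<Longrightarrow> (g \<circ> \<phi> has_derivative blinfun_apply (k u)) (at u)" "continuous_on X k"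
proof -
  have \<phi>: "open U" "\<And>u. u \<in> U \<Longrightarrow> (\<phi> has_derivative blinfun_apply (\<phi>' u)) (at u)" "continuous_on U \<phi>'"
    using P by (auto simp: C1_parametrization_def)
  have cont: "continuous_on U \<phi>"
    using \<phi>(2) by (meson continuous_at_imp_continuous_on has_derivative_continuous)
  show "open X"
    using continuous_open_preimage[OF cont \<phi>(1) open_Z] by (simp add: X_def vimage_def Int_def)
  show "(g \<circ> \<phi> has_derivative blinfun_apply (k u)) (at u)" if u: "u \<in> X" for u
    using diff_chain_at[OF \<phi>(2) g_der, of u] u by (simp add: X_def k_def comp_def blinfun_compose.rep_eq)
  have "continuous_on X (\<lambda>u. g' (\<phi> u))"
    using cont by (intro continuous_on_compose2[OF g'_cont]) (auto simp: X_def intro: continuous_on_subset)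
  moreover have "continuous_on X \<phi>'" using \<phi>(3) by (rule continuous_on_subset) (auto simp: X_def)
  ultimately show "continuous_on X k"
    unfolding k_def by (rule bounded_bilinear.continuous_on[OF bounded_bilinear_blinfun_compose])
qed

text \<open>A chart turns \<open>A\<close> into \<open>A0\<close>. Up to factors near 1,
  \<open>A\<close> has the measure of the flat piece \<open>\<phi>' p\<close> makes of
  \<open>A0\<close>, and its image under \<open>g\<close> that of the flat piece made by
  \<open>k p\<close>. Between the two flat pieces \<open>jacobian\<close> gives the exact factor
  \<open>w y0\<close>, and \<open>w\<close> is nearly constant.\<close>

lemma local_comparison:
  assumes y0: "y0 \<in> Y" "0 < w y0" and \<epsilon>: "0 < \<epsilon>"
  shows "\<exists>G. open G \<and> y0 \<in> G \<and> (\<forall>A. A \<in> sets borel \<and> A \<subseteq> G \<inter> Y \<longrightarrow> g ` A \<in> sets borel \<and>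
     hausdorff_outer CARD('m) (g ` A) \<le> ennreal (1 + \<epsilon>) * emeasure \<nu> A \<and>
     emeasure \<nu> A \<le> ennreal (1 + \<epsilon>) * hausdorff_outer CARD('m) (g ` A))"
proof -
  let ?H = "hausdorff_outer CARD('m)"
  \<comment> \<open>\<open>CARD('m)\<close> powers of \<open>1 + \<delta>\<close> are lost in each
    of the two bilipschitz comparisons, and one more through the oscillation of
    \<open>w\<close>.\<close>
  obtain \<delta> where \<delta>: "0 < \<delta>" "(1 + \<delta>) ^ (2 * CARD('m) + 1) \<le> 1 + \<epsilon>"
    using power_close_to_one[OF \<epsilon>] by blast
  obtain U \<phi> \<phi>' p where P: "C1_parametrization S U \<phi> \<phi>'" and p: "p \<in> U" "\<phi> p = y0"
    using param[OF y0(1)] by (auto simp: has_local_C1_parametrization_def)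
  have \<phi>: "open U" "openin (top_of_set S) (\<phi> ` U)" "\<And>u. u \<in> U \<Longrightarrow> (\<phi> has_derivative blinfun_apply (\<phi>' u)) (at u)"
    "continuous_on U \<phi>'" "inj (blinfun_apply (\<phi>' p))"
    using P p by (auto simp: C1_parametrization_def)
  obtain \<psi> where \<psi>: "homeomorphism U (\<phi> ` U) \<phi> \<psi>" using P by (auto simp: C1_parametrization_def)
  define X where "X = {u \<in> U. \<phi> u \<in> Z}"
  define k where "k = (\<lambda>u. g' (\<phi> u) o\<^sub>L \<phi>' u)"
  define h where "h = g \<circ> \<phi>"
  have comp: "open X" "\<And>u. u \<in> X \<Longrightarrow> (h has_derivative blinfun_apply (k u)) (at u)" "continuous_on X k"
    using composed_derivative[OF P] by (auto simp: X_def k_def h_def)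
  have pX: "p \<in> X" using p y0 Y_sub by (auto simp: X_def)
  have kinj: "inj (blinfun_apply (k p))"
    using jacobian_inj[OF P p(1)] p(2) y0 by (simp add: k_def blinfun_compose.rep_eq comp_def)
  obtain r1 where r1: "0 < r1" "ball p r1 \<subseteq> U"
    "\<And>a b. a \<in> ball p r1 \<Longrightarrow> b \<in> ball p r1 \<Longrightarrow> dist (\<phi>' p a) (\<phi>' p b) \<le> (1 + \<delta>) * dist (\<phi> a) (\<phi> b)"
    "\<And>a b. a \<in> ball p r1 \<Longrightarrow> b \<in> ball p r1 \<Longrightarrow> dist (\<phi> a) (\<phi> b) \<le> (1 + \<delta>) * dist (\<phi>' p a) (\<phi>' p b)"
    using C1_bilipschitz[OF \<phi>(1) p(1) \<phi>(3-5) \<delta>(1)] by blast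
  obtain r2 where r2: "0 < r2" "ball p r2 \<subseteq> X"
    "\<And>a b. a \<in> ball p r2 \<Longrightarrow> b \<in> ball p r2 \<Longrightarrow> dist (k p a) (k p b) \<le> (1 + \<delta>) * dist (h a) (h b)"
    "\<And>a b. a \<in> ball p r2 \<Longrightarrow> b \<in> ball p r2 \<Longrightarrow> dist (h a) (h b) \<le> (1 + \<delta>) * dist (k p a) (k p b)"
    using C1_bilipschitz[OF comp(1) pX comp(2,3) kinj \<delta>(1)] by blast
  define r where "r = min r1 r2"
  define B where "B = ball p r"
  have B: "p \<in> B" "B \<subseteq> ball p r1" "B \<subseteq> ball p r2" "B \<subseteq> U" "open B"
    using r1 r2 by (auto simp: B_def r_def)
  have "openin (top_of_set (\<phi> ` U)) (\<phi> ` B)"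
    using \<psi> B(4,5) by (intro homeomorphism_imp_open_map) (auto simp: open_subset)
  then have "openin (top_of_set S) (\<phi> ` B)" using \<phi>(2) by (rule openin_trans)
  then obtain G1 where G1: "open G1" "\<phi> ` B = S \<inter> G1" by (auto simp: openin_open)
  \<comment> \<open>The oscillation \<open>q\<close> is chosen so that \<open>w y0 - q\<close> is
    \<open>w y0\<close> divided by \<open>1 + \<delta>\<close>; then \<open>w y0 + q\<close> is
    below \<open>(1 + \<delta>) * w y0\<close>.\<close>
  define q where "q = w y0 * \<delta> / (1 + \<delta>)"
  have q: "0 < q" "w y0 + q \<le> (1 + \<delta>) * w y0" "(1 + \<delta>) * (w y0 - q) = w y0"
    using \<delta> y0 by (auto simp: q_def field_simps)
  obtain d where d: "0 < d" "\<And>y. y \<in> Y \<Longrightarrow> dist y y0 < d \<Longrightarrow> dist (w y) (w y0) < q"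
    using w_cont y0(1) q(1) unfolding continuous_on_iff by metis
  show ?thesis
  proof (intro exI[of _ "G1 \<inter> ball y0 d"] conjI allI impI)
    show "open (G1 \<inter> ball y0 d)" using G1 by auto
    have "y0 \<in> \<phi> ` B" using B(1) p(2) by auto
    then show "y0 \<in> G1 \<inter> ball y0 d" using G1 d by auto
    fix A assume A: "A \<in> sets borel \<and> A \<subseteq> G1 \<inter> ball y0 d \<inter> Y"
    define A0 where "A0 = {u \<in> B. \<phi> u \<in> A}"
    have "continuous_on B \<phi>" using \<psi> B(4) by (auto simp: homeomorphism_def intro: continuous_on_subset)
    then have A0: "A0 \<in> sets borel" "A0 \<subseteq> B"
      unfolding A0_def using B(5) A by (auto intro: borel_vimage_continuous_on)
    have "A \<subseteq> \<phi> ` B" using A Y_sub G1(2) by auto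
    then have \<phi>A: "\<phi> ` A0 = A" unfolding A0_def by blast
    have gA: "g ` A = h ` A0" unfolding h_def \<phi>A[symmetric] by (simp add: image_comp)
    have hinj: "inj_on h B"
    proof (rule inj_onI)
      fix a b assume ab: "a \<in> B" "b \<in> B" "h a = h b"
      then have "dist (k p a) (k p b) \<le> 0" using r2(3)[OF subsetD[OF B(3) ab(1)] subsetD[OF B(3) ab(2)]] ab(3) by simp
      then show "a = b" using kinj by (auto simp: inj_def)
    qed
    have "continuous_on X h"
      using comp(2) by (meson continuous_at_imp_continuous_on has_derivative_continuous)
    then have "continuous_on B h" using B(3) r2(2) by (meson continuous_on_subset)
    then show "g ` A \<in> sets borel"
      unfolding gA using hinj A0 B(5) by (intro borel_image_inj_continuous[of B])
    define L where "L = \<phi>' p ` A0"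
    have M: "k p ` A0 = g' y0 ` L" by (simp add: L_def k_def p(2) image_image)
    have Lb: "L \<in> sets borel"
      unfolding L_def using \<phi>(5) A0(1)
      by (intro inj_linear_image_borel) (simp_all add: blinfun.bounded_linear_right bounded_linear.linear)
    have jac: "?H (k p ` A0) = ennreal (w y0) * ?H L"
      unfolding M using jacobian[OF P p(1), of L] p(2) y0 Lb by (auto simp: L_def)
    let ?C = "ennreal ((1 + \<delta>) ^ CARD('m))" and ?D = "ennreal (1 + \<delta>)"
    have pos: "0 < 1 + \<delta>" using \<delta> by simp
    have in1: "a \<in> ball p r1" and in2: "a \<in> ball p r2" if "a \<in> A0" for a using that A0(2) B by auto
    have 1: "?H (h ` A0) \<le> ?C * ?H (k p ` A0)" "?H (k p ` A0) \<le> ?C * ?H (h ` A0)"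
      using r2(3,4) in2 by (intro hausdorff_outer_image_le pos; blast)+
    have 2: "?H A \<le> ?C * ?H L" "?H L \<le> ?C * ?H A"
      unfolding L_def \<phi>A[symmetric] using r1(3,4) in1 by (intro hausdorff_outer_image_le pos; blast)+
    have wA: "w y \<le> (1 + \<delta>) * w y0" "w y0 - q \<le> w y" if "y \<in> A" for y
    proof -
      have "y \<in> Y" "dist y y0 < d" using that A by (auto simp: dist_commute)
      then have "\<bar>w y - w y0\<bar> < q" using d(2) by (simp add: dist_real_def)
      then show "w y \<le> (1 + \<delta>) * w y0" "w y0 - q \<le> w y" using q(2) by linarith+
    qed
    have 3: "emeasure \<nu> A \<le> ?D * (ennreal (w y0) * ?H A)"
      using emeasure_\<nu>_le[of A "(1 + \<delta>) * w y0"] A wA(1) \<delta>(1) y0(2) by (simp add: ennreal_mult mult.assoc)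
    have "ennreal (w y0 - q) * ?H A \<le> emeasure \<nu> A" using emeasure_\<nu>_ge[of A "w y0 - q"] A wA(2) by auto
    then have "?D * (ennreal (w y0 - q) * ?H A) \<le> ?D * emeasure \<nu> A" by (rule mult_left_mono) simp
    moreover have "?D * ennreal (w y0 - q) = ennreal (w y0)"
      using q(3) \<delta>(1) by (subst ennreal_mult'[symmetric]) auto
    ultimately have 4: "ennreal (w y0) * ?H A \<le> ?D * emeasure \<nu> A" by (simp add: mult.assoc[symmetric])
    have CCD: "?C * (?C * (?D * x)) \<le> ennreal (1 + \<epsilon>) * x" for x
    proof -
      have "?C * (?C * ?D) = ennreal ((1 + \<delta>) ^ (2 * CARD('m) + 1))"
      proof -
        have "(1 + \<delta>) ^ (2 * CARD('m) + 1) = (1 + \<delta>) ^ CARD('m) * ((1 + \<delta>) ^ CARD('m) * (1 + \<delta>))"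
          by (simp add: power_add mult_2)
        then show ?thesis using pos by (simp only: ennreal_mult' zero_le_power less_imp_le)
      qed
      then have "?C * (?C * (?D * x)) = ennreal ((1 + \<delta>) ^ (2 * CARD('m) + 1)) * x"
        by (simp add: mult.assoc[symmetric])
      also have "\<dots> \<le> ennreal (1 + \<epsilon>) * x" using \<delta>(2) by (intro mult_right_mono ennreal_leI) auto
      finally show ?thesis .
    qed
    have "?H (g ` A) \<le> ?C * (ennreal (w y0) * ?H L)" using 1(1) jac gA by simp
    also have "\<dots> \<le> ?C * (ennreal (w y0) * (?C * ?H A))" by (intro mult_left_mono 2) auto
    also have "\<dots> = ?C * (?C * (ennreal (w y0) * ?H A))" by (simp add: mult_ac)
    also have "\<dots> \<le> ?C * (?C * (?D * emeasure \<nu> A))" by (intro mult_left_mono 4) auto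
    finally show "?H (g ` A) \<le> ennreal (1 + \<epsilon>) * emeasure \<nu> A" using CCD order_trans by blast
    have "emeasure \<nu> A \<le> ?D * (ennreal (w y0) * (?C * ?H L))"
      by (rule order_trans[OF 3]) (intro mult_left_mono 2; simp)
    also have "\<dots> = ?D * (?C * ?H (k p ` A0))" by (simp add: jac mult_ac)
    also have "\<dots> \<le> ?D * (?C * (?C * ?H (h ` A0)))" by (intro mult_left_mono 1) auto
    also have "\<dots> = ?C * (?C * (?D * ?H (g ` A)))" by (simp add: gA mult_ac)
    finally show "emeasure \<nu> A \<le> ennreal (1 + \<epsilon>) * ?H (g ` A)" using CCD order_trans by blast
  qed
qed

text \<open>Countably many of the neighbourhoods from \<open>local_comparison\<close> cover
  \<open>B\<close>. Made disjoint, they have disjoint images because \<open>g\<close> is injective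
  on \<open>B\<close>, so both measures are sums over the pieces and the factor
  \<open>1 + \<epsilon>\<close> carries over.\<close>

lemma emeasure_image_approx:
  assumes B: "B \<in> sets borel" "B \<subseteq> Y" "inj_on g B" "\<And>y. y \<in> B \<Longrightarrow> 0 < w y" and \<epsilon>: "0 < \<epsilon>"
  shows "g ` B \<in> sets borel \<and>
     hausdorff_outer CARD('m) (g ` B) \<le> ennreal (1 + \<epsilon>) * emeasure \<nu> B \<and>
     emeasure \<nu> B \<le> ennreal (1 + \<epsilon>) * hausdorff_outer CARD('m) (g ` B)"
proof (cases "B = {}")
  case False
  let ?H = "hausdorff_outer CARD('m)"
  define good where "good G \<longleftrightarrow> open G \<and> (\<forall>A. A \<in> sets borel \<and> A \<subseteq> G \<inter> Y \<longrightarrow> g ` A \<in> sets borel \<and>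
     ?H (g ` A) \<le> ennreal (1 + \<epsilon>) * emeasure \<nu> A \<and> emeasure \<nu> A \<le> ennreal (1 + \<epsilon>) * ?H (g ` A))" for G
  obtain F where F: "F \<subseteq> Collect good" "countable F" "\<Union>F = \<Union>(Collect good)"
    by (rule Lindelof[of "Collect good"]) (auto simp: good_def)
  have "\<exists>G. good G \<and> y \<in> G" if "y \<in> B" for y
    using local_comparison[of y \<epsilon>] that B(2,4) \<epsilon> unfolding good_def by blast
  then have cover: "B \<subseteq> \<Union>F" unfolding F(3) by blast
  then have "F \<noteq> {}" using False by auto
  define G where "G = from_nat_into F"
  have GF: "good (G n)" for n unfolding G_def using from_nat_into[OF \<open>F \<noteq> {}\<close>] F(1) by auto
  have UG: "(\<Union>n. G n) = \<Union>F" using F(2) \<open>F \<noteq> {}\<close> by (simp add: G_def)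
  define A where "A n = B \<inter> disjointed G n" for n
  have Gb: "G n \<in> sets borel" for n using GF[of n] by (auto simp: good_def)
  have Ab: "A n \<in> sets borel" for n
    unfolding A_def using sets.range_disjointed_sets[of G borel] Gb B(1) by (intro sets.Int) auto
  have AB: "A n \<subseteq> B" "A n \<subseteq> G n \<inter> Y" for n
    using disjointed_subset[of G n] B(2) by (auto simp: A_def)
  have "(\<Union>n. A n) = B \<inter> (\<Union>n. disjointed G n)" by (auto simp: A_def)
  then have UA: "(\<Union>n. A n) = B" using cover UG by (auto simp: UN_disjointed_eq)
  have dis: "disjoint_family A"
    using disjoint_family_disjointed[of G] by (auto simp: A_def disjoint_family_on_def)
  have gA: "g ` A n \<in> sets borel" "?H (g ` A n) \<le> ennreal (1 + \<epsilon>) * emeasure \<nu> (A n)"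
    "emeasure \<nu> (A n) \<le> ennreal (1 + \<epsilon>) * ?H (g ` A n)" for n
    using GF[of n] Ab[of n] AB(2)[of n] unfolding good_def by blast+
  have gB: "g ` B = (\<Union>n. g ` A n)" by (subst UA[symmetric]) (rule image_UN)
  have gBb: "g ` B \<in> sets borel" unfolding gB using gA(1) by (intro sets.countable_UN) auto
  have gdis: "disjoint_family (\<lambda>n. g ` A n)"
    unfolding disjoint_family_on_def
  proof (intro ballI impI)
    fix m n :: nat assume "m \<noteq> n"
    then have "A m \<inter> A n = {}" using dis by (simp add: disjoint_family_on_def)
    then show "g ` A m \<inter> g ` A n = {}"
      using inj_on_image_Int[OF B(3) AB(1)[of m] AB(1)[of n]] by simp
  qed
  have "?H (g ` B) = emeasure (hausdorff_measure CARD('m)) (\<Union>n. g ` A n)"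
    using gBb by (simp add: emeasure_hausdorff_measure gB)
  also have "\<dots> = (\<Sum>n. emeasure (hausdorff_measure CARD('m)) (g ` A n))"
    using gA(1) gdis by (intro suminf_emeasure[symmetric]) auto
  finally have 1: "?H (g ` B) = (\<Sum>n. ?H (g ` A n))" using gA(1) by (simp add: emeasure_hausdorff_measure)
  have "emeasure \<nu> B = emeasure \<nu> (\<Union>n. A n)" by (simp only: UA)
  also have "\<dots> = (\<Sum>n. emeasure \<nu> (A n))" using Ab dis by (intro suminf_emeasure[symmetric]) auto
  finally have 2: "emeasure \<nu> B = (\<Sum>n. emeasure \<nu> (A n))" .
  have "?H (g ` B) \<le> ennreal (1 + \<epsilon>) * emeasure \<nu> B"
    unfolding 1 2 ennreal_suminf_cmult[symmetric] by (intro suminf_le gA) auto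
  moreover have "emeasure \<nu> B \<le> ennreal (1 + \<epsilon>) * ?H (g ` B)"
    unfolding 1 2 ennreal_suminf_cmult[symmetric] by (intro suminf_le gA) auto
  ultimately show ?thesis using gBb by blast
qed simp

lemma emeasure_image:
  assumes "B \<in> sets borel" "B \<subseteq> Y" "inj_on g B" "\<And>y. y \<in> B \<Longrightarrow> 0 < w y"
  shows "g ` B \<in> sets borel" "emeasure (hausdorff_measure CARD('m)) (g ` B) = emeasure \<nu> B"
proof -
  note approx = emeasure_image_approx[OF assms]
  show gB: "g ` B \<in> sets borel" using approx[of 1] by simp
  have "hausdorff_outer CARD('m) (g ` B) = emeasure \<nu> B"
  proof (rule antisym)
    show "hausdorff_outer CARD('m) (g ` B) \<le> emeasure \<nu> B"
      by (rule ennreal_le_of_le_factor) (use approx in blast)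
    show "emeasure \<nu> B \<le> hausdorff_outer CARD('m) (g ` B)"
      by (rule ennreal_le_of_le_factor) (use approx in blast)
  qed
  then show "emeasure (hausdorff_measure CARD('m)) (g ` B) = emeasure \<nu> B"
    using gB by (simp add: emeasure_hausdorff_measure)
qed

theorem area_formula:
  assumes B: "B \<in> sets borel" "B \<subseteq> Y" "inj_on g B" "\<And>y. y \<in> B \<Longrightarrow> 0 < w y"
    and q [measurable]: "q \<in> borel_measurable borel"
  shows "(\<integral>\<^sup>+y\<in>B. q (g y) * ennreal (w y) \<partial>hausdorff_surface) =
    (\<integral>\<^sup>+u\<in>g ` B. q u \<partial>hausdorff_measure CARD('m))"
proof -
  \<comment> \<open>A version of \<open>g\<close> that is Borel on the whole space; \<open>g\<close>
    itself is controlled only on \<open>Z\<close>.\<close>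
  define g0 where "g0 y = (if y \<in> B then g y else 0)" for y
  have "continuous_on B g" using g_cont B(2) Y_sub by (meson continuous_on_subset le_inf_iff)
  then have "(\<lambda>y. indicator B y *\<^sub>R g y) \<in> borel_measurable borel"
    using B(1) by (rule borel_measurable_continuous_on_indicator[rotated])
  also have "(\<lambda>y. indicator B y *\<^sub>R g y) = g0" by (auto simp: g0_def indicator_def)
  finally have [measurable]: "g0 \<in> borel_measurable borel" .
  have [measurable]: "B \<in> sets borel" "g ` B \<in> sets borel" using B emeasure_image(1)[OF B] by auto
  let ?M1 = "distr (density \<nu> (indicator B)) borel g0"
  let ?M2 = "density (hausdorff_measure CARD('m)) (indicator (g ` B)) :: (real ^ 'm) measure"
  have "?M1 = ?M2"
  proof (rule measure_eqI)
    show "sets ?M1 = sets ?M2" by simp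
    fix C assume "C \<in> sets ?M1"
    then have [measurable]: "C \<in> sets borel" by simp
    define B' where "B' = {y \<in> B. g0 y \<in> C}"
    have B'[measurable]: "B' \<in> sets borel" unfolding B'_def by measurable
    have sub: "B' \<subseteq> B" by (auto simp: B'_def)
    have gB': "g ` B' = g ` B \<inter> C" by (auto simp: B'_def g0_def)
    have "emeasure ?M1 C = emeasure (density \<nu> (indicator B)) {y. g0 y \<in> C}"
      by (subst emeasure_distr) (auto simp: vimage_def \<nu>_def)
    also have "\<dots> = (\<integral>\<^sup>+y. indicator B y * indicator {y. g0 y \<in> C} y \<partial>\<nu>)"
      by (subst emeasure_density) auto
    also have "\<dots> = (\<integral>\<^sup>+y. indicator B' y \<partial>\<nu>)"
      by (intro nn_integral_cong) (auto split: split_indicator simp: B'_def)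
    also have "\<dots> = emeasure \<nu> B'" by simp
    also have "\<dots> = emeasure (hausdorff_measure CARD('m)) (g ` B')"
      using sub B by (intro emeasure_image(2)[symmetric]) (auto intro: inj_on_subset)
    also have "\<dots> = (\<integral>\<^sup>+u. indicator (g ` B \<inter> C) u \<partial>hausdorff_measure CARD('m))"
      unfolding gB' by (rule nn_integral_indicator[symmetric]) simp
    also have "\<dots> = (\<integral>\<^sup>+u. indicator (g ` B) u * indicator C u \<partial>hausdorff_measure CARD('m))"
      by (intro nn_integral_cong) (auto split: split_indicator)
    also have "\<dots> = emeasure ?M2 C"
      by (rule emeasure_density[symmetric]) auto
    finally show "emeasure ?M1 C = emeasure ?M2 C" .
  qed
  then have "(\<integral>\<^sup>+u. q u \<partial>?M1) = (\<integral>\<^sup>+u. q u \<partial>?M2)" by simp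
  also have "(\<integral>\<^sup>+u. q u \<partial>?M2) = (\<integral>\<^sup>+u\<in>g ` B. q u \<partial>hausdorff_measure CARD('m))"
    by (subst nn_integral_density) (auto simp: mult.commute)
  also have "(\<integral>\<^sup>+u. q u \<partial>?M1) = (\<integral>\<^sup>+y. indicator B y * q (g0 y) \<partial>\<nu>)"
    by (subst nn_integral_distr) (auto simp: nn_integral_density)
  also have "\<dots> = (\<integral>\<^sup>+y. ennreal (indicator Y y * w y) * (indicator B y * q (g0 y)) \<partial>hausdorff_surface)"
    unfolding \<nu>_def by (subst nn_integral_density) auto
  also have "\<dots> = (\<integral>\<^sup>+y\<in>B. q (g y) * ennreal (w y) \<partial>hausdorff_surface)"
    using B(2) by (intro nn_integral_cong) (auto split: split_indicator simp: g0_def mult.commute)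
  finally show ?thesis by simp
qed

text \<open>In a chart, the points with \<open>w\<close> equal to 0 are points where the derivative
  of the composition of \<open>g\<close> with the chart has a kernel, and that composition maps
  between spaces of the same dimension.\<close>

lemma critical_values_null:
  "hausdorff_outer CARD('m) (g ` {y \<in> Y. w y = 0}) = 0"
proof (rule hausdorff_outer_zero_locally)
  fix y assume y: "y \<in> {y \<in> Y. w y = 0}"
  obtain U \<phi> \<phi>' p where P: "C1_parametrization S U \<phi> \<phi>'" and p: "p \<in> U" "\<phi> p = y"
    using param[of y] y by (auto simp: has_local_C1_parametrization_def)
  obtain G where G: "open G" "\<phi> ` U = S \<inter> G"
    using P by (auto simp: C1_parametrization_def openin_open)
  note comp = composed_derivative[OF P]
  define E where "E = {u \<in> U. \<phi> u \<in> Y \<and> w (\<phi> u) = 0}"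
  have "E \<subseteq> {u \<in> U. \<phi> u \<in> Z}" using Y_sub by (auto simp: E_def)
  moreover have "\<exists>v. v \<noteq> 0 \<and> (g' (\<phi> u) o\<^sub>L \<phi>' u) v = 0" if "u \<in> E" for u
    using critical[OF P, of u] that by (simp add: E_def)
  ultimately have "hausdorff_outer DIM(real ^ 'm) ((g \<circ> \<phi>) ` E) = 0"
    using comp by (intro hausdorff_outer_critical_image[of "{u \<in> U. \<phi> u \<in> Z}" _ "\<lambda>u. g' (\<phi> u) o\<^sub>L \<phi>' u"]) auto
  then have "hausdorff_outer CARD('m) ((g \<circ> \<phi>) ` E) = 0" by simp
  moreover have "g ` ({y \<in> Y. w y = 0} \<inter> G) \<subseteq> (g \<circ> \<phi>) ` E"
  proof
    fix z assume "z \<in> g ` ({y \<in> Y. w y = 0} \<inter> G)"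
    then obtain x where x: "z = g x" "x \<in> Y" "w x = 0" "x \<in> G" by auto
    then have "x \<in> \<phi> ` U" using G Y_sub by auto
    then obtain u where u: "u \<in> U" "x = \<phi> u" by auto
    then have "u \<in> E" using x by (simp add: E_def)
    then show "z \<in> (g \<circ> \<phi>) ` E" using x(1) u(2) by auto
  qed
  ultimately have "hausdorff_outer CARD('m) (g ` ({y \<in> Y. w y = 0} \<inter> G)) = 0"
    by (rule hausdorff_outer_zero_mono)
  then show "\<exists>G. open G \<and> y \<in> G \<and> hausdorff_outer CARD('m) (g ` ({y \<in> Y. w y = 0} \<inter> G)) = 0"
    using G p by blast
qed

end

section \<open>Boundaries with interior cones\<close>

text \<open>
  The common consequence of the Lipschitz condition and of convexity that is used for both domains:
  near every boundary point there is a cone of directions leading into \<open>D\<close>.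
\<close>

definition cone_boundary :: "'m::finite pt set \<Rightarrow> bool" where
  "cone_boundary D \<longleftrightarrow> (\<forall>x\<in>frontier D. \<exists>e \<rho> r. norm e = 1 \<and> 0 < \<rho> \<and> 0 < r \<and>
     (\<forall>y\<in>frontier D \<inter> ball x r. \<forall>t. 0 < t \<and> t < r \<longrightarrow> ball (y + t *\<^sub>R e) (t * \<rho>) \<subseteq> D \<and> y - t *\<^sub>R e \<notin> D))"

lemma norm_fst_le': "norm (fst z) \<le> norm z" and norm_snd_le': "norm (snd z) \<le> norm z"
  by (cases z, simp add: norm_fst_le norm_snd_le)+

lemma frontier_not_in_open: "open D \<Longrightarrow> x \<in> frontier D \<Longrightarrow> x \<notin> D"
  by (simp add: frontier_def interior_open)

text \<open>In the chart \<open>D\<close> lies above the graph of \<open>f\<close>, and a Lipschitz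
  graph stays out of an upright cone with apex on it. The axis \<open>e\<close> is the vertical
  direction pulled back by the isometry.\<close>

lemma lipschitz_boundary_imp_cone_boundary:
  fixes D :: "'m::finite pt set"
  assumes "open D" "lipschitz_boundary D"
  shows "cone_boundary D"
  unfolding cone_boundary_def
proof
  fix x assume x: "x \<in> frontier D"
  from bspec[OF assms(2)[unfolded lipschitz_boundary_def] x]
  obtain \<epsilon> I f L where \<epsilon>: "\<epsilon> > 0" and I: "affine_isometry I" "I x = 0" and f: "L-lipschitz_on UNIV f"
    and img: "I ` (D \<inter> ball x \<epsilon>) = {z \<in> ball 0 \<epsilon>. snd z > f (fst z)}"
    by (elim exE conjE) (rule that)
  obtain T a where T: "orthogonal_transformation T" "I = (\<lambda>z. T z + a)"
    using I(1) by (auto simp: affine_isometry_def)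
  have linT: "linear T" using T(1) by (rule orthogonal_transformation_linear)
  have Ix: "I z = T (z - x)" for z
    using I(2) T(2) by (simp add: linear_diff[OF linT] add_eq_0_iff)
  have normT: "norm (T z) = norm z" for z using T(1) by (rule orthogonal_transformation_norm)
  have injT: "inj T" using T(1) by (rule orthogonal_transformation_inj)
  define p where "p z = fst (T (z - x))" for z
  define h where "h z = snd (T (z - x))" for z
  have D: "z \<in> D \<longleftrightarrow> h z > f (p z)" if z: "z \<in> ball x \<epsilon>" for z
  proof -
    have z0: "T (z - x) \<in> ball 0 \<epsilon>" using z by (simp add: normT dist_norm norm_minus_commute)
    have "inj I"
    proof (rule injI)
      fix a b assume "I a = I b"
      then show "a = b" using injD[OF injT, of "a - x" "b - x"] by (simp add: Ix)
    qed
    then have "z \<in> D \<longleftrightarrow> I z \<in> I ` (D \<inter> ball x \<epsilon>)"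
      using z by (simp only: inj_image_mem_iff) simp
    then show ?thesis unfolding img Ix using z0 by (simp add: p_def h_def)
  qed
  have contT: "continuous_on A T" for A using linT by (simp add: linear_continuous_on linear_linear)
  have contf: "continuous_on A f" for A using f lipschitz_on_continuous_on lipschitz_on_subset by blast
  have cont: "continuous_on UNIV (\<lambda>z. f (p z) - h z)"
    unfolding p_def h_def
    by (intro continuous_intros continuous_on_compose2[OF contf[of UNIV]] continuous_on_compose2[OF contT[of UNIV]]) auto
  \<comment> \<open>A boundary point cannot be above the graph, since it would be in the open set
    \<open>D\<close>; nor below, since the region below the graph is open and misses
    \<open>D\<close>.\<close>
  have fr: "h y = f (p y)" if y: "y \<in> frontier D" "y \<in> ball x \<epsilon>" for y
  proof (rule ccontr)
    assume "h y \<noteq> f (p y)"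
    moreover have "\<not> h y > f (p y)" using D[OF y(2)] frontier_not_in_open[OF assms(1) y(1)] by blast
    ultimately have lt: "0 < f (p y) - h y" by simp
    define G where "G = ball x \<epsilon> \<inter> (\<lambda>z. f (p z) - h z) -` {0<..}"
    have "open G" unfolding G_def using cont by (intro open_Int open_vimage) auto
    moreover have "y \<in> G" using lt y(2) by (simp add: G_def)
    moreover have "G \<inter> D = {}" using D by (auto simp: G_def)
    moreover have "y \<in> closure D" using y(1) by (simp add: frontier_def)
    ultimately show False by (metis IntI closure_iff_nhds_not_empty empty_iff inf_commute subset_refl)
  qed
  have L: "0 \<le> L" using f by (rule lipschitz_on_nonneg)
  obtain e where e: "T e = e_vec" using orthogonal_transformation_surj[OF T(1)] by (metis surjD)
  have ne: "norm e = 1" using normT[of e] e by simp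
  \<comment> \<open>The solution of \<open>\<rho> + L * \<rho> = 1\<close>: a displacement below
    \<open>t * \<rho>\<close> lowers the height by less than \<open>t * \<rho>\<close> and raises
    the graph by at most \<open>L * t * \<rho>\<close>, which together use up the gain
    \<open>t\<close>.\<close>
  define \<rho> where "\<rho> = 1 / (1 + L)"
  have \<rho>: "0 < \<rho>" "\<rho> \<le> 1" "\<rho> + L * \<rho> = 1" using L by (auto simp: \<rho>_def field_simps)
  define r where "r = \<epsilon> / 3"
  have r: "0 < r" using \<epsilon> by (simp add: r_def)
  show "\<exists>e \<rho> r. norm e = 1 \<and> 0 < \<rho> \<and> 0 < r \<and>
     (\<forall>y\<in>frontier D \<inter> ball x r. \<forall>t. 0 < t \<and> t < r \<longrightarrow> ball (y + t *\<^sub>R e) (t * \<rho>) \<subseteq> D \<and> y - t *\<^sub>R e \<notin> D)"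
  proof (rule exI[of _ e], rule exI[of _ \<rho>], rule exI[of _ r], intro conjI ne \<rho> r ballI allI impI)
    fix y t assume y: "y \<in> frontier D \<inter> ball x r" and t: "0 < t \<and> t < r"
    have yf: "y \<in> frontier D" "y \<in> ball x \<epsilon>" "norm (y - x) < r"
      using y \<epsilon> by (auto simp: r_def dist_norm norm_minus_commute)
    show "ball (y + t *\<^sub>R e) (t * \<rho>) \<subseteq> D"
    proof
      fix z assume z: "z \<in> ball (y + t *\<^sub>R e) (t * \<rho>)"
      define d where "d = z - (y + t *\<^sub>R e)"
      have nd: "norm d < t * \<rho>" using z by (simp add: d_def dist_norm norm_minus_commute)
      have zx: "z - x = (y - x) + (t *\<^sub>R e + d)" by (simp add: d_def)
      have "norm (z - x) \<le> norm (y - x) + (norm (t *\<^sub>R e) + norm d)"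
        unfolding zx by (meson add_left_mono norm_triangle_ineq order_trans)
      also have "\<dots> < r + (t + t * \<rho>)" using yf(3) nd t ne by simp
      also have "\<dots> \<le> r + (r + r * 1)" using t \<rho> by (intro add_mono mult_mono) auto
      finally have zb: "z \<in> ball x \<epsilon>" by (simp add: r_def dist_norm norm_minus_commute)
      have Tz: "T (z - x) = T (y - x) + t *\<^sub>R e_vec + T d"
        unfolding zx by (simp add: linear_add[OF linT] linear_cmul[OF linT] e)
      have pz: "p z = p y + fst (T d)" and hz: "h z = h y + t + snd (T d)"
        by (simp_all add: p_def h_def Tz e_vec_def)
      have "\<bar>f (p z) - f (p y)\<bar> \<le> L * norm (fst (T d))"
        using lipschitz_onD[OF f, of "p z" "p y"] by (simp add: dist_norm dist_real_def pz)
      also have "\<dots> \<le> L * (t * \<rho>)"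
        using norm_fst_le'[of "T d"] nd normT[of d] L by (intro mult_left_mono) auto
      finally have 1: "f (p z) \<le> f (p y) + t * (L * \<rho>)" by (simp add: mult_ac)
      have "\<bar>snd (T d)\<bar> < t * \<rho>" using norm_snd_le'[of "T d"] nd normT[of d] by simp
      then have "h z > h y + t - t * \<rho>" unfolding hz by linarith
      moreover have "t = t * \<rho> + t * (L * \<rho>)" using \<rho>(3) by (metis distrib_left mult.right_neutral)
      ultimately have "h z > f (p z)" using 1 fr[OF yf(1,2)] by linarith
      then show "z \<in> D" using D[OF zb] by simp
    qed
    define z where "z = y - t *\<^sub>R e"
    have zx: "z - x = (y - x) + (- t) *\<^sub>R e" by (simp add: z_def)
    have "norm (z - x) \<le> norm (y - x) + norm ((- t) *\<^sub>R e)" unfolding zx by (rule norm_triangle_ineq)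
    also have "\<dots> < \<epsilon>" using yf(3) t ne by (simp add: r_def)
    finally have zb: "z \<in> ball x \<epsilon>" by (simp add: dist_norm norm_minus_commute)
    have "T (z - x) = T (y - x) + (- t) *\<^sub>R e_vec"
      unfolding zx by (simp only: linear_add[OF linT] linear_cmul[OF linT] e)
    then have "p z = p y" "h z = h y - t" by (simp_all add: p_def h_def e_vec_def)
    then show "y - t *\<^sub>R e \<notin> D" using D[OF zb] fr[OF yf(1,2)] t by (simp add: z_def)
  qed
qed

text \<open>A ball around an interior point \<open>z0\<close>, moved along with \<open>y\<close> and
  then shrunk towards \<open>y\<close>, stays in \<open>D\<close> by convexity; the shrunk balls
  sweep out the cone. Its axis points from \<open>x\<close> to \<open>z0\<close>.\<close>

lemma convex_imp_cone_boundary: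
  fixes D :: "'m::finite pt set"
  assumes "open D" "convex D" "D \<noteq> {}"
  shows "cone_boundary D"
  unfolding cone_boundary_def
proof
  fix x assume x: "x \<in> frontier D"
  obtain z0 where z0: "z0 \<in> D" using assms(3) by auto
  obtain s where s: "0 < s" "ball z0 s \<subseteq> D" using assms(1) z0 openE by blast
  define l where "l = norm (z0 - x)"
  have l: "0 < l" using frontier_not_in_open[OF assms(1) x] z0 by (auto simp: l_def)
  define e where "e = (z0 - x) /\<^sub>R l"
  \<comment> \<open>Half of the radius \<open>s\<close> pays for the distance from \<open>x\<close>
    to \<open>y\<close>, the other half is the radius of the moved ball. The homothety of ratio
    \<open>t / l\<close> turns \<open>s / 2\<close> into \<open>t * \<rho>\<close>, and
    \<open>r \<le> l\<close> keeps its ratio below 1.\<close>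
  define \<rho> where "\<rho> = s / (2 * l)"
  define r where "r = min (s / 2) l"
  have shrink: "y + t *\<^sub>R (c - y) \<in> D" if "y \<in> closure D" "c \<in> D" "0 < t" "t \<le> 1" for y c t
  proof -
    have "y - t *\<^sub>R (y - c) \<in> interior D"
      using that assms by (intro mem_interior_closure_convex_shrink) (auto simp: interior_open)
    then show ?thesis using assms(1) by (simp add: interior_open algebra_simps)
  qed
  show "\<exists>e \<rho> r. norm e = 1 \<and> 0 < \<rho> \<and> 0 < r \<and>
     (\<forall>y\<in>frontier D \<inter> ball x r. \<forall>t. 0 < t \<and> t < r \<longrightarrow> ball (y + t *\<^sub>R e) (t * \<rho>) \<subseteq> D \<and> y - t *\<^sub>R e \<notin> D)"
  proof (rule exI[of _ e], rule exI[of _ \<rho>], rule exI[of _ r], intro conjI ballI allI impI)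
    show "norm e = 1" using l by (simp add: e_def l_def)
    show "0 < \<rho>" "0 < r" using l s by (auto simp: \<rho>_def r_def)
    fix y t assume y: "y \<in> frontier D \<inter> ball x r" and t: "0 < t \<and> t < r"
    have yc: "y \<in> closure D" "y \<notin> D"
      using y frontier_not_in_open[OF assms(1), of y] by (auto simp: frontier_def)
    show cone: "ball (y + t *\<^sub>R e) (t * \<rho>) \<subseteq> D"
    proof
      fix z assume z: "z \<in> ball (y + t *\<^sub>R e) (t * \<rho>)"
      define d where "d = (l / t) *\<^sub>R (z - (y + t *\<^sub>R e))"
      have "norm d = (l / t) * norm (z - (y + t *\<^sub>R e))" using l t by (simp add: d_def)
      also have "\<dots> < (l / t) * (t * \<rho>)"
        using z l t by (intro mult_strict_left_mono) (auto simp: dist_norm norm_minus_commute)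
      also have "\<dots> = s / 2" using l t by (simp add: \<rho>_def)
      finally have nd: "norm d < s / 2" .
      define c where "c = z0 + (y - x) + d"
      have "norm (c - z0) \<le> norm (y - x) + norm d" unfolding c_def by (simp add: norm_triangle_ineq)
      also have "\<dots> < s" using nd y by (auto simp: r_def dist_norm norm_minus_commute)
      finally have "c \<in> D" using s(2) by (auto simp: dist_norm norm_minus_commute)
      then have "y + (t / l) *\<^sub>R (c - y) \<in> D"
        using t l yc by (intro shrink) (auto simp: r_def field_simps)
      moreover have "c - y = l *\<^sub>R e + d" using l by (simp add: c_def e_def)
      then have "(t / l) *\<^sub>R (c - y) = t *\<^sub>R e + (t / l) *\<^sub>R d" using l by (simp add: scaleR_add_right)
      then have "y + (t / l) *\<^sub>R (c - y) = z" using l t by (simp add: d_def)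
      ultimately show "z \<in> D" by simp
    qed
    show "y - t *\<^sub>R e \<notin> D"
    proof
      assume *: "y - t *\<^sub>R e \<in> D"
      have "y + t *\<^sub>R e \<in> D" using cone t \<open>0 < \<rho>\<close> by auto
      then have "(y + t *\<^sub>R e) + (1/2) *\<^sub>R ((y - t *\<^sub>R e) - (y + t *\<^sub>R e)) \<in> D"
        using * closure_subset by (intro shrink) auto
      moreover have "(y + t *\<^sub>R e) + (1/2) *\<^sub>R ((y - t *\<^sub>R e) - (y + t *\<^sub>R e)) = y"
        by (simp add: algebra_simps flip: scaleR_add_left)
      ultimately show False using yc by metis
    qed
  qed
qed

text \<open>No boundary point lies in the cone at another one nearby. So heights along
  \<open>e\<close> are bounded by horizontal distances: the boundary is locally a Lipschitz graph
  over a bounded set, and finitely many such pieces suffice by compactness.\<close>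

lemma hausdorff_outer_frontier_finite:
  fixes D :: "'m::finite pt set"
  assumes "open D" "bounded D" "cone_boundary D"
  shows "hausdorff_outer CARD('m) (frontier D) < \<infinity>"
proof -
  have local: "\<exists>G. open G \<and> x \<in> G \<and> hausdorff_outer CARD('m) (frontier D \<inter> G) < \<infinity>" if x: "x \<in> frontier D" for x
  proof -
    from bspec[OF assms(3)[unfolded cone_boundary_def] x]
    obtain e \<rho> r where er: "norm e = 1" "0 < \<rho>" "0 < r" and
      cone': "\<forall>y\<in>frontier D \<inter> ball x r. \<forall>t. 0 < t \<and> t < r \<longrightarrow> ball (y + t *\<^sub>R e) (t * \<rho>) \<subseteq> D \<and> y - t *\<^sub>R e \<notin> D"
      by (elim exE conjE) (rule that)
    then have cone: "\<And>y t. y \<in> frontier D \<inter> ball x r \<Longrightarrow> 0 < t \<Longrightarrow> t < r \<Longrightarrow> ball (y + t *\<^sub>R e) (t * \<rho>) \<subseteq> D"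
      by blast
    obtain R :: "'m pt \<Rightarrow> 'm pt" where R: "orthogonal_transformation R" "R e = e_vec" "\<And>z. R (R z) = z"
      using orthogonal_reflection_exists[OF er(1) norm_e_vec] by metis
    have linR: "linear R" using R(1) by (rule orthogonal_transformation_linear)
    have normR: "norm (R z) = norm z" for z using R(1) by (rule orthogonal_transformation_norm)
    let ?F = "frontier D \<inter> ball x (r / 2)"
    have half: "snd (R (y2 - y1)) * \<rho> \<le> norm (fst (R (y2 - y1)))"
      if y: "y1 \<in> ?F" "y2 \<in> ?F" for y1 y2
    proof (cases "0 < snd (R (y2 - y1))")
      case True
      define t where "t = snd (R (y2 - y1))"
      have "t \<le> norm (y2 - y1)" using norm_snd_le'[of "R (y2 - y1)"] by (simp add: t_def normR)
      also have "\<dots> < r" using y dist_triangle3[of y2 y1 x] by (simp add: dist_norm)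
      finally have t: "0 < t" "t < r" using True by (auto simp: t_def)
      have "y2 \<notin> ball (y1 + t *\<^sub>R e) (t * \<rho>)"
        using cone[of y1 t] t y er frontier_not_in_open[OF assms(1), of y2] by auto
      moreover have "dist (y1 + t *\<^sub>R e) y2 = norm (y2 - y1 - t *\<^sub>R e)"
        by (metis dist_commute dist_norm diff_diff_eq)
      ultimately have "t * \<rho> \<le> norm (y2 - y1 - t *\<^sub>R e)" by simp
      also have "\<dots> = norm (R (y2 - y1) - t *\<^sub>R e_vec)"
        by (metis R(2) linear_cmul[OF linR] linear_diff[OF linR] normR)
      also have "R (y2 - y1) - t *\<^sub>R e_vec = (fst (R (y2 - y1)), 0)"
        by (simp add: t_def e_vec_def prod_eq_iff)
      finally show ?thesis by (simp add: t_def norm_Pair)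
    next
      case False
      then have "snd (R (y2 - y1)) * \<rho> \<le> 0" using er(2) by (simp add: mult_le_0_iff)
      then show ?thesis by (meson norm_ge_zero order_trans)
    qed
    define C where "C = 1 / \<rho> + 1"
    have C: "0 < C" using er by (simp add: C_def add_pos_nonneg)
    have key: "dist y1 y2 \<le> C * dist (fst (R y1)) (fst (R y2))" if y: "y1 \<in> ?F" "y2 \<in> ?F" for y1 y2
    proof -
      define z where "z = R (y2 - y1)"
      have "R (y1 - y2) = - z" by (metis z_def linear_neg[OF linR] minus_diff_eq)
      then have "\<bar>snd z\<bar> * \<rho> \<le> norm (fst z)"
        using half[OF y] half[OF y(2,1)] er(2) by (cases "0 \<le> snd z") (auto simp: z_def)
      then have "\<bar>snd z\<bar> \<le> norm (fst z) / \<rho>" using er by (simp add: field_simps)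
      have "dist y1 y2 = norm z" by (simp add: z_def normR dist_norm norm_minus_commute)
      also have "\<dots> \<le> norm (fst z) + \<bar>snd z\<bar>" using norm_Pair_le[of "fst z" "snd z"] by simp
      also have "\<dots> \<le> C * norm (fst z)"
        using \<open>\<bar>snd z\<bar> \<le> norm (fst z) / \<rho>\<close> by (simp add: C_def algebra_simps)
      also have "norm (fst z) = dist (fst (R y1)) (fst (R y2))"
        by (simp add: z_def linear_diff[OF linR] dist_norm norm_minus_commute)
      finally show ?thesis .
    qed
    have "hausdorff_outer CARD('m) (id ` ?F) \<le> ennreal (C ^ CARD('m)) * hausdorff_outer CARD('m) ((\<lambda>y. fst (R y)) ` ?F)"
      using key by (intro hausdorff_outer_image_le C) auto
    also have "\<dots> < \<infinity>"
    proof -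
      have "bounded (R ` ?F)" using R(1) by (intro bounded_linear_image) (auto simp: linear_linear linR)
      then have "bounded (fst ` R ` ?F)" by (rule bounded_fst)
      then show ?thesis
        using hausdorff_outer_bounded_finite[of "fst ` R ` ?F"] by (simp add: image_image ennreal_mult_less_top)
    qed
    finally show ?thesis using er(3) by (intro exI[of _ "ball x (r / 2)"]) auto
  qed
  have "compact (frontier D)" using assms(2) by (rule compact_frontier_bounded)
  moreover have "frontier D \<subseteq> \<Union>{G. open G \<and> hausdorff_outer CARD('m) (frontier D \<inter> G) < \<infinity>}"
    using local by blast
  ultimately obtain F where F: "F \<subseteq> {G. open G \<and> hausdorff_outer CARD('m) (frontier D \<inter> G) < \<infinity>}"
      "finite F" "frontier D \<subseteq> \<Union>F"
    by (rule compactE) auto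
  from F(2,1) have "hausdorff_outer CARD('m) (\<Union>G\<in>F. frontier D \<inter> G) < \<infinity>"
  proof (induction F)
    case (insert G F)
    then show ?case
      using hausdorff_outer_Un_le[of "CARD('m)" "frontier D \<inter> G" "\<Union>G\<in>F. frontier D \<inter> G"]
      by (auto intro: le_less_trans)
  qed simp
  moreover have "frontier D = (\<Union>G\<in>F. frontier D \<inter> G)" using F(3) by auto
  ultimately show ?thesis by simp
qed

section \<open>Normal vectors\<close>

text \<open>The map \<open>\<Psi>\<close> is injective between spaces of equal dimension, hence
  onto; the coefficient of \<open>n\<close> is then read off by an inner product.\<close>

lemma hyperplane_decomposition:
  fixes L :: "real ^ 'm::finite \<Rightarrow> 'm pt"
  assumes L: "linear L" "inj L" and n: "norm n = 1" "\<And>v. n \<bullet> L v = 0"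
  shows "\<exists>v. z = L v + (n \<bullet> z) *\<^sub>R n"
proof -
  define \<Psi> where "\<Psi> b = L (fst b) + snd b *\<^sub>R n" for b :: "'m pt"
  have nn: "n \<bullet> n = 1" using n(1) by (simp add: norm_eq_1)
  have lin: "linear \<Psi>"
    by (rule linearI) (simp_all add: \<Psi>_def linear_add[OF L(1)] linear_cmul[OF L(1)] algebra_simps)
  have inner: "n \<bullet> \<Psi> b = snd b" for b by (simp add: \<Psi>_def inner_add_right n(2) nn)
  have "inj \<Psi>"
  proof (subst linear_injective_0[OF lin], intro allI impI)
    fix b assume b: "\<Psi> b = 0"
    then have "snd b = 0" using inner[of b] by simp
    moreover from this b have "L (fst b) = 0" by (simp add: \<Psi>_def)
    then have "fst b = 0" using L by (simp add: linear_injective_0)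
    ultimately show "b = 0" by (simp add: prod_eq_iff)
  qed
  then have "surj \<Psi>" using lin by (simp add: linear_injective_imp_surjective)
  then obtain b where "z = \<Psi> b" by (metis surjD)
  then show ?thesis using inner[of b] by (auto simp: \<Psi>_def)
qed

section \<open>Tangent planes and their independence of the chart\<close>

lemma C1_parametrizationD:
  assumes "C1_parametrization S U \<phi> \<phi>'"
  shows "open U" "openin (top_of_set S) (\<phi> ` U)" "\<And>u. u \<in> U \<Longrightarrow> (\<phi> has_derivative blinfun_apply (\<phi>' u)) (at u)"
    "continuous_on U \<phi>'" "\<And>u. u \<in> U \<Longrightarrow> inj (blinfun_apply (\<phi>' u))" "\<And>u. linear (blinfun_apply (\<phi>' u))"
    "\<And>u. u \<in> U \<Longrightarrow> \<phi> u \<in> S"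
proof -
  have "\<phi> ` U \<subseteq> S" using assms openin_imp_subset unfolding C1_parametrization_def by blast
  then show "\<And>u. u \<in> U \<Longrightarrow> \<phi> u \<in> S" by blast
qed (use assms in \<open>auto simp: C1_parametrization_def blinfun.bounded_linear_right bounded_linear.linear\<close>)

lemma C1_parametrization_ball:
  assumes P: "C1_parametrization S U \<phi> \<phi>'" and p: "p \<in> U" "0 < r" "ball p r \<subseteq> U"
  obtains d where "0 < d" "\<And>y. y \<in> S \<Longrightarrow> dist y (\<phi> p) < d \<Longrightarrow> \<exists>u \<in> ball p r. y = \<phi> u"
proof -
  note \<phi> = C1_parametrizationD[OF P]
  obtain \<psi> where \<psi>: "homeomorphism U (\<phi> ` U) \<phi> \<psi>" using P by (auto simp: C1_parametrization_def)
  have "openin (top_of_set (\<phi> ` U)) (\<phi> ` ball p r)"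
    using \<psi> p(3) by (intro homeomorphism_imp_open_map) (auto simp: open_subset)
  then have "openin (top_of_set S) (\<phi> ` ball p r)" using \<phi>(2) by (rule openin_trans)
  then obtain G where G: "open G" "\<phi> ` ball p r = S \<inter> G" by (auto simp: openin_open)
  have "\<phi> p \<in> G" using G(2) p(2) by auto
  then obtain d where d: "0 < d" "ball (\<phi> p) d \<subseteq> G" using G(1) openE by blast
  show ?thesis
  proof (rule that[OF d(1)])
    fix y assume "y \<in> S" "dist y (\<phi> p) < d"
    then have "y \<in> S \<inter> G" using d(2) by (auto simp: dist_commute)
    then show "\<exists>u \<in> ball p r. y = \<phi> u" using G(2) by blast
  qed
qed

text \<open>Every point of \<open>S\<close> near \<open>\<phi> p\<close> has a parameter near
  \<open>p\<close>, and the parameter distance is at most a multiple of the distance on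
  \<open>S\<close> since \<open>\<phi>' p\<close> is bounded below. So the linearisation error
  bounds the deviation from the tangent plane.\<close>

lemma tangent_estimate:
  assumes P: "C1_parametrization S U \<phi> \<phi>'" and p: "p \<in> U" and n: "norm n = 1" "\<And>v. n \<bullet> \<phi>' p v = 0" and \<epsilon>: "0 < \<epsilon>"
  obtains d where "0 < d" "\<And>y. y \<in> S \<Longrightarrow> dist y (\<phi> p) < d \<Longrightarrow> \<bar>n \<bullet> (y - \<phi> p)\<bar> \<le> \<epsilon> * norm (y - \<phi> p)"
proof -
  note \<phi> = C1_parametrizationD[OF P]
  obtain m where m: "m > 0" "\<And>v. m * norm v \<le> norm (\<phi>' p v)"
    using linear_inj_bounded_below_pos[OF \<phi>(6) \<phi>(5)[OF p]] by blast
  \<comment> \<open>The bound \<open>m / 2\<close> leaves half of the lower bound of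
    \<open>\<phi>' p\<close> after the error is subtracted; the bound
    \<open>\<epsilon> * m / 2\<close> then gives exactly the constant \<epsilon>.\<close>
  define \<eta> where "\<eta> = min (m / 2) (\<epsilon> * m / 2)"
  have \<eta>: "0 < \<eta>" "\<eta> \<le> m / 2" "\<eta> \<le> \<epsilon> * m / 2" using m \<epsilon> by (auto simp: \<eta>_def)
  obtain r where r: "0 < r" "ball p r \<subseteq> U"
    "\<And>a b. a \<in> ball p r \<Longrightarrow> b \<in> ball p r \<Longrightarrow> norm (\<phi> a - \<phi> b - \<phi>' p (a - b)) \<le> \<eta> * norm (a - b)"
    using C1_strict_derivative[OF \<phi>(1) p \<phi>(3,4) \<eta>(1)] by blast
  obtain d where d: "0 < d" "\<And>y. y \<in> S \<Longrightarrow> dist y (\<phi> p) < d \<Longrightarrow> \<exists>u \<in> ball p r. y = \<phi> u"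
    using C1_parametrization_ball[OF P p r(1,2)] by blast
  show ?thesis
  proof (rule that[OF d(1)])
    fix y assume "y \<in> S" "dist y (\<phi> p) < d"
    then obtain u where u: "u \<in> ball p r" "y = \<phi> u" using d(2) by blast
    define x where "x = \<phi> u - \<phi> p - \<phi>' p (u - p)"
    have x: "norm x \<le> \<eta> * norm (u - p)" using r(3)[OF u(1), of p] r(1) by (simp add: x_def)
    have yx: "y - \<phi> p = x + \<phi>' p (u - p)" by (simp add: x_def u(2))
    have "\<bar>n \<bullet> (y - \<phi> p)\<bar> = \<bar>n \<bullet> x\<bar>" by (simp add: yx inner_add_right n(2))
    also have "\<dots> \<le> norm x" using Cauchy_Schwarz_ineq2[of n x] n(1) by simp
    also note x
    finally have 1: "\<bar>n \<bullet> (y - \<phi> p)\<bar> \<le> \<eta> * norm (u - p)" .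
    have "norm (\<phi>' p (u - p)) \<le> norm (y - \<phi> p) + norm x"
      using norm_triangle_ineq4[of "y - \<phi> p" x] by (simp add: yx)
    then have "m * norm (u - p) \<le> norm (y - \<phi> p) + (m / 2) * norm (u - p)"
      using m(2)[of "u - p"] x mult_right_mono[OF \<eta>(2) norm_ge_zero[of "u - p"]] by linarith
    then have 2: "(m / 2) * norm (u - p) \<le> norm (y - \<phi> p)" by (simp add: algebra_simps)
    have "\<eta> * norm (u - p) \<le> (\<epsilon> * m / 2) * norm (u - p)" using \<eta>(3) by (intro mult_right_mono) auto
    also have "\<dots> = \<epsilon> * ((m / 2) * norm (u - p))" by simp
    also have "\<dots> \<le> \<epsilon> * norm (y - \<phi> p)" using 2 \<epsilon> by (intro mult_left_mono) auto
    finally show "\<bar>n \<bullet> (y - \<phi> p)\<bar> \<le> \<epsilon> * norm (y - \<phi> p)" using 1 by linarith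
  qed
qed

lemma nonpos_if_le_small_multiples:
  fixes a c :: real
  assumes "\<And>\<epsilon>. 0 < \<epsilon> \<Longrightarrow> \<epsilon> \<le> 1 \<Longrightarrow> a \<le> \<epsilon> * c"
  shows "a \<le> 0"
proof (rule ccontr)
  assume "\<not> a \<le> 0"
  then have a: "0 < a" by simp
  define \<epsilon> where "\<epsilon> = min 1 (a / (2 * (\<bar>c\<bar> + 1)))"
  have "0 < \<epsilon>" "\<epsilon> \<le> 1" using a by (auto simp: \<epsilon>_def)
  then have "a \<le> \<epsilon> * c" by (rule assms)
  also have "\<dots> \<le> \<epsilon> * (\<bar>c\<bar> + 1)" using \<open>0 < \<epsilon>\<close> by (intro mult_left_mono) auto
  also have "\<dots> \<le> a / (2 * (\<bar>c\<bar> + 1)) * (\<bar>c\<bar> + 1)" by (intro mult_right_mono) (auto simp: \<epsilon>_def)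
  also have "\<dots> = a / 2"  by (simp add: field_simps)
  finally show False using a by simp
qed

text \<open>\<open>orthogonal_to_tangent_space\<close> speaks of one chart only. The tangent
  estimate of that chart is a statement about \<open>S\<close> alone; applied to the points
  \<open>\<phi> (p + t *\<^sub>R v)\<close> of another chart it bounds
  \<open>n \<bullet> \<phi>' p v\<close> by small multiples of a fixed number.\<close>

lemma orthogonal_to_tangent_space_all:
  assumes n: "norm n = 1" "orthogonal_to_tangent_space S x n"
    and P: "C1_parametrization S U \<phi> \<phi>'" "p \<in> U" "\<phi> p = x"
  shows "n \<bullet> \<phi>' p v = 0"
proof -
  note \<phi> = C1_parametrizationD[OF P(1)]
  obtain V \<xi> \<xi>' q where Q: "C1_parametrization S V \<xi> \<xi>'" "q \<in> V" "\<xi> q = x" "\<And>v. n \<bullet> \<xi>' q v = 0"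
    using n(2) unfolding orthogonal_to_tangent_space_def by blast
  have "\<bar>n \<bullet> \<phi>' p v\<bar> \<le> \<epsilon> * (norm (\<phi>' p v) + 2 * norm v)" if \<epsilon>: "0 < \<epsilon>" "\<epsilon> \<le> 1" for \<epsilon>
  proof -
    obtain d where d: "0 < d" "\<And>y. y \<in> S \<Longrightarrow> dist y x < d \<Longrightarrow> \<bar>n \<bullet> (y - x)\<bar> \<le> \<epsilon> * norm (y - x)"
      using tangent_estimate[OF Q(1,2) n(1) Q(4) \<epsilon>(1)] Q(3) by metis
    obtain r where r: "0 < r" "ball p r \<subseteq> U"
      "\<And>a b. a \<in> ball p r \<Longrightarrow> b \<in> ball p r \<Longrightarrow> norm (\<phi> a - \<phi> b - \<phi>' p (a - b)) \<le> \<epsilon> * norm (a - b)"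
      using C1_strict_derivative[OF \<phi>(1) P(2) \<phi>(3,4) \<epsilon>(1)] by blast
    \<comment> \<open>With \<open>t = min r d / K\<close>, the parameter
      \<open>p + t *\<^sub>R v\<close> stays in the ball of radius \<open>r\<close> and its image
      stays within \<open>d\<close> of \<open>x\<close>.\<close>
    define K where "K = norm (\<phi>' p v) + norm v + 1"
    have K: "0 < K" "norm v < K" "norm (\<phi>' p v) + norm v < K" by (auto simp: K_def add_nonneg_pos)
    define t where "t = min r d / K"
    have t: "0 < t" "t * K \<le> r" "t * K \<le> d" using r d K by (auto simp: t_def)
    have "t * norm v < t * K" using t K by (intro mult_strict_left_mono) auto
    moreover have "norm (t *\<^sub>R v) = t * norm v" using t by simp
    ultimately have "norm (t *\<^sub>R v) < r" using t by linarith
    then have u: "p + t *\<^sub>R v \<in> ball p r" by (simp add: dist_norm)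
    define y where "y = \<phi> (p + t *\<^sub>R v)"
    define e where "e = y - x - t *\<^sub>R \<phi>' p v"
    have e: "norm e \<le> \<epsilon> * (t * norm v)"
      using r(3)[OF u, of p] r(1) P(3) t(1) by (simp add: e_def y_def blinfun.scaleR_right)
    have "\<epsilon> * (t * norm v) \<le> 1 * (t * norm v)" using \<epsilon> t by (intro mult_right_mono) auto
    then have e1: "norm e \<le> t * norm v" using e by simp
    have yx: "y - x = t *\<^sub>R \<phi>' p v + e" by (simp add: e_def)
    have nyx: "norm (y - x) \<le> t * norm (\<phi>' p v) + norm e"
      unfolding yx using norm_triangle_ineq[of "t *\<^sub>R \<phi>' p v" e] t by simp
    also have "\<dots> \<le> t * (norm (\<phi>' p v) + norm v)" using e1 by (simp add: algebra_simps)
    also have "\<dots> < t * K" using t K by (intro mult_strict_left_mono) auto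
    finally have "dist y x < d" using t by (simp add: dist_norm)
    moreover have "y \<in> S" using \<phi>(7) u r(2) by (auto simp: y_def)
    ultimately have 1: "\<bar>n \<bullet> (y - x)\<bar> \<le> \<epsilon> * norm (y - x)" using d(2) by blast
    have "t * \<bar>n \<bullet> \<phi>' p v\<bar> = \<bar>n \<bullet> (y - x) - n \<bullet> e\<bar>"
      using t by (simp add: yx inner_add_right abs_mult)
    also have "\<dots> \<le> \<bar>n \<bullet> (y - x)\<bar> + norm e"
      using Cauchy_Schwarz_ineq2[of n e] n(1) by simp
    also have "\<dots> \<le> \<epsilon> * (t * norm (\<phi>' p v) + t * norm v) + \<epsilon> * (t * norm v)"
      using 1 nyx e e1 \<epsilon> mult_left_mono[of "norm (y - x)" "t * norm (\<phi>' p v) + t * norm v" \<epsilon>] by linarith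
    also have "\<dots> = t * (\<epsilon> * (norm (\<phi>' p v) + 2 * norm v))" by (simp add: algebra_simps)
    finally show ?thesis using t by simp
  qed
  then have "\<bar>n \<bullet> \<phi>' p v\<bar> \<le> 0" by (rule nonpos_if_le_small_multiples)
  then show ?thesis by simp
qed

lemma unit_normal_exists:
  fixes S :: "'m::finite pt set"
  assumes "has_local_C1_parametrization S x"
  obtains n where "norm n = 1" "orthogonal_to_tangent_space S x n"
proof -
  obtain U \<phi> \<phi>' p where P: "C1_parametrization S U \<phi> \<phi>'" "p \<in> U" "\<phi> p = x"
    using assms by (auto simp: has_local_C1_parametrization_def)
  note \<phi> = C1_parametrizationD[OF P(1)]
  have "dim (range (\<phi>' p)) \<le> dim (UNIV :: (real ^ 'm) set)"
    using dim_image_le[OF \<phi>(6), of p UNIV] .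
  then have "dim (range (\<phi>' p)) < DIM('m pt)" by (simp add: dim_UNIV)
  then obtain z where z: "z \<noteq> 0" "\<And>y. y \<in> span (range (\<phi>' p)) \<Longrightarrow> orthogonal z y"
    using orthogonal_to_subspace_exists by blast
  have "(z /\<^sub>R norm z) \<bullet> \<phi>' p v = 0" for v
    using z(2)[of "\<phi>' p v"] by (simp add: orthogonal_def span_base)
  then show ?thesis
    using z(1) P by (intro that[of "z /\<^sub>R norm z"]) (auto simp: orthogonal_to_tangent_space_def)
qed

lemma unit_normal_unique:
  assumes n: "norm n = 1" "orthogonal_to_tangent_space S x n"
    and k: "norm k = 1" "orthogonal_to_tangent_space S x k"
  shows "k = n \<or> k = - n"
proof -
  obtain U \<phi> \<phi>' p where P: "C1_parametrization S U \<phi> \<phi>'" "p \<in> U" "\<phi> p = x" "\<And>v. n \<bullet> \<phi>' p v = 0"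
    using n(2) unfolding orthogonal_to_tangent_space_def by blast
  note \<phi> = C1_parametrizationD[OF P(1)]
  obtain v where v: "k = \<phi>' p v + (n \<bullet> k) *\<^sub>R n"
    using hyperplane_decomposition[OF \<phi>(6) \<phi>(5)[OF P(2)] n(1) P(4)] by blast
  have "\<phi>' p v \<bullet> \<phi>' p v = (k - (n \<bullet> k) *\<^sub>R n) \<bullet> \<phi>' p v" by (subst v) simp
  also have "\<dots> = 0"
    using orthogonal_to_tangent_space_all[OF k P(1-3)] P(4) by (simp add: inner_diff_left)
  finally have k_eq: "k = (n \<bullet> k) *\<^sub>R n" using v by simp
  then have "\<bar>n \<bullet> k\<bar> = 1" using n(1) k(1) by (metis mult.right_neutral norm_scaleR)
  then show ?thesis using k_eq by (smt (verit) scaleR_minus1_left scaleR_one)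
qed

text \<open>A small segment from a good direction to \<open>w\<close> stays off the boundary, by the tangent estimate.\<close>

lemma sides_of_tangent_plane:
  fixes D :: "'m::finite pt set"
  assumes D: "open D" "cone_boundary D" and x: "x \<in> frontier D" "has_local_C1_parametrization (frontier D) x"
  obtains n where "norm n = 1" "orthogonal_to_tangent_space (frontier D) x n"
    "\<And>w. n \<bullet> w > 0 \<Longrightarrow> \<exists>\<delta>>0. \<forall>t. 0 < t \<and> t < \<delta> \<longrightarrow> x + t *\<^sub>R w \<in> D"
    "\<And>w. n \<bullet> w < 0 \<Longrightarrow> \<exists>\<delta>>0. \<forall>t. 0 < t \<and> t < \<delta> \<longrightarrow> x + t *\<^sub>R w \<notin> D"
proof -
  obtain k where k: "norm k = 1" "orthogonal_to_tangent_space (frontier D) x k"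
    using unit_normal_exists[OF x(2)] by blast
  obtain U \<phi> \<phi>' p where P: "C1_parametrization (frontier D) U \<phi> \<phi>'" "p \<in> U" "\<phi> p = x" "\<And>v. k \<bullet> \<phi>' p v = 0"
    using k(2) unfolding orthogonal_to_tangent_space_def by blast
  note \<phi> = C1_parametrizationD[OF P(1)]
  obtain e \<rho> r where er: "norm e = 1" "0 < \<rho>" "0 < r" and
    cone: "\<And>t. 0 < t \<Longrightarrow> t < r \<Longrightarrow> ball (x + t *\<^sub>R e) (t * \<rho>) \<subseteq> D" "\<And>t. 0 < t \<Longrightarrow> t < r \<Longrightarrow> x - t *\<^sub>R e \<notin> D"
    using D(2) x(1) unfolding cone_boundary_def by (metis IntI centre_in_ball)
  have inD: "x + t *\<^sub>R e \<in> D" if "0 < t" "t < r" for t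
    using cone(1)[OF that] er that by auto
  \<comment> \<open>If the axis \<open>e\<close> were tangential, a curve in the boundary with
    velocity \<open>e\<close> would run into the cone around \<open>e\<close>, which lies in
    \<open>D\<close>.\<close>
  have "k \<bullet> e \<noteq> 0"
  proof
    assume "k \<bullet> e = 0"
    then obtain v where v: "e = \<phi>' p v"
      using hyperplane_decomposition[OF \<phi>(6) \<phi>(5)[OF P(2)] k(1) P(4), of e] by auto
    define \<eta> where "\<eta> = \<rho> / (norm v + 1)"
    have \<eta>: "0 < \<eta>" "\<eta> * norm v < \<rho>"
    proof -
      have "0 < norm v + 1" by (simp add: add_nonneg_pos)
      then show "0 < \<eta>" "\<eta> * norm v < \<rho>" using er(2) by (simp_all add: \<eta>_def field_simps)
    qed
    obtain s where s: "0 < s" "ball p s \<subseteq> U"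
      "\<And>a b. a \<in> ball p s \<Longrightarrow> b \<in> ball p s \<Longrightarrow> norm (\<phi> a - \<phi> b - \<phi>' p (a - b)) \<le> \<eta> * norm (a - b)"
      using C1_strict_derivative[OF \<phi>(1) P(2) \<phi>(3,4) \<eta>(1)] by blast
    define t where "t = min (r / 2) ((s / 2) / (norm v + 1))"
    have t: "0 < t" "t < r" "t * norm v < s"
    proof -
      show "0 < t" using er s by (auto simp: t_def add_nonneg_pos)
      show "t < r" using er by (auto simp: t_def)
      have pos: "0 < norm v + 1" by (simp add: add_nonneg_pos)
      have "t * norm v \<le> t * (norm v + 1)" using \<open>0 < t\<close> by (intro mult_left_mono) auto
      also have "\<dots> \<le> s / 2"
      proof -
        have "t \<le> (s / 2) / (norm v + 1)" unfolding t_def by (rule min.cobounded2)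
        then show ?thesis using pos by (simp only: pos_le_divide_eq)
      qed
      also have "\<dots> < s" using s(1) by simp
      finally show "t * norm v < s" .
    qed
    have u: "p + t *\<^sub>R v \<in> ball p s" using t by (simp add: dist_norm)
    define y where "y = \<phi> (p + t *\<^sub>R v)"
    have "norm (y - (x + t *\<^sub>R e)) \<le> \<eta> * (t * norm v)"
      using s(3)[OF u, of p] s(1) P(3) t(1) v by (simp add: y_def blinfun.scaleR_right algebra_simps)
    also have "\<dots> = t * (\<eta> * norm v)" by simp
    also have "\<dots> < t * \<rho>" using \<eta> t by (intro mult_strict_left_mono) auto
    finally have "y \<in> D" using cone(1)[OF t(1,2)] by (auto simp: dist_norm norm_minus_commute)
    moreover have "y \<in> frontier D" using \<phi>(7) u s(2) by (auto simp: y_def)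
    ultimately show False using frontier_not_in_open[OF D(1)] by blast
  qed
  define n where "n = (if k \<bullet> e > 0 then k else - k)"
  have n: "norm n = 1" "n \<bullet> e > 0" using k(1) \<open>k \<bullet> e \<noteq> 0\<close> by (auto simp: n_def)
  have n_perp: "n \<bullet> \<phi>' p v = 0" for v using P(4) by (simp add: n_def)
  have n_orth: "orthogonal_to_tangent_space (frontier D) x n"
    unfolding orthogonal_to_tangent_space_def using P n_perp by blast
  \<comment> \<open>The sign \<sigma> treats both sides of the tangent plane at once. On the segment
    the normal component is at least \<open>t * c\<close>, whereas a boundary point would have at
    most \<open>\<epsilon> * t * K\<close>, which is half of that. So the segment misses the
    boundary, and its end points are both in \<open>D\<close> or both outside.\<close>
  have segment: "\<exists>\<delta>>0. \<forall>t. 0 < t \<and> t < \<delta> \<longrightarrow> (x + t *\<^sub>R a \<in> D \<longleftrightarrow> x + t *\<^sub>R b \<in> D)"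
    if pos: "n \<bullet> a * \<sigma> > 0" "n \<bullet> b * \<sigma> > 0" and \<sigma>: "\<bar>\<sigma>\<bar> = 1" for a b and \<sigma> :: real
  proof -
    define c where "c = min (n \<bullet> a * \<sigma>) (n \<bullet> b * \<sigma>)"
    define K where "K = norm a + norm b + 1"
    have c: "0 < c" "c \<le> n \<bullet> a * \<sigma>" "c \<le> n \<bullet> b * \<sigma>" and K: "0 < K" "norm a \<le> K" "norm b \<le> K"
      using pos by (auto simp: c_def K_def add_nonneg_pos)
    define \<epsilon> where "\<epsilon> = c / (2 * K)"
    have \<epsilon>: "0 < \<epsilon>" "\<epsilon> * K = c / 2" using c K by (auto simp: \<epsilon>_def)
    obtain d where d: "0 < d" "\<And>y. y \<in> frontier D \<Longrightarrow> dist y x < d \<Longrightarrow> \<bar>n \<bullet> (y - x)\<bar> \<le> \<epsilon> * norm (y - x)"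
      using tangent_estimate[OF P(1,2) n(1) n_perp \<epsilon>(1)] P(3) by metis
    show ?thesis
    proof (intro exI[of _ "d / K"] conjI allI impI)
      show "0 < d / K" using d K by simp
      fix t assume "0 < t \<and> t < d / K"
      then have t: "0 < t" "t * K < d" using K by (auto simp: field_simps)
      define J where "J = closed_segment (x + t *\<^sub>R a) (x + t *\<^sub>R b)"
      have "J \<inter> frontier D = {}"
      proof (rule ccontr)
        assume "J \<inter> frontier D \<noteq> {}"
        then obtain y where y: "y \<in> frontier D" "y \<in> J" by auto
        then obtain s where s: "0 \<le> s" "s \<le> 1" "y = (1 - s) *\<^sub>R (x + t *\<^sub>R a) + s *\<^sub>R (x + t *\<^sub>R b)"
          by (auto simp: J_def in_segment)
        define w where "w = (1 - s) *\<^sub>R a + s *\<^sub>R b"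
        have yw: "y - x = t *\<^sub>R w" unfolding w_def s(3) by (simp add: algebra_simps)
        have "norm w \<le> (1 - s) * norm a + s * norm b"
          unfolding w_def using norm_triangle_ineq[of "(1 - s) *\<^sub>R a" "s *\<^sub>R b"] s by simp
        also have "\<dots> \<le> (1 - s) * K + s * K" using s K by (intro add_mono mult_left_mono) auto
        finally have wK: "norm w \<le> K" by (simp add: algebra_simps)
        have "(1 - s) * c + s * c \<le> (1 - s) * (n \<bullet> a * \<sigma>) + s * (n \<bullet> b * \<sigma>)"
          using s c by (intro add_mono mult_left_mono) auto
        then have "c \<le> n \<bullet> w * \<sigma>" by (simp add: w_def inner_add_right algebra_simps)
        also have "\<dots> \<le> \<bar>n \<bullet> w\<bar>" using \<sigma> by (metis abs_ge_self abs_mult mult.right_neutral)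
        finally have cw: "c \<le> \<bar>n \<bullet> w\<bar>" .
        have "norm (y - x) \<le> t * K" using yw wK t by simp
        then have "dist y x < d" using t by (simp add: dist_norm)
        then have "\<bar>n \<bullet> (y - x)\<bar> \<le> \<epsilon> * norm (y - x)" using d(2) y(1) by blast
        also have "\<dots> \<le> \<epsilon> * (t * K)" using \<open>norm (y - x) \<le> t * K\<close> \<epsilon> by (intro mult_left_mono) auto
        also have "\<dots> = t * (c / 2)" using \<epsilon>(2) by (simp add: mult_ac)
        finally have "t * \<bar>n \<bullet> w\<bar> \<le> t * (c / 2)" using t by (simp add: yw abs_mult)
        then show False using cw c t by simp
      qed
      moreover have "connected J" by (simp add: J_def)
      ultimately have "J \<inter> D = {} \<or> J \<subseteq> D" using connected_Int_frontier[of J D] by blast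
      moreover have "x + t *\<^sub>R a \<in> J" "x + t *\<^sub>R b \<in> J" by (auto simp: J_def)
      ultimately show "x + t *\<^sub>R a \<in> D \<longleftrightarrow> x + t *\<^sub>R b \<in> D" by blast
    qed
  qed
  show ?thesis
  proof (rule that[OF n(1) n_orth])
    fix w
    { assume "n \<bullet> w > 0"
      then obtain \<delta> where \<delta>: "\<delta> > 0" "\<forall>t. 0 < t \<and> t < \<delta> \<longrightarrow> (x + t *\<^sub>R e \<in> D \<longleftrightarrow> x + t *\<^sub>R w \<in> D)"
        using segment[of e 1 w] n(2) by auto
      then show "\<exists>\<delta>>0. \<forall>t. 0 < t \<and> t < \<delta> \<longrightarrow> x + t *\<^sub>R w \<in> D"
        using inD er(3) by (intro exI[of _ "min \<delta> r"]) auto }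
    { assume "n \<bullet> w < 0"
      then obtain \<delta> where \<delta>: "\<delta> > 0" "\<forall>t. 0 < t \<and> t < \<delta> \<longrightarrow> (x + t *\<^sub>R (- e) \<in> D \<longleftrightarrow> x + t *\<^sub>R w \<in> D)"
        using segment[of "- e" "-1" w] n(2) by auto
      then show "\<exists>\<delta>>0. \<forall>t. 0 < t \<and> t < \<delta> \<longrightarrow> x + t *\<^sub>R w \<notin> D"
        using cone(2) er(3) by (intro exI[of _ "min \<delta> r"]) auto }
  qed
qed

text \<open>The description in \<open>inner_normal\<close> is well defined: a unit normal is unique
  up to sign, and \<open>- n\<close> leads out of \<open>D\<close>.\<close>

lemma inner_normal:
  fixes D :: "'m::finite pt set"
  assumes D: "open D" "cone_boundary D" and x: "x \<in> frontier D" "has_local_C1_parametrization (frontier D) x"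
  shows "norm (inner_normal D x) = 1"
    and "orthogonal_to_tangent_space (frontier D) x (inner_normal D x)"
    and "inner_normal D x \<bullet> w > 0 \<Longrightarrow> \<exists>\<delta>>0. \<forall>t. 0 < t \<and> t < \<delta> \<longrightarrow> x + t *\<^sub>R w \<in> D"
    and "inner_normal D x \<bullet> w < 0 \<Longrightarrow> \<exists>\<delta>>0. \<forall>t. 0 < t \<and> t < \<delta> \<longrightarrow> x + t *\<^sub>R w \<notin> D"
proof -
  obtain n where n: "norm n = 1" "orthogonal_to_tangent_space (frontier D) x n"
    "\<And>w. n \<bullet> w > 0 \<Longrightarrow> \<exists>\<delta>>0. \<forall>t. 0 < t \<and> t < \<delta> \<longrightarrow> x + t *\<^sub>R w \<in> D"
    "\<And>w. n \<bullet> w < 0 \<Longrightarrow> \<exists>\<delta>>0. \<forall>t. 0 < t \<and> t < \<delta> \<longrightarrow> x + t *\<^sub>R w \<notin> D"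
    using sides_of_tangent_plane[OF D x] by blast
  have nn: "n \<bullet> n = 1" using n(1) by (simp add: norm_eq_1)
  have "inner_normal D x = n"
    unfolding inner_normal_def
  proof (rule the_equality)
    show "is_inner_normal D x n" using n(1,2) n(3)[of n] nn by (auto simp: is_inner_normal_def)
    fix k assume k: "is_inner_normal D x k"
    then have "k = n \<or> k = - n" using unit_normal_unique[OF n(1,2)] by (auto simp: is_inner_normal_def)
    moreover have "k \<noteq> - n"
    proof
      assume "k = - n"
      then obtain \<delta> where \<delta>: "\<delta> > 0" "\<And>t. 0 < t \<Longrightarrow> t < \<delta> \<Longrightarrow> x + t *\<^sub>R (- n) \<in> D"
        using k by (auto simp: is_inner_normal_def)
      obtain \<delta>' where \<delta>': "\<delta>' > 0" "\<And>t. 0 < t \<Longrightarrow> t < \<delta>' \<Longrightarrow> x + t *\<^sub>R (- n) \<notin> D"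
        using n(4)[of "- n"] nn by auto
      define s where "s = min \<delta> \<delta>' / 2"
      have "0 < s" "s < \<delta>" "s < \<delta>'" using \<delta>(1) \<delta>'(1) by (auto simp: s_def min_def)
      then show False using \<delta>(2) \<delta>'(2) by blast
    qed
    ultimately show "k = n" by blast
  qed
  then have eq: "inner_normal D x = n" .
  show "norm (inner_normal D x) = 1" unfolding eq by (rule n(1))
  show "orthogonal_to_tangent_space (frontier D) x (inner_normal D x)" unfolding eq by (rule n(2))
  show "inner_normal D x \<bullet> w > 0 \<Longrightarrow> \<exists>\<delta>>0. \<forall>t. 0 < t \<and> t < \<delta> \<longrightarrow> x + t *\<^sub>R w \<in> D"
    unfolding eq by (rule n(3))
  show "inner_normal D x \<bullet> w < 0 \<Longrightarrow> \<exists>\<delta>>0. \<forall>t. 0 < t \<and> t < \<delta> \<longrightarrow> x + t *\<^sub>R w \<notin> D"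
    unfolding eq by (rule n(4))
qed

text \<open>Only the modulus of \<open>inner_normal D x \<bullet> z\<close> is shown to be continuous: its sign is determined
  by visibility, so this is all that is needed.\<close>

lemma abs_normal_uniform:
  fixes \<nu> :: "'m::finite pt \<Rightarrow> 'm pt"
  assumes \<nu>: "\<And>x. x \<in> Y \<Longrightarrow> norm (\<nu> x) = 1 \<and> orthogonal_to_tangent_space S x (\<nu> x)"
    and Y: "Y \<subseteq> S" and x0: "x0 \<in> Y" and \<epsilon>: "0 < \<epsilon>"
  obtains d where "0 < d" "\<And>x z. x \<in> Y \<Longrightarrow> dist x x0 < d \<Longrightarrow> \<bar>\<bar>\<nu> x \<bullet> z\<bar> - \<bar>\<nu> x0 \<bullet> z\<bar>\<bar> \<le> \<epsilon> * norm z"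
proof -
  obtain U \<phi> \<phi>' p where P: "C1_parametrization S U \<phi> \<phi>'" "p \<in> U" "\<phi> p = x0" "\<And>v. \<nu> x0 \<bullet> \<phi>' p v = 0"
    using \<nu>[OF x0] unfolding orthogonal_to_tangent_space_def by blast
  note \<phi> = C1_parametrizationD[OF P(1)]
  obtain m where m: "m > 0" "\<And>v. m * norm v \<le> norm (\<phi>' p v)"
    using linear_inj_bounded_below_pos[OF \<phi>(6) \<phi>(5)[OF P(2)]] by blast
  define \<theta> where "\<theta> = min 1 (\<epsilon> / 2)"
  have \<theta>: "0 < \<theta>" "\<theta> \<le> 1" "2 * \<theta> \<le> \<epsilon>" using \<epsilon> by (auto simp: \<theta>_def)
  obtain r1 where r1: "0 < r1" "\<And>u. u \<in> U \<Longrightarrow> dist u p < r1 \<Longrightarrow> dist (\<phi>' u) (\<phi>' p) < m * \<theta>"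
    using \<phi>(4) P(2) m(1) \<theta>(1) unfolding continuous_on_iff by (metis mult_pos_pos)
  obtain r2 where r2: "0 < r2" "ball p r2 \<subseteq> U" using \<phi>(1) P(2) openE by blast
  define r where "r = min r1 r2"
  have r: "0 < r" "ball p r \<subseteq> U" using r1 r2 by (auto simp: r_def)
  obtain d where d: "0 < d" "\<And>y. y \<in> S \<Longrightarrow> dist y x0 < d \<Longrightarrow> \<exists>u \<in> ball p r. y = \<phi> u"
    using C1_parametrization_ball[OF P(1,2) r] P(3) by metis
  show ?thesis
  proof (rule that[OF d(1)])
    fix x z assume x: "x \<in> Y" "dist x x0 < d"
    then obtain u where u: "u \<in> ball p r" "x = \<phi> u" using d(2) Y by blast
    have uU: "u \<in> U" using u r by auto
    define n where "n = \<nu> x"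
    define n0 where "n0 = \<nu> x0"
    have n: "norm n = 1" "norm n0 = 1" using \<nu> x x0 by (auto simp: n_def n0_def)
    have nn: "n \<bullet> n = 1" "n0 \<bullet> n0 = 1" using n by (simp_all add: norm_eq_1)
    have n_perp: "n \<bullet> \<phi>' u v = 0" for v
      using orthogonal_to_tangent_space_all[OF _ _ P(1) uU, of n] \<nu>[OF x(1)] u(2) by (auto simp: n_def)
    have du: "norm (\<phi>' p - \<phi>' u) \<le> m * \<theta>"
      using r1(2)[OF uU] u(1) by (auto simp: r_def dist_norm dist_commute norm_minus_commute)
    define c where "c = n0 \<bullet> n"
    obtain v where v: "n = \<phi>' p v + c *\<^sub>R n0"
      using hyperplane_decomposition[OF \<phi>(6) \<phi>(5)[OF P(2)] n(2), of n] P(4) by (auto simp: n0_def c_def)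
    define \<tau> where "\<tau> = \<phi>' p v"
    have \<tau>0: "n0 \<bullet> \<tau> = 0" using P(4) by (simp add: \<tau>_def n0_def)
    have n\<tau>: "n = \<tau> + c *\<^sub>R n0" using v by (simp add: \<tau>_def)
    \<comment> \<open>\<tau> is the part of \<open>n\<close> tangential at \<open>x0\<close>. As
      \<open>n\<close> annihilates \<open>\<phi>' u v\<close>, the product
      \<open>n \<bullet> \<tau>\<close> only sees the small difference of the derivatives at
      \<open>p\<close> and \<open>u\<close>; so \<tau> is small and \<open>n\<close> is almost
      \<open>n0\<close> or \<open>- n0\<close>.\<close>
    have "(norm \<tau>)\<^sup>2 = n \<bullet> \<tau>" by (simp add: n\<tau> power2_norm_eq_inner inner_add_left \<tau>0)
    also have "\<dots> = n \<bullet> ((\<phi>' p - \<phi>' u) v)" by (simp add: \<tau>_def blinfun.diff_left inner_diff_right n_perp)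
    also have "\<dots> \<le> norm ((\<phi>' p - \<phi>' u) v)" using norm_cauchy_schwarz[of n "(\<phi>' p - \<phi>' u) v"] n by simp
    also have "\<dots> \<le> norm (\<phi>' p - \<phi>' u) * norm v" by (rule norm_blinfun)
    also have "\<dots> \<le> m * \<theta> * norm v" using du by (rule mult_right_mono) simp
    also have "\<dots> = \<theta> * (m * norm v)" by simp
    also have "\<dots> \<le> \<theta> * norm \<tau>" unfolding \<tau>_def using m(2) \<theta> by (intro mult_left_mono) auto
    finally have \<tau>: "norm \<tau> \<le> \<theta>"
      using \<theta> by (cases "\<tau> = 0") (auto simp: power2_eq_square)
    have "1 = n \<bullet> n" using nn by simp
    also have "\<dots> = \<tau> \<bullet> \<tau> + c * c"
      unfolding n\<tau> using \<tau>0 nn by (simp add: inner_add_left inner_add_right inner_commute)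
    finally have c1: "c\<^sup>2 = 1 - (norm \<tau>)\<^sup>2"
      by (simp only: power2_norm_eq_inner power2_eq_square[of c])
    then have "c\<^sup>2 \<le> 1" by simp
    then have c2: "\<bar>c\<bar> \<le> 1" by (simp add: abs_square_le_1)
    then have "c\<^sup>2 \<le> \<bar>c\<bar>" using mult_left_mono[of "\<bar>c\<bar>" 1 "\<bar>c\<bar>"] by (simp add: power2_eq_square)
    moreover have "(norm \<tau>)\<^sup>2 \<le> norm \<tau>"
      using \<tau> \<theta> mult_left_mono[of "norm \<tau>" 1 "norm \<tau>"] by (simp add: power2_eq_square)
    ultimately have c3: "1 - \<bar>c\<bar> \<le> \<theta>" using c1 \<tau> by linarith
    have nz: "n \<bullet> z = \<tau> \<bullet> z + c * (n0 \<bullet> z)" by (simp add: n\<tau> inner_add_left)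
    have t1: "\<bar>\<tau> \<bullet> z\<bar> \<le> \<theta> * norm z"
      using Cauchy_Schwarz_ineq2[of \<tau> z] mult_right_mono[OF \<tau> norm_ge_zero[of z]] by linarith
    have "\<bar>n0 \<bullet> z\<bar> \<le> norm z" using Cauchy_Schwarz_ineq2[of n0 z] n by simp
    then have "(1 - \<bar>c\<bar>) * \<bar>n0 \<bullet> z\<bar> \<le> \<theta> * norm z" using c2 c3 by (intro mult_mono) auto
    then have t2: "\<bar>n0 \<bullet> z\<bar> - \<bar>c * (n0 \<bullet> z)\<bar> \<le> \<theta> * norm z" by (simp add: abs_mult algebra_simps)
    have t3: "\<bar>c * (n0 \<bullet> z)\<bar> \<le> \<bar>n0 \<bullet> z\<bar>" using c2 by (simp add: abs_mult mult_left_le_one_le)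
    have "\<theta> * norm z + \<theta> * norm z \<le> \<epsilon> * norm z"
      using mult_right_mono[OF \<theta>(3) norm_ge_zero[of z]] by (simp add: algebra_simps)
    then show "\<bar>\<bar>\<nu> x \<bullet> z\<bar> - \<bar>\<nu> x0 \<bullet> z\<bar>\<bar> \<le> \<epsilon> * norm z"
      using nz t1 t2 t3 unfolding n_def[symmetric] n0_def[symmetric] by linarith
  qed
qed

lemma continuous_on_abs_normal:
  fixes \<nu> :: "'m::finite pt \<Rightarrow> 'm pt"
  assumes \<nu>: "\<And>x. x \<in> Y \<Longrightarrow> norm (\<nu> x) = 1 \<and> orthogonal_to_tangent_space S x (\<nu> x)" and Y: "Y \<subseteq> S"
  shows "continuous_on (Y \<times> UNIV) (\<lambda>p. \<bar>\<nu> (fst p) \<bullet> snd p\<bar>)"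
  unfolding continuous_on_iff
proof (intro ballI allI impI)
  fix p0 :: "'m pt \<times> 'm pt" and \<epsilon> :: real
  assume p0: "p0 \<in> Y \<times> UNIV" and \<epsilon>: "0 < \<epsilon>"
  obtain x0 z0 where xz: "p0 = (x0, z0)" by (cases p0)
  have x0: "x0 \<in> Y" using p0 xz by auto
  define K where "K = norm z0 + 1"
  have K: "0 < K" by (simp add: K_def add_nonneg_pos)
  obtain d where d: "0 < d" "\<And>x z. x \<in> Y \<Longrightarrow> dist x x0 < d \<Longrightarrow> \<bar>\<bar>\<nu> x \<bullet> z\<bar> - \<bar>\<nu> x0 \<bullet> z\<bar>\<bar> \<le> (\<epsilon> / (2 * K)) * norm z"
    using abs_normal_uniform[of Y \<nu> S x0 "\<epsilon> / (2 * K)"] \<nu> Y x0 \<epsilon> K by auto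
  show "\<exists>\<delta>>0. \<forall>p\<in>Y \<times> UNIV. dist p p0 < \<delta> \<longrightarrow>
      dist \<bar>\<nu> (fst p) \<bullet> snd p\<bar> \<bar>\<nu> (fst p0) \<bullet> snd p0\<bar> < \<epsilon>"
  proof (intro exI[of _ "min d (min 1 (\<epsilon> / 2))"] conjI ballI impI)
    show "0 < min d (min 1 (\<epsilon> / 2))" using d \<epsilon> by auto
    fix p :: "'m pt \<times> 'm pt" assume p: "p \<in> Y \<times> UNIV" "dist p p0 < min d (min 1 (\<epsilon> / 2))"
    obtain x z where p_eq: "p = (x, z)" by (cases p)
    have "dist x x0 \<le> dist p p0" "dist z z0 \<le> dist p p0"
      using dist_fst_le[of p p0] dist_snd_le[of p p0] by (auto simp: p_eq xz)
    then have xd: "x \<in> Y" "dist x x0 < d" "dist z z0 < 1" "dist z z0 < \<epsilon> / 2" using p p_eq by auto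
    have "norm z \<le> K"
      using xd(3) norm_triangle_ineq2[of z z0] by (simp add: K_def dist_norm)
    then have "(\<epsilon> / (2 * K)) * norm z \<le> (\<epsilon> / (2 * K)) * K" using \<epsilon> K by (intro mult_left_mono) auto
    also have "\<dots> = \<epsilon> / 2" using K by simp
    finally have 1: "\<bar>\<bar>\<nu> x \<bullet> z\<bar> - \<bar>\<nu> x0 \<bullet> z\<bar>\<bar> \<le> \<epsilon> / 2" using d(2)[OF xd(1,2), of z] by linarith
    have "\<bar>\<nu> x0 \<bullet> z - \<nu> x0 \<bullet> z0\<bar> \<le> norm (z - z0)"
      using Cauchy_Schwarz_ineq2[of "\<nu> x0" "z - z0"] \<nu>[OF x0] by (simp add: inner_diff_right)
    then have "\<bar>\<nu> x0 \<bullet> z - \<nu> x0 \<bullet> z0\<bar> < \<epsilon> / 2" using xd(4) by (simp add: dist_norm)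
    then have "dist \<bar>\<nu> x0 \<bullet> z\<bar> \<bar>\<nu> x0 \<bullet> z0\<bar> < \<epsilon> / 2"
      unfolding dist_real_def by (rule le_less_trans[OF abs_triangle_ineq3])
    moreover have "dist \<bar>\<nu> x \<bullet> z\<bar> \<bar>\<nu> x0 \<bullet> z\<bar> \<le> \<epsilon> / 2"
      unfolding dist_real_def by (rule 1)
    moreover have "dist \<bar>\<nu> x \<bullet> z\<bar> \<bar>\<nu> x0 \<bullet> z0\<bar> \<le>
        dist \<bar>\<nu> x \<bullet> z\<bar> \<bar>\<nu> x0 \<bullet> z\<bar> + dist \<bar>\<nu> x0 \<bullet> z\<bar> \<bar>\<nu> x0 \<bullet> z0\<bar>"
      by (rule dist_triangle)
    ultimately have "dist \<bar>\<nu> x \<bullet> z\<bar> \<bar>\<nu> x0 \<bullet> z0\<bar> < \<epsilon>" by linarith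
    then show "dist \<bar>\<nu> (fst p) \<bullet> snd p\<bar> \<bar>\<nu> (fst p0) \<bullet> snd p0\<bar> < \<epsilon>"
      by (simp only: p_eq xz fst_conv snd_conv)
  qed
qed

section \<open>Visibility\<close>

definition clear :: "'m::finite pt set \<Rightarrow> 'm pt \<Rightarrow> 'm pt \<Rightarrow> real \<Rightarrow> bool" where
  "clear D x w s \<longleftrightarrow> (\<forall>t. 0 < t \<and> t \<le> s \<longrightarrow> x + t *\<^sub>R w \<in> D)"

definition enters :: "'m::finite pt set \<Rightarrow> 'm pt \<Rightarrow> 'm pt \<Rightarrow> bool" where
  "enters D x w \<longleftrightarrow> (\<exists>s>0. clear D x w s)"

text \<open>For \<open>x\<close> on the boundary this picks out, among the intervals of
  \<open>D\<close> on a line, the one that meets \<open>E\<close>.\<close>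

definition reaches :: "'m::finite pt set \<Rightarrow> 'm pt set \<Rightarrow> 'm pt \<Rightarrow> 'm pt \<Rightarrow> bool" where
  "reaches D E x w \<longleftrightarrow> (\<exists>s>0. clear D x w s \<and> x + s *\<^sub>R w \<in> E)"

text \<open>The complement is the projection of a closed set along the compact \<open>K\<close>,
  hence closed. Conditions over a non-compact range of times become Borel by exhausting it with
  countably many compact ranges.\<close>

lemma open_Collect_forall_compact:
  fixes f :: "real \<Rightarrow> 'p::euclidean_space \<Rightarrow> 'b::topological_space"
  assumes K: "compact K" and D: "open D" and f: "continuous_on UNIV (\<lambda>z. f (fst z) (snd z))"
  shows "open {p. \<forall>t\<in>K. f t p \<in> D}"
proof -
  define U where "U = (K \<times> UNIV) \<inter> {z. f (fst z) (snd z) \<in> - D}"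
  have "closed ((\<lambda>z. f (fst z) (snd z)) -` (- D))"
    using f D by (intro closed_vimage) auto
  then have "closedin (top_of_set (K \<times> UNIV)) U"
    unfolding U_def vimage_def by (intro closedin_closed_Int)
  from closedin_compact_projection[OF K this]
  have "closed {p. \<exists>t. t \<in> K \<and> (t, p) \<in> U}" by simp
  moreover have "{p. \<forall>t\<in>K. f t p \<in> D} = - {p. \<exists>t. t \<in> K \<and> (t, p) \<in> U}" by (auto simp: U_def)
  ultimately show ?thesis by (simp add: open_Compl)
qed

lemma borel_Collect_clear:
  fixes D :: "'m::finite pt set"
  assumes "open D" "0 < s"
  shows "{p. clear D (fst p) (snd p) s} \<in> sets borel"
proof -
  have "{p. clear D (fst p) (snd p) s} = (\<Inter>n. {p. \<forall>t\<in>{s / real (Suc n)..s}. fst p + t *\<^sub>R snd p \<in> D})"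
  proof (intro equalityI subsetI)
    fix p assume p: "p \<in> (\<Inter>n. {p. \<forall>t\<in>{s / real (Suc n)..s}. fst p + t *\<^sub>R snd p \<in> D})"
    show "p \<in> {p. clear D (fst p) (snd p) s}"
      unfolding clear_def
    proof (intro CollectI allI impI)
      fix t assume t: "0 < t \<and> t \<le> s"
      obtain n where "inverse (real (Suc n)) < t / s" using t assms(2) reals_Archimedean[of "t / s"] by auto
      then have "s / real (Suc n) \<le> t" using assms(2) by (simp add: field_simps)
      then show "fst p + t *\<^sub>R snd p \<in> D" using p t by auto
    qed
  next
    fix p assume p: "p \<in> {p. clear D (fst p) (snd p) s}"
    show "p \<in> (\<Inter>n. {p. \<forall>t\<in>{s / real (Suc n)..s}. fst p + t *\<^sub>R snd p \<in> D})"
    proof (intro INT_I CollectI ballI)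
      fix n t assume t: "t \<in> {s / real (Suc n)..s}"
      have "0 < s / real (Suc n)" using assms(2) by simp
      then have "0 < t" using t by (auto intro: less_le_trans)
      then show "fst p + t *\<^sub>R snd p \<in> D" using p t by (simp add: clear_def)
    qed
  qed
  moreover have "open {p. \<forall>t\<in>{s / real (Suc n)..s}. fst p + t *\<^sub>R snd p \<in> D}" for n
    using assms(1) by (intro open_Collect_forall_compact) (auto intro!: continuous_intros)
  ultimately show ?thesis by (auto intro!: sets.countable_INT)
qed

lemma clear_mono: "clear D x w s \<Longrightarrow> s' \<le> s \<Longrightarrow> clear D x w s'"
  by (auto simp: clear_def)

lemma borel_Collect_enters:
  fixes D :: "'m::finite pt set"
  assumes "open D"
  shows "{p. enters D (fst p) (snd p)} \<in> sets borel"
proof -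
  have "enters D x w \<longleftrightarrow> (\<exists>n. clear D x w (inverse (real (Suc n))))" for x w
  proof
    assume "enters D x w"
    then obtain s where s: "0 < s" "clear D x w s" by (auto simp: enters_def)
    obtain n where "inverse (real (Suc n)) < s" using reals_Archimedean s by blast
    then show "\<exists>n. clear D x w (inverse (real (Suc n)))" using clear_mono s by (meson less_imp_le)
  next
    assume "\<exists>n. clear D x w (inverse (real (Suc n)))"
    then obtain n where n: "clear D x w (inverse (real (Suc n)))" ..
    have "0 < inverse (real (Suc n))" by simp
    then show "enters D x w" using n unfolding enters_def by blast
  qed
  then have "{p. enters D (fst p) (snd p)} = (\<Union>n. {p. clear D (fst p) (snd p) (inverse (real (Suc n)))})"
    by auto
  also have "\<dots> \<in> sets borel" using assms by (intro sets.countable_UN) (auto intro!: borel_Collect_clear)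
  finally show ?thesis .
qed

text \<open>\<open>E\<close> is open and \<open>clear\<close> persists for earlier times, so it is
  enough to look at rational times.\<close>

lemma borel_Collect_reaches:
  fixes D E :: "'m::finite pt set"
  assumes "open D" "open E"
  shows "{p. reaches D E (fst p) (snd p)} \<in> sets borel"
proof -
  let ?Q = "{s \<in> \<rat>. 0 < s} :: real set"
  have "reaches D E x w \<longleftrightarrow> (\<exists>s\<in>?Q. clear D x w s \<and> x + s *\<^sub>R w \<in> E)" for x w
  proof
    assume "reaches D E x w"
    then obtain s where s: "0 < s" "clear D x w s" "x + s *\<^sub>R w \<in> E" by (auto simp: reaches_def)
    have "open ((\<lambda>t. x + t *\<^sub>R w) -` E)" using assms(2) by (intro open_vimage) (auto intro!: continuous_intros)
    then obtain d where d: "0 < d" "ball s d \<subseteq> (\<lambda>t. x + t *\<^sub>R w) -` E"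
      using s(3) openE[of "(\<lambda>t. x + t *\<^sub>R w) -` E" s] by auto
    obtain t where t: "t \<in> \<rat>" "max 0 (s - d) < t" "t < s"
      using Rats_dense_in_real[of "max 0 (s - d)" s] s(1) d(1) by auto
    have "t \<in> ball s d" using t by (auto simp: dist_real_def)
    then have "x + t *\<^sub>R w \<in> E" using d(2) by blast
    moreover have "clear D x w t" using s(2) t(3) clear_mono by (meson less_imp_le)
    ultimately show "\<exists>s\<in>?Q. clear D x w s \<and> x + s *\<^sub>R w \<in> E" using t by auto
  qed (auto simp: reaches_def)
  then have "{p. reaches D E (fst p) (snd p)} =
      (\<Union>s\<in>?Q. {p. clear D (fst p) (snd p) s} \<inter> (\<lambda>p. fst p + s *\<^sub>R snd p) -` E)" by auto
  also have "\<dots> \<in> sets borel"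
  proof (rule sets.countable_UN'')
    show "countable ?Q" by (rule countable_subset[OF _ countable_rat]) auto
    show "{p. clear D (fst p) (snd p) s} \<inter> (\<lambda>p. fst p + s *\<^sub>R snd p) -` E \<in> sets borel" if "s \<in> ?Q" for s
      using that assms by (intro sets.Int borel_Collect_clear continuous_vimage_borel continuous_intros) auto
  qed
  finally show ?thesis .
qed

lemma visible_iff: "visible D x y \<longleftrightarrow> x \<noteq> y \<and> (\<forall>t. 0 < t \<and> t < 1 \<longrightarrow> x + t *\<^sub>R (y - x) \<in> D)"
proof -
  have "(1 - t) *\<^sub>R x + t *\<^sub>R y = x + t *\<^sub>R (y - x)" for t by (simp add: algebra_simps)
  then show ?thesis by (auto simp: visible_def open_segment_image_interval)
qed

lemma visible_commute: "visible D x y \<longleftrightarrow> visible D y x"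
  by (auto simp: visible_def open_segment_commute)

lemma borel_Collect_visible:
  fixes D :: "'m::finite pt set"
  assumes "open D"
  shows "{p. visible D (fst p) (snd p)} \<in> sets borel"
proof -
  define K where "K n = {1 / real (n + 2)..1 - 1 / real (n + 2)}" for n
  have K: "(\<Union>n. K n) = {0<..<1::real}"
  proof (intro equalityI subsetI)
    fix t :: real assume t: "t \<in> {0<..<1}"
    then obtain n where n: "inverse (real (Suc n)) < min t (1 - t)"
      using reals_Archimedean[of "min t (1 - t)"] by auto
    have "1 / real (n + 2) \<le> inverse (real (Suc n))" by (simp add: field_simps)
    then have "t \<in> K n" using n by (auto simp: K_def)
    then show "t \<in> (\<Union>n. K n)" by blast
  next
    fix t assume "t \<in> (\<Union>n. K n)"
    then obtain n where "1 / real (n + 2) \<le> t" "t \<le> 1 - 1 / real (n + 2)" by (auto simp: K_def)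
    moreover have "0 < 1 / real (n + 2)" by simp
    ultimately have "0 < t" "t < 1" by linarith+
    then show "t \<in> {0<..<1}" by simp
  qed
  have "visible D x y \<longleftrightarrow> x \<noteq> y \<and> (\<forall>n. \<forall>t\<in>K n. x + t *\<^sub>R (y - x) \<in> D)" for x y
    unfolding visible_iff using K by (metis UN_iff UNIV_I greaterThanLessThan_iff)
  then have "{p. visible D (fst p) (snd p)} =
      {p. fst p \<noteq> snd p} \<inter> (\<Inter>n. {p. \<forall>t\<in>K n. fst p + t *\<^sub>R (snd p - fst p) \<in> D})" by auto
  moreover have "open {p. \<forall>t\<in>K n. fst p + t *\<^sub>R (snd p - fst p) \<in> D}" for n
    using assms(1) unfolding K_def by (intro open_Collect_forall_compact) (auto intro!: continuous_intros)
  moreover have "open {p :: 'm pt \<times> 'm pt. fst p \<noteq> snd p}"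
    by (intro open_Collect_neq continuous_intros)
  ultimately show ?thesis by (auto intro!: sets.countable_INT sets.Int)
qed

text \<open>The first time outside \<open>D\<close> is sought only from \<open>s\<close> on, because
  \<open>x\<close> itself may lie on the boundary; the set of such times is closed and
  nonempty.\<close>

lemma exit_time:
  fixes D :: "'m::finite pt set"
  assumes "open D" "bounded D" "enters D x w" "w \<noteq> 0"
  obtains \<tau> where "0 < \<tau>" "\<And>t. 0 < t \<Longrightarrow> t < \<tau> \<Longrightarrow> x + t *\<^sub>R w \<in> D" "x + \<tau> *\<^sub>R w \<in> frontier D"
proof -
  obtain s where s: "0 < s" "clear D x w s" using assms(3) by (auto simp: enters_def)
  define A where "A = {t. s \<le> t \<and> x + t *\<^sub>R w \<notin> D}"
  obtain K where K: "\<And>z. z \<in> D \<Longrightarrow> norm z \<le> K" using assms(2) by (auto simp: bounded_iff)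
  define t0 where "t0 = max s ((\<bar>K\<bar> + norm x + 1) / norm w)"
  have "(\<bar>K\<bar> + norm x + 1) / norm w \<le> t0" by (simp add: t0_def)
  then have "\<bar>K\<bar> + norm x + 1 \<le> t0 * norm w" using assms(4) by (simp add: field_simps)
  moreover have "0 \<le> t0" using s by (simp add: t0_def)
  then have "t0 * norm w - norm x \<le> norm (x + t0 *\<^sub>R w)"
    using norm_diff_ineq[of "t0 *\<^sub>R w" x] by (simp add: add.commute)
  ultimately have "t0 \<in> A" using K[of "x + t0 *\<^sub>R w"] by (auto simp: A_def t0_def)
  then have ne: "A \<noteq> {}" by auto
  have bdd: "bdd_below A" by (rule bdd_belowI[of _ s]) (auto simp: A_def)
  have "A = {s..} \<inter> (\<lambda>t. x + t *\<^sub>R w) -` (- D)" by (auto simp: A_def)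
  moreover have "closed \<dots>" using assms(1) by (intro closed_Int closed_vimage) (auto intro!: continuous_intros)
  ultimately have "closed A" by simp
  define \<tau> where "\<tau> = Inf A"
  have \<tau>A: "\<tau> \<in> A" unfolding \<tau>_def using closed_contains_Inf[OF ne bdd \<open>closed A\<close>] .
  have inD: "x + t *\<^sub>R w \<in> D" if "0 < t" "t < \<tau>" for t
  proof (cases "t \<le> s")
    case False
    then show ?thesis using that(2) cInf_lower[OF _ bdd, of t] by (force simp: \<tau>_def A_def)
  qed (use s that in \<open>auto simp: clear_def\<close>)
  have \<tau>0: "0 < \<tau>" using \<tau>A s by (auto simp: A_def)
  have "x + \<tau> *\<^sub>R w \<in> closure D"
  proof (rule Lim_in_closed_set[OF closed_closure])
    show "((\<lambda>t. x + t *\<^sub>R w) \<longlongrightarrow> x + \<tau> *\<^sub>R w) (at_left \<tau>)" by (intro tendsto_intros)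
    have "eventually (\<lambda>t. t \<in> {0<..<\<tau>}) (at_left \<tau>)"
      using \<tau>0 by (auto simp: eventually_at_left_field intro!: exI[of _ 0])
    then show "eventually (\<lambda>t. x + t *\<^sub>R w \<in> closure D) (at_left \<tau>)"
      by eventually_elim (use inD closure_subset in auto)
  qed simp
  moreover have "x + \<tau> *\<^sub>R w \<notin> D" using \<tau>A by (simp add: A_def)
  ultimately have "x + \<tau> *\<^sub>R w \<in> frontier D" using assms(1) by (simp add: frontier_def interior_open)
  then show ?thesis using \<tau>0 inD by (intro that)
qed

section \<open>Projection formulas on the boundary of a domain\<close>

locale regular_domain =
  fixes D R :: "'m::finite pt set"
  assumes open_D: "open D" and bounded_D: "bounded D" and cone_D: "cone_boundary D"
    and regular_R: "regular_part D R"
begin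

abbreviation "nv \<equiv> inner_normal D"

lemma R_sub: "R \<subseteq> frontier D"
  using regular_R unfolding regular_part_def by (meson openin_imp_subset)

lemma frontier_borel [measurable]: "frontier D \<in> sets borel"
  by (intro borel_closed frontier_closed)

lemma R_borel [measurable]: "R \<in> sets borel"
proof -
  obtain G where "open G" "R = frontier D \<inter> G"
    using regular_R by (auto simp: regular_part_def openin_open)
  then show ?thesis by simp
qed

lemma irregular_null: "hausdorff_outer CARD('m) (frontier D - R) = 0"
  using regular_R by (simp add: regular_part_def emeasure_hausdorff_measure)

lemma R_param: "x \<in> R \<Longrightarrow> has_local_C1_parametrization (frontier D) x"
  using regular_R by (simp add: regular_part_def)

lemma normal:
  assumes "x \<in> R"
  shows "norm (nv x) = 1" "orthogonal_to_tangent_space (frontier D) x (nv x)"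
    "nv x \<bullet> w > 0 \<Longrightarrow> \<exists>\<delta>>0. \<forall>t. 0 < t \<and> t < \<delta> \<longrightarrow> x + t *\<^sub>R w \<in> D"
    "nv x \<bullet> w < 0 \<Longrightarrow> \<exists>\<delta>>0. \<forall>t. 0 < t \<and> t < \<delta> \<longrightarrow> x + t *\<^sub>R w \<notin> D"
  using inner_normal[OF open_D cone_D _ R_param[OF assms]] assms R_sub by blast+

lemma abs_normal_cont: "continuous_on (R \<times> UNIV) (\<lambda>p. \<bar>nv (fst p) \<bullet> snd p\<bar>)"
  by (rule continuous_on_abs_normal[of R nv "frontier D"]) (use normal R_sub in auto)

lemma normal_nonneg_visible:
  assumes "x \<in> R" "visible D x y"
  shows "0 \<le> nv x \<bullet> (y - x)"
proof (rule ccontr)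
  assume "\<not> ?thesis"
  then obtain \<delta> where \<delta>: "\<delta> > 0" "\<And>t. 0 < t \<Longrightarrow> t < \<delta> \<Longrightarrow> x + t *\<^sub>R (y - x) \<notin> D"
    using normal(4)[OF assms(1), of "y - x"] by auto
  have "x + (min 1 \<delta> / 2) *\<^sub>R (y - x) \<in> D" using assms(2) \<delta>(1) by (auto simp: visible_iff min_def)
  moreover have "0 < min 1 \<delta> / 2" "min 1 \<delta> / 2 < \<delta>" using \<delta>(1) by (auto simp: min_def)
  ultimately show False using \<delta>(2) by blast
qed

lemma normal_enters:
  assumes "x \<in> R" "nv x \<bullet> w > 0"
  shows "enters D x w"
proof -
  obtain \<delta> where \<delta>: "\<delta> > 0" "\<And>t. 0 < t \<Longrightarrow> t < \<delta> \<Longrightarrow> x + t *\<^sub>R w \<in> D"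
    using normal(3)[OF assms] by auto
  then show ?thesis unfolding enters_def clear_def by (intro exI[of _ "\<delta> / 2"]) auto
qed

text \<open>One form of derivative covers both changes of variables: projection from a point, where
  \<open>\<kappa> y\<close> is the inverse height of \<open>y\<close> seen from that point, and
  parallel projection, where \<kappa> is 1 and \<open>T\<close> the identity. The weight vanishes
  where the projecting direction is tangential.\<close>

lemma hypersurface_map_hproj:
  fixes g u :: "'m pt \<Rightarrow> real ^ 'm" and T :: "'m pt \<Rightarrow> 'm pt"
  assumes Z: "open Z" and g: "\<And>y. y \<in> Z \<Longrightarrow> (g has_derivative (\<lambda>z. \<kappa> y *\<^sub>R hproj (u y) (T z))) (at y)"
    and \<kappa>: "continuous_on Z \<kappa>" "\<And>y. y \<in> Z \<Longrightarrow> 0 < \<kappa> y" and u: "continuous_on Z u"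
    and T: "orthogonal_transformation T" "\<And>z. T (T z) = z"
    and Y: "Y \<in> sets borel" "Y \<subseteq> R \<inter> Z"
  shows "hypersurface_map (frontier D) Y Z g (\<lambda>y. Blinfun (\<lambda>z. \<kappa> y *\<^sub>R hproj (u y) (T z)))
    (\<lambda>y. \<kappa> y ^ CARD('m) * \<bar>T (nv y) \<bullet> (u y, 1)\<bar>)"
proof -
  have linT: "linear T" using T(1) by (rule orthogonal_transformation_linear)
  have contT: "continuous_on A T" for A using linT by (simp add: linear_continuous_on linear_linear)
  have Tinner: "T a \<bullet> T b = a \<bullet> b" for a b using T(1) unfolding orthogonal_transformation_def by metis
  have Tadj: "T a \<bullet> b = a \<bullet> T b" for a b by (metis T(2) Tinner)
  define g' where "g' y = Blinfun (\<lambda>z. \<kappa> y *\<^sub>R hproj (u y) (T z))" for y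
  have lin: "bounded_linear (\<lambda>z. \<kappa> y *\<^sub>R hproj (u y) (T z))" for y
  proof -
    have l: "linear (\<lambda>z. hproj (u y) (T z))"
      using linear_compose[OF linT linear_hproj[of "u y"]] by (simp add: comp_def)
    have "linear (\<lambda>z. \<kappa> y *\<^sub>R hproj (u y) (T z))"
      by (rule linearI) (simp_all add: linear_add[OF l] linear_cmul[OF l] scaleR_add_right)
    then show ?thesis by (simp add: linear_linear)
  qed
  have g': "blinfun_apply (g' y) = (\<lambda>z. \<kappa> y *\<^sub>R hproj (u y) (T z))" for y
    unfolding g'_def using lin by (rule bounded_linear_Blinfun_apply)
  have perp: "nv (\<phi> p) \<bullet> \<phi>' p v = 0"
    if "C1_parametrization (frontier D) U \<phi> \<phi>'" "p \<in> U" "\<phi> p \<in> Y" for U \<phi> \<phi>' p v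
  proof -
    have "\<phi> p \<in> R" using that(3) Y(2) by blast
    then show ?thesis using orthogonal_to_tangent_space_all[OF normal(1,2) that(1,2) refl] by blast
  qed
  have "hypersurface_map (frontier D) Y Z g g' (\<lambda>y. \<kappa> y ^ CARD('m) * \<bar>T (nv y) \<bullet> (u y, 1)\<bar>)"
  proof
    show "open Z" "Y \<in> sets borel" by fact+
    show "Y \<subseteq> frontier D \<inter> Z" using Y R_sub by auto
    show "(g has_derivative blinfun_apply (g' y)) (at y)" if "y \<in> Z" for y using g[OF that] by (simp add: g')
    show "continuous_on Z g'"
    proof (rule continuous_on_blinfun_componentwise)
      fix i :: "'m pt"
      show "continuous_on Z (\<lambda>y. g' y i)"
        unfolding g' hproj_def by (intro continuous_intros \<kappa> u)
    qed
    show "has_local_C1_parametrization (frontier D) y" if "y \<in> Y" for y using that Y(2) R_param by blast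
    show "0 \<le> \<kappa> y ^ CARD('m) * \<bar>T (nv y) \<bullet> (u y, 1)\<bar>" if "y \<in> Y" for y
    proof -
      have "y \<in> Z" using that Y(2) by blast
      then show ?thesis using \<kappa>(2)[of y] by simp
    qed
    have YZ: "continuous_on Y \<kappa>" "continuous_on Y u"
      using \<kappa>(1) u Y(2) by (auto intro: continuous_on_subset)
    have "continuous_on Y (\<lambda>y. (y, T (u y, 1)))"
      by (intro continuous_intros continuous_on_compose2[OF contT[of UNIV]] YZ) auto
    then have "continuous_on Y (\<lambda>y. \<bar>nv (fst (y, T (u y, 1))) \<bullet> snd (y, T (u y, 1))\<bar>)"
      by (rule continuous_on_compose2[OF abs_normal_cont]) (use Y in auto)
    then have "continuous_on Y (\<lambda>y. \<bar>T (nv y) \<bullet> (u y, 1)\<bar>)" by (simp add: Tadj)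
    then show "continuous_on Y (\<lambda>y. \<kappa> y ^ CARD('m) * \<bar>T (nv y) \<bullet> (u y, 1)\<bar>)"
      by (intro continuous_on_mult continuous_on_power YZ)
    fix U \<phi> \<phi>' p
    assume P: "C1_parametrization (frontier D) U \<phi> \<phi>'" "p \<in> U" "\<phi> p \<in> Y"
    note \<phi> = C1_parametrizationD[OF P(1)]
    define y where "y = \<phi> p"
    have yRZ: "y \<in> R" "y \<in> Z" using P(3) Y(2) unfolding y_def by blast+
    note y = yRZ \<kappa>(2)[OF yRZ(2)]
    have n1: "norm (nv y) = 1" using normal(1) y by simp
    { assume w: "0 < \<kappa> (\<phi> p) ^ CARD('m) * \<bar>T (nv (\<phi> p)) \<bullet> (u (\<phi> p), 1)\<bar>"
      then have ne: "T (nv y) \<bullet> (u y, 1) \<noteq> 0" by (auto simp: y_def)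
      show "inj (\<lambda>v. g' (\<phi> p) (\<phi>' p v))"
      proof -
        have "linear (\<lambda>v. g' (\<phi> p) (\<phi>' p v))"
          by (intro linearI) (simp_all add: blinfun.add_right blinfun.scaleR_right)
        moreover have "v = 0" if v: "g' (\<phi> p) (\<phi>' p v) = 0" for v
        proof -
          define z where "z = T (\<phi>' p v)"
          have "hproj (u y) z = 0" using v y by (simp add: g' y_def z_def)
          then have z: "z = snd z *\<^sub>R (u y, 1)" by (simp add: hproj_def prod_eq_iff)
          have "0 = T (nv y) \<bullet> z" using perp[OF P, of v] by (simp add: z_def Tinner y_def)
          also have "\<dots> = snd z * (T (nv y) \<bullet> (u y, 1))" by (subst z) (simp only: inner_scaleR_right)
          finally have "snd z = 0" using ne by simp
          then have "z = 0" using z by (simp add: prod_eq_iff)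
          then have "\<phi>' p v = 0" using T(2)[of "\<phi>' p v"] linear_0[OF linT] by (simp add: z_def)
          then show ?thesis using \<phi>(5)[OF P(2)] \<phi>(6)[of p] by (simp add: linear_injective_0)
        qed
        ultimately show ?thesis by (simp add: linear_injective_0)
      qed
      fix B assume B: "B \<in> sets borel" "B \<subseteq> range (\<phi>' p)"
      then have "nv y \<bullet> z = 0" if "z \<in> B" for z using that perp[OF P] by (auto simp: y_def)
      then have "hausdorff_outer CARD('m) ((\<lambda>z. \<kappa> y *\<^sub>R hproj (u y) (T z)) ` B) =
          ennreal (\<kappa> y ^ CARD('m) * \<bar>T (nv y) \<bullet> (u y, 1)\<bar>) * hausdorff_outer CARD('m) B"
        by (intro hausdorff_outer_scaled_hproj[OF T(1) n1 B(1) _ ne y(3)])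
      then show "hausdorff_outer CARD('m) (g' (\<phi> p) ` B) =
          ennreal (\<kappa> (\<phi> p) ^ CARD('m) * \<bar>T (nv (\<phi> p)) \<bullet> (u (\<phi> p), 1)\<bar>) * hausdorff_outer CARD('m) B"
        by (simp only: g' y_def) }
    \<comment> \<open>The projecting direction \<open>T (u y, 1)\<close> is now tangential, and it
      is the vector that the derivative kills.\<close>
    { assume w: "\<kappa> (\<phi> p) ^ CARD('m) * \<bar>T (nv (\<phi> p)) \<bullet> (u (\<phi> p), 1)\<bar> = 0"
      then have "T (nv y) \<bullet> (u y, 1) = 0" using y by (auto simp: y_def)
      then have "nv y \<bullet> T (u y, 1) = 0" by (simp only: Tadj)
      moreover obtain v where v: "T (u y, 1) = \<phi>' p v + (nv y \<bullet> T (u y, 1)) *\<^sub>R nv y"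
        using hyperplane_decomposition[OF \<phi>(6) \<phi>(5)[OF P(2)] n1, of "T (u y, 1)"] perp[OF P] by (auto simp: y_def)
      ultimately have v: "T (u y, 1) = \<phi>' p v" by simp
      then have "T (\<phi>' p v) = (u y, 1)" using T(2) by metis
      then have "g' (\<phi> p) (\<phi>' p v) = 0" by (simp add: g' y_def hproj_def)
      moreover have "v \<noteq> 0"
      proof
        assume "v = 0"
        then have "\<phi>' p v = 0" by simp
        then have "(u y, 1) = T 0" using \<open>T (\<phi>' p v) = (u y, 1)\<close> by simp
        then have "(u y, 1) = (0 :: 'm pt)" using linear_0[OF linT] by simp
        then show False by (simp add: prod_eq_iff)
      qed
      ultimately show "\<exists>v. v \<noteq> 0 \<and> g' (\<phi> p) (\<phi>' p v) = 0" by blast }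
  qed
  then show ?thesis by (simp only: g'_def[abs_def])
qed

text \<open>The irregular points and the points where the projection is tangential are invisible
  under \<open>g\<close>, up to a null set.\<close>

lemma projection_formula:
  fixes g u :: "'m pt \<Rightarrow> real ^ 'm" and T :: "'m pt \<Rightarrow> 'm pt"
  assumes Z: "open Z" and g: "\<And>y. y \<in> Z \<Longrightarrow> (g has_derivative (\<lambda>z. \<kappa> y *\<^sub>R hproj (u y) (T z))) (at y)"
    and \<kappa>: "continuous_on Z \<kappa>" "\<And>y. y \<in> Z \<Longrightarrow> 0 < \<kappa> y" and u: "continuous_on Z u"
    and T: "orthogonal_transformation T" "\<And>z. T (T z) = z"
    and P: "P \<in> sets borel" "P \<subseteq> frontier D \<inter> Z" "inj_on g P" and Q: "g ` P = Q" "Q \<in> sets borel"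
    and q [measurable]: "q \<in> borel_measurable borel"
  shows "(\<integral>\<^sup>+y\<in>P \<inter> R. q (g y) * ennreal (\<kappa> y ^ CARD('m) * \<bar>T (nv y) \<bullet> (u y, 1)\<bar>) \<partial>hausdorff_surface) =
    (\<integral>\<^sup>+v\<in>Q. q v \<partial>hausdorff_measure CARD('m))"
proof -
  let ?HN = "hausdorff_measure CARD('m) :: (real ^ 'm) measure"
  define w where "w y = \<kappa> y ^ CARD('m) * \<bar>T (nv y) \<bullet> (u y, 1)\<bar>" for y
  define g' where "g' y = Blinfun (\<lambda>z. \<kappa> y *\<^sub>R hproj (u y) (T z))" for y
  have PR: "P \<inter> R \<in> sets borel" "P \<inter> R \<subseteq> R \<inter> Z" using P by auto
  interpret hypersurface_map "frontier D" "P \<inter> R" Z g g' w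
    unfolding w_def[abs_def] g'_def[abs_def] by (rule hypersurface_map_hproj[OF Z g \<kappa> u T PR])
  define B where "B = {y \<in> P \<inter> R. 0 < w y}"
  have B: "B \<in> sets borel"
    using borel_vimage_continuous_on[OF w_cont PR(1), of "{0<..}"] by (simp add: B_def)
  have B': "B \<subseteq> P \<inter> R" "inj_on g B" "\<And>y. y \<in> B \<Longrightarrow> 0 < w y"
    using P(3) by (auto simp: B_def intro: inj_on_subset)
  have "(\<integral>\<^sup>+y\<in>P \<inter> R. q (g y) * ennreal (w y) \<partial>hausdorff_surface) =
      (\<integral>\<^sup>+y\<in>B. q (g y) * ennreal (w y) \<partial>hausdorff_surface)"
    using w_nonneg by (intro nn_integral_cong) (force simp: B_def ennreal_eq_0_iff split: split_indicator)
  also have "\<dots> = (\<integral>\<^sup>+v\<in>g ` B. q v \<partial>?HN)"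
    by (rule area_formula[OF B B' q])
  also have "\<dots> = (\<integral>\<^sup>+v\<in>Q. q v \<partial>?HN)"
  proof -
    have "hausdorff_outer CARD('m) (g ` (P - R)) = 0"
    proof (rule hausdorff_outer_zero_C1_image[OF open_Z g_der g'_cont])
      show "P - R \<subseteq> Z" using P by auto
      show "hausdorff_outer CARD('m) (P - R) = 0"
        by (rule hausdorff_outer_zero_mono[OF irregular_null]) (use P in auto)
    qed
    then have "hausdorff_outer CARD('m) (g ` (P - R) \<union> g ` {y \<in> P \<inter> R. w y = 0}) = 0"
      using hausdorff_outer_Un_le[of "CARD('m)" "g ` (P - R)" "g ` {y \<in> P \<inter> R. w y = 0}"] critical_values_null
      by simp
    then obtain N where N: "N \<in> null_sets ?HN" "g ` (P - R) \<union> g ` {y \<in> P \<inter> R. w y = 0} \<subseteq> N"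
      by (rule hausdorff_outer_zero_imp_null_superset)
    have ind: "indicator (g ` B) v = (indicator Q v :: ennreal)" if v: "v \<notin> N" for v
    proof -
      have "v \<in> g ` B" if "v \<in> Q"
      proof -
        have "v \<in> g ` P" using that by (simp only: Q(1))
        then obtain y where y: "y \<in> P" "v = g y" by blast
        have yR: "y \<in> R" using y v N(2) by blast
        then have "w y \<noteq> 0" using y v N(2) by blast
        moreover have "0 \<le> w y" using w_nonneg y(1) yR by blast
        ultimately have "y \<in> B" using y(1) yR by (simp add: B_def)
        then show ?thesis using y(2) by blast
      qed
      moreover have "v \<in> Q" if "v \<in> g ` B" using that Q(1) B'(1) by blast
      ultimately show ?thesis by (auto simp: indicator_def)
    qed
    show ?thesis
      by (intro nn_integral_cong_AE AE_I'[OF N(1)]) (auto, metis ind)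
  qed
  finally show ?thesis by (simp add: w_def)
qed

end

text \<open>The gnomonic coordinate of the direction from \<open>x\<close> to \<open>y\<close> after
  the change of coordinates \<open>T\<close>: where the height of \<open>T (y - x)\<close> is
  positive, that vector is a multiple of \<open>(u, 1)\<close>.\<close>

definition slope :: "('m::finite pt \<Rightarrow> 'm pt) \<Rightarrow> 'm pt \<Rightarrow> 'm pt \<Rightarrow> real ^ 'm" where
  "slope T x y = inverse (snd (T (y - x))) *\<^sub>R fst (T (y - x))"

lemma slope_direction:
  assumes "0 < snd (T (y - x))"
  shows "(slope T x y, 1) = inverse (snd (T (y - x))) *\<^sub>R T (y - x)"
  using assms by (simp add: slope_def prod_eq_iff)

lemma continuous_on_orthogonal:
  assumes "orthogonal_transformation (T :: 'a::euclidean_space \<Rightarrow> 'a)"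
  shows "continuous_on A T"
  using orthogonal_transformation_linear[OF assms] by (simp add: linear_continuous_on linear_linear)

lemma null_sets_hausdorff_iff_lborel:
  fixes A :: "(real ^ 'm::finite) set"
  shows "A \<in> null_sets (hausdorff_measure CARD('m)) \<longleftrightarrow> A \<in> null_sets lborel"
proof -
  obtain c where c: "c > 0" "(hausdorff_measure CARD('m) :: (real ^ 'm) measure) = scale_measure (ennreal c) lborel"
    using hausdorff_measure_eq_lborel[where 'a="real ^ 'm"] by auto
  show ?thesis unfolding c(2) using c(1) by (auto simp: null_sets_def)
qed

section \<open>Central and parallel projection; the kernel of the random chord\<close>

context regular_domain
begin

text \<open>A ray from \<open>x\<close> that enters \<open>D\<close> has exactly one visible end
  point, where it first leaves \<open>D\<close>; so the visible boundary points on the positive side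
  correspond to the entering directions. By the quotient rule the map \<open>slope T x\<close> has a
  derivative of the form treated in \<open>projection_formula\<close>.\<close>

lemma radial_formula:
  fixes T :: "'m pt \<Rightarrow> 'm pt"
  assumes T: "orthogonal_transformation T" "\<And>z. T (T z) = z"
    and q [measurable]: "q \<in> borel_measurable borel"
  shows "(\<integral>\<^sup>+y\<in>{y \<in> R. 0 < snd (T (y - x)) \<and> visible D x y}.
       q (slope T x y) * ennreal (\<bar>nv y \<bullet> (y - x)\<bar> / snd (T (y - x)) ^ (CARD('m) + 1)) \<partial>hausdorff_surface) =
    (\<integral>\<^sup>+u\<in>{u. enters D x (T (u, 1))}. q u \<partial>hausdorff_measure CARD('m))"
proof -
  have linT: "linear T" using T(1) by (rule orthogonal_transformation_linear)
  have contT: "continuous_on A T" for A using T(1) by (rule continuous_on_orthogonal)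
  have Tinner: "T a \<bullet> T b = a \<bullet> b" for a b using T(1) unfolding orthogonal_transformation_def by metis
  define t where "t y = snd (T (y - x))" for y
  define b where "b y = fst (T (y - x))" for y
  define g where "g y = slope T x y" for y
  have g: "g y = inverse (t y) *\<^sub>R b y" for y by (simp add: g_def slope_def t_def b_def)
  define Z where "Z = {y. 0 < t y}"
  have contt: "continuous_on A t" and contb: "continuous_on A b" for A
    unfolding t_def b_def by (intro continuous_intros continuous_on_compose2[OF contT[of UNIV]]; simp)+
  have Z: "open Z"
    unfolding Z_def using contt[of UNIV] by (intro open_Collect_less continuous_intros)
  define P where "P = {y \<in> frontier D. 0 < t y \<and> visible D x y}"
  define Q where "Q = {u. enters D x (T (u, 1))}"
  have P: "P \<in> sets borel" "P \<subseteq> frontier D \<inter> Z"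
  proof -
    have "{y. visible D x y} = (\<lambda>y. (x, y)) -` {p. visible D (fst p) (snd p)}" by simp
    then have "{y. visible D x y} \<in> sets borel"
      using continuous_vimage_borel[OF _ borel_Collect_visible[OF open_D], of "\<lambda>y. (x, y)"]
      by (simp add: continuous_intros)
    moreover have "P = frontier D \<inter> Z \<inter> {y. visible D x y}" by (auto simp: P_def Z_def)
    ultimately show "P \<in> sets borel" using Z by simp
  qed (auto simp: P_def Z_def)
  have Qb: "Q \<in> sets borel"
  proof -
    have "Q = (\<lambda>u. (x, T (u, 1))) -` {p. enters D (fst p) (snd p)}" by (simp add: Q_def vimage_def)
    moreover have "continuous_on UNIV (\<lambda>u. (x, T (u, 1)))"
      by (intro continuous_intros continuous_on_compose2[OF contT[of UNIV]]) auto
    ultimately show ?thesis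
      using continuous_vimage_borel[OF _ borel_Collect_enters[OF open_D], of "\<lambda>u. (x, T (u, 1))"] by (simp only:)
  qed
  have dir: "T (g y, 1) = inverse (t y) *\<^sub>R (y - x)" if "0 < t y" for y
    using slope_direction[of T y x] that T(2)[of "y - x"] linear_cmul[OF linT] by (simp add: g_def t_def)
  have point: "y = x + t y *\<^sub>R T (g y, 1)" if "0 < t y" for y
    using dir[OF that] that by simp
  have notD: "y \<notin> D" if "y \<in> P" for y
    using that frontier_not_in_open[OF open_D] by (simp add: P_def)
  have inD: "x + s *\<^sub>R T (g y, 1) \<in> D" if "y \<in> P" "0 < s" "s < t y" for y s
  proof -
    have "x + (s / t y) *\<^sub>R (y - x) \<in> D" using that by (auto simp: P_def visible_iff)
    then show ?thesis using dir[of y] that by (simp add: P_def divide_inverse)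
  qed
  \<comment> \<open>Of two boundary points on one ray, the nearer would lie on the open segment to
    the farther, which is visible, and hence in \<open>D\<close>.\<close>
  have inj: "inj_on g P"
  proof (rule inj_onI)
    fix y1 y2 assume y: "y1 \<in> P" "y2 \<in> P" "g y1 = g y2"
    have pos: "0 < t y1" "0 < t y2" using y by (auto simp: P_def)
    have "\<not> t y1 < t y2" using inD[OF y(2) pos(1)] point[OF pos(1)] y(3) notD[OF y(1)] by metis
    moreover have "\<not> t y2 < t y1" using inD[OF y(1) pos(2)] point[OF pos(2)] y(3) notD[OF y(2)] by metis
    ultimately have "t y1 = t y2" by simp
    then show "y1 = y2" using point[OF pos(1)] point[OF pos(2)] y(3) by metis
  qed
  have img: "g ` P = Q"
  proof (intro equalityI subsetI)
    fix u assume "u \<in> g ` P"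
    then obtain y where y: "y \<in> P" "u = g y" by blast
    have "0 < t y" using y by (simp add: P_def)
    then have "0 < t y / 2" "t y / 2 < t y" by auto
    then have "clear D x (T (u, 1)) (t y / 2)"
      using inD[OF y(1)] y(2) by (auto simp: clear_def)
    then show "u \<in> Q" using \<open>0 < t y / 2\<close> unfolding Q_def enters_def by blast
  next
    fix u assume "u \<in> Q"
    then have ent: "enters D x (T (u, 1))" by (simp add: Q_def)
    have "T (u, 1) \<noteq> 0"
    proof
      assume "T (u, 1) = 0"
      then have "(u, 1) = (0 :: 'm pt)" using T(2)[of "(u, 1)"] linear_0[OF linT] by simp
      then show False by (simp add: prod_eq_iff)
    qed
    then obtain \<tau> where \<tau>: "0 < \<tau>" "\<And>s. 0 < s \<Longrightarrow> s < \<tau> \<Longrightarrow> x + s *\<^sub>R T (u, 1) \<in> D"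
        "x + \<tau> *\<^sub>R T (u, 1) \<in> frontier D"
      using exit_time[OF open_D bounded_D ent] by blast
    define y where "y = x + \<tau> *\<^sub>R T (u, 1)"
    have Ty: "T (y - x) = \<tau> *\<^sub>R (u, 1)" by (simp add: y_def linear_cmul[OF linT] T(2))
    then have ty: "t y = \<tau>" and by': "b y = \<tau> *\<^sub>R u" by (simp_all add: t_def b_def)
    have "visible D x y"
      unfolding visible_iff
    proof (intro conjI allI impI)
      show "x \<noteq> y" using ty \<tau>(1) linear_0[OF linT] by (auto simp: t_def)
      fix s :: real assume s: "0 < s \<and> s < 1"
      have "x + (s * \<tau>) *\<^sub>R T (u, 1) \<in> D" using s \<tau>(1) by (intro \<tau>(2)) auto
      then show "x + s *\<^sub>R (y - x) \<in> D" by (simp add: y_def)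
    qed
    then have "y \<in> P" using \<tau>(1,3) ty by (simp add: P_def y_def)
    moreover have "g y = u" using ty by' \<tau>(1) by (simp add: g)
    ultimately show "u \<in> g ` P" by blast
  qed
  have der: "(g has_derivative (\<lambda>z. inverse (t y) *\<^sub>R hproj (g y) (T z))) (at y)" if "y \<in> Z" for y
  proof -
    have ty: "t y \<noteq> 0" using that by (simp add: Z_def)
    have blT: "bounded_linear T" using linT by (simp add: linear_linear)
    have "((\<lambda>y. T (y - x)) has_derivative (\<lambda>z. T z)) (at y)"
      by (rule bounded_linear.has_derivative[OF blT]) (auto intro!: derivative_eq_intros)
    then have t': "(t has_derivative (\<lambda>z. snd (T z))) (at y)" and b': "(b has_derivative (\<lambda>z. fst (T z))) (at y)"
      unfolding t_def[abs_def] b_def[abs_def] by (intro has_derivative_snd has_derivative_fst; assumption)+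
    have "((\<lambda>y. inverse (t y) *\<^sub>R b y) has_derivative
        (\<lambda>z. inverse (t y) *\<^sub>R fst (T z) + (- (inverse (t y) * snd (T z) * inverse (t y))) *\<^sub>R b y)) (at y)"
      by (rule has_derivative_scaleR[OF Deriv.has_derivative_inverse[where f = t, OF ty t'] b'])
    moreover have "(\<lambda>z. inverse (t y) *\<^sub>R fst (T z) + (- (inverse (t y) * snd (T z) * inverse (t y))) *\<^sub>R b y) =
        (\<lambda>z. inverse (t y) *\<^sub>R hproj (g y) (T z))"
      by (simp add: hproj_def g scaleR_diff_right mult_ac fun_eq_iff)
    moreover have "(\<lambda>y. inverse (t y) *\<^sub>R b y) = g" by (simp add: g fun_eq_iff)
    ultimately show ?thesis by simp
  qed
  have "continuous_on Z (\<lambda>y. inverse (t y))"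
    using contt by (intro continuous_on_inverse) (auto simp: Z_def)
  moreover from this have "continuous_on Z g"
    unfolding g[abs_def] using contb by (intro continuous_on_scaleR)
  ultimately have main: "(\<integral>\<^sup>+y\<in>P \<inter> R. q (g y) * ennreal (inverse (t y) ^ CARD('m) * \<bar>T (nv y) \<bullet> (g y, 1)\<bar>) \<partial>hausdorff_surface) =
      (\<integral>\<^sup>+u\<in>Q. q u \<partial>hausdorff_measure CARD('m))"
    using der by (intro projection_formula[OF Z _ _ _ _ T P inj img Qb q]) (auto simp: Z_def)
  \<comment> \<open>\<open>CARD('m)\<close> powers of the inverse height come from the scaling of
    the hyperplane, and one more from normalising the direction to \<open>(g y, 1)\<close>; together
    they make d.\<close>
  have weight: "inverse (t y) ^ CARD('m) * \<bar>T (nv y) \<bullet> (g y, 1)\<bar> = \<bar>nv y \<bullet> (y - x)\<bar> / t y ^ (CARD('m) + 1)"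
    if "y \<in> P" for y
  proof -
    have ty: "0 < t y" using that by (simp add: P_def)
    have "(g y, 1) = inverse (t y) *\<^sub>R T (y - x)"
      using slope_direction[of T y x] ty by (simp add: g_def t_def)
    then have "T (nv y) \<bullet> (g y, 1) = inverse (t y) * (nv y \<bullet> (y - x))"
      by (simp only: inner_scaleR_right Tinner)
    then have "\<bar>T (nv y) \<bullet> (g y, 1)\<bar> = inverse (t y) * \<bar>nv y \<bullet> (y - x)\<bar>"
      using ty by (simp add: abs_mult)
    then show ?thesis using ty by (simp add: field_simps)
  qed
  have "P \<inter> R = {y \<in> R. 0 < t y \<and> visible D x y}" using R_sub by (auto simp: P_def)
  then have eq: "{y \<in> R. 0 < t y \<and> visible D x y} = P \<inter> R" by simp
  have "(\<integral>\<^sup>+y\<in>{y \<in> R. 0 < t y \<and> visible D x y}. q (g y) * ennreal (\<bar>nv y \<bullet> (y - x)\<bar> / t y ^ (CARD('m) + 1)) \<partial>hausdorff_surface) =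
      (\<integral>\<^sup>+y\<in>P \<inter> R. q (g y) * ennreal (inverse (t y) ^ CARD('m) * \<bar>T (nv y) \<bullet> (g y, 1)\<bar>) \<partial>hausdorff_surface)"
    unfolding eq
  proof (intro nn_integral_cong)
    fix y
    show "q (g y) * ennreal (\<bar>nv y \<bullet> (y - x)\<bar> / t y ^ (CARD('m) + 1)) * indicator (P \<inter> R) y =
        q (g y) * ennreal (inverse (t y) ^ CARD('m) * \<bar>T (nv y) \<bullet> (g y, 1)\<bar>) * indicator (P \<inter> R) y"
      using weight[of y] by (cases "y \<in> P \<inter> R") auto
  qed
  then show ?thesis using main by (simp only: t_def g_def Q_def)
qed

lemma parallel_formula:
  assumes P: "P \<in> sets borel" "P \<subseteq> frontier D" "inj_on (hproj u) P" and Q: "hproj u ` P = Q" "Q \<in> sets borel"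
    and q [measurable]: "q \<in> borel_measurable borel"
  shows "(\<integral>\<^sup>+x\<in>P \<inter> R. q (hproj u x) * ennreal \<bar>nv x \<bullet> (u, 1)\<bar> \<partial>hausdorff_surface) =
    (\<integral>\<^sup>+v\<in>Q. q v \<partial>hausdorff_measure CARD('m))"
proof -
  have bl: "bounded_linear (hproj u)" using linear_hproj by (simp add: linear_linear)
  have "(\<integral>\<^sup>+x\<in>P \<inter> R. q (hproj u x) * ennreal (1 ^ CARD('m) * \<bar>(\<lambda>z. z) (nv x) \<bullet> (u, 1)\<bar>) \<partial>hausdorff_surface) =
    (\<integral>\<^sup>+v\<in>Q. q v \<partial>hausdorff_measure CARD('m))"
    by (rule projection_formula[of UNIV "hproj u" "\<lambda>_. 1" "\<lambda>_. u" "\<lambda>z. z"])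
       (use P Q bl in \<open>auto simp: bounded_linear_imp_has_derivative orthogonal_transformation_id\<close>)
  then show ?thesis by simp
qed

text \<open>\<open>K_tilde\<close> without its constant and with absolute values. The moduli are
  what is known to be continuous, and for visible pairs the inner products with the inner normals
  have the right sign anyway.\<close>

definition kernel :: "'m pt \<Rightarrow> 'm pt \<Rightarrow> real" where
  "kernel x y = (if x \<in> R \<and> y \<in> R \<and> visible D x y
     then \<bar>nv x \<bullet> (y - x)\<bar> * \<bar>nv y \<bullet> (y - x)\<bar> / norm (y - x) ^ (CARD('m) + 2) else 0)"

lemma abs_inner_commute: "\<bar>a \<bullet> (x - y)\<bar> = \<bar>a \<bullet> (y - x)\<bar>" for a x y :: "'a::real_inner"
  by (simp add: inner_diff_right abs_minus_commute)

lemma kernel_commute: "kernel x y = kernel y x"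
  unfolding kernel_def using visible_commute[of D x y]
  by (simp add: abs_inner_commute[of _ x y] norm_minus_commute[of x y] mult.commute)

lemma K_tilde_eq_kernel: "K_tilde D R x y = gamma_const TYPE('m) * kernel x y"
proof (cases "x \<in> R \<and> y \<in> R \<and> visible D x y")
  case True
  have "0 \<le> nv x \<bullet> (y - x)" "0 \<le> nv y \<bullet> (x - y)"
    using normal_nonneg_visible True visible_commute[of D x y] by blast+
  then show ?thesis
    using True abs_inner_commute[of "nv y" x y]
    by (simp add: K_tilde_def kernel_def inner_commute norm_minus_commute[of x y])
qed (auto simp: K_tilde_def kernel_def)

lemma kernel_measurable: "(\<lambda>p. kernel (fst p) (snd p)) \<in> borel_measurable borel"
proof -
  define A where "A = R \<times> R"
  have A: "A \<in> sets borel"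
    unfolding A_def by (intro borel_Times R_borel)
  have 1: "continuous_on A (\<lambda>p. \<bar>nv (fst p) \<bullet> (snd p - fst p)\<bar>)"
  proof -
    have "continuous_on A (\<lambda>p. \<bar>nv (fst (fst p, snd p - fst p)) \<bullet> snd (fst p, snd p - fst p)\<bar>)"
      by (rule continuous_on_compose2[OF abs_normal_cont]) (auto simp: A_def intro!: continuous_intros)
    then show ?thesis by simp
  qed
  have 2: "continuous_on A (\<lambda>p. \<bar>nv (snd p) \<bullet> (snd p - fst p)\<bar>)"
  proof -
    have "continuous_on A (\<lambda>p. \<bar>nv (fst (snd p, snd p - fst p)) \<bullet> snd (snd p, snd p - fst p)\<bar>)"
      by (rule continuous_on_compose2[OF abs_normal_cont]) (auto simp: A_def intro!: continuous_intros)
    then show ?thesis by simp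
  qed
  define f where "f p = \<bar>nv (fst p) \<bullet> (snd p - fst p)\<bar> * \<bar>nv (snd p) \<bullet> (snd p - fst p)\<bar>" for p
  have "continuous_on A f" unfolding f_def by (intro continuous_on_mult 1 2)
  then have [measurable]: "(\<lambda>p. indicator A p *\<^sub>R f p) \<in> borel_measurable borel"
    using A by (rule borel_measurable_continuous_on_indicator[rotated])
  have [measurable]: "{p. visible D (fst p) (snd p)} \<in> sets borel"
    by (rule borel_Collect_visible[OF open_D])
  have [measurable]: "(\<lambda>p :: 'm pt \<times> 'm pt. norm (snd p - fst p)) \<in> borel_measurable borel"
    by (intro borel_measurable_continuous_onI continuous_intros)
  have "(\<lambda>p. kernel (fst p) (snd p)) = (\<lambda>p. indicator {p. visible D (fst p) (snd p)} p *
      (indicator A p *\<^sub>R f p) / norm (snd p - fst p) ^ (CARD('m) + 2))"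
    by (auto simp: kernel_def A_def f_def fun_eq_iff)
  also have "\<dots> \<in> borel_measurable borel" by measurable
  finally show ?thesis .
qed

text \<open>In coordinates that make the normal at \<open>x\<close> vertical, every
  \<open>(u, 1)\<close> points into \<open>D\<close>, so the integral on the right extends over all
  \<open>u\<close> and its weight depends on neither \<open>x\<close> nor \<open>D\<close>. The set
  \<open>C\<close> is a cone, so that membership of \<open>y - x\<close> is a condition on the
  direction.\<close>

lemma kernel_formula:
  fixes T :: "'m pt \<Rightarrow> 'm pt"
  assumes x: "x \<in> R" and T: "orthogonal_transformation T" "T (nv x) = e_vec" "\<And>z. T (T z) = z"
    and C: "C \<in> sets borel" "\<And>s z. 0 < s \<Longrightarrow> s *\<^sub>R z \<in> C \<longleftrightarrow> z \<in> C"
  shows "(\<integral>\<^sup>+y. ennreal (kernel x y) * indicator C (y - x) \<partial>hausdorff_surface) =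
    (\<integral>\<^sup>+u. ennreal (1 / norm (u, 1::real) ^ (CARD('m) + 2)) * indicator C (T (u, 1)) \<partial>hausdorff_measure CARD('m))"
proof -
  have linT: "linear T" using T(1) by (rule orthogonal_transformation_linear)
  have normT: "norm (T z) = norm z" for z using T(1) by (rule orthogonal_transformation_norm)
  have Tinner: "T a \<bullet> T b = a \<bullet> b" for a b using T(1) unfolding orthogonal_transformation_def by metis
  have sndT: "snd (T z) = nv x \<bullet> z" for z
    using Tinner[of "nv x" z] by (simp add: T(2) inner_e_vec)
  define q where "q u = ennreal (1 / norm (u, 1::real) ^ (CARD('m) + 2)) * indicator C (T (u, 1))" for u :: "real ^ 'm"
  have contTu: "continuous_on UNIV (\<lambda>u :: real ^ 'm. T (u, 1))"
    by (intro continuous_intros continuous_on_compose2[OF continuous_on_orthogonal[OF T(1), of UNIV]]) auto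
  have "(\<lambda>u :: real ^ 'm. T (u, 1)) -` C \<in> sets borel" by (rule continuous_vimage_borel[OF contTu C(1)])
  then have "(indicator ((\<lambda>u :: real ^ 'm. T (u, 1)) -` C) :: _ \<Rightarrow> ennreal) \<in> borel_measurable borel"
    by (rule borel_measurable_indicator)
  also have "indicator ((\<lambda>u :: real ^ 'm. T (u, 1)) -` C) = (\<lambda>u. indicator C (T (u, 1)) :: ennreal)"
    by (auto simp: indicator_def fun_eq_iff)
  finally have [measurable]: "(\<lambda>u :: real ^ 'm. indicator C (T (u, 1)) :: ennreal) \<in> borel_measurable borel" .
  have [measurable]: "(\<lambda>u :: real ^ 'm. norm (u, 1::real)) \<in> borel_measurable borel"
    by (intro borel_measurable_continuous_onI continuous_intros)
  have q: "q \<in> borel_measurable borel" unfolding q_def[abs_def] by measurable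
  define S where "S = {y \<in> R. 0 < snd (T (y - x)) \<and> visible D x y}"
  have "ennreal (kernel x y) * indicator C (y - x) =
      q (slope T x y) * ennreal (\<bar>nv y \<bullet> (y - x)\<bar> / snd (T (y - x)) ^ (CARD('m) + 1)) * indicator S y" for y
  proof (cases "y \<in> S")
    case True
    define t where "t = snd (T (y - x))"
    have t: "0 < t" "t = nv x \<bullet> (y - x)" and y: "y \<in> R" "visible D x y" using True by (auto simp: S_def t_def sndT)
    have dir: "(slope T x y, 1) = inverse t *\<^sub>R T (y - x)" using slope_direction[of T y x] t(1) by (simp add: t_def)
    then have nrm: "norm (slope T x y, 1::real) = norm (y - x) / t" using t(1) by (simp add: normT divide_inverse)
    have "T (slope T x y, 1) = inverse t *\<^sub>R (y - x)" unfolding dir by (simp add: linear_cmul[OF linT] T(3))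
    then have ind: "indicator C (T (slope T x y, 1)) = (indicator C (y - x) :: ennreal)"
      using C(2)[of "inverse t" "y - x"] t(1) by (simp add: indicator_def)
    have ne: "norm (y - x) \<noteq> 0" using y(2) by (auto simp: visible_def)
    have "kernel x y = t * \<bar>nv y \<bullet> (y - x)\<bar> / norm (y - x) ^ (CARD('m) + 2)"
      using x y t by (simp add: kernel_def)
    also have "\<dots> = (1 / (norm (y - x) / t) ^ (CARD('m) + 2)) * (\<bar>nv y \<bullet> (y - x)\<bar> / t ^ (CARD('m) + 1))"
      using t(1) ne by (simp add: power_divide field_simps)
    finally have "ennreal (kernel x y) = ennreal (1 / norm (slope T x y, 1::real) ^ (CARD('m) + 2)) *
        ennreal (\<bar>nv y \<bullet> (y - x)\<bar> / t ^ (CARD('m) + 1))"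
      unfolding nrm using t(1) by (subst ennreal_mult'[symmetric]) auto
    then show ?thesis using True by (simp add: q_def ind t_def[symmetric] mult_ac)
  next
    case False
    \<comment> \<open>A visible \<open>y\<close> off \<open>S\<close> lies in the tangential
      direction, where the cosine at \<open>x\<close> vanishes.\<close>
    have "kernel x y = 0"
    proof (cases "y \<in> R \<and> visible D x y")
      case True
      then have "nv x \<bullet> (y - x) = 0" using False normal_nonneg_visible[OF x, of y] by (auto simp: S_def sndT)
      then show ?thesis by (simp add: kernel_def)
    qed (auto simp: kernel_def)
    then show ?thesis using False by simp
  qed
  then have "(\<integral>\<^sup>+y. ennreal (kernel x y) * indicator C (y - x) \<partial>hausdorff_surface) =
      (\<integral>\<^sup>+u\<in>{u. enters D x (T (u, 1))}. q u \<partial>hausdorff_measure CARD('m))"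
    using radial_formula[OF T(1,3) q, of x] by (simp add: S_def)
  also have "{u. enters D x (T (u, 1))} = UNIV"
  proof -
    have "nv x \<bullet> T (u, 1) > 0" for u
      using Tinner[of "nv x" "T (u, 1)"] by (simp add: T(2,3) inner_e_vec)
    then show ?thesis using normal_enters[OF x] by auto
  qed
  finally show ?thesis by (simp add: q_def)
qed

lemma reflection_to_e_vec:
  assumes "x \<in> R"
  obtains T :: "'m pt \<Rightarrow> 'm pt" where "orthogonal_transformation T" "T (nv x) = e_vec" "\<And>z. T (T z) = z"
  using orthogonal_reflection_exists[OF normal(1)[OF assms] norm_e_vec] by metis

lemma kernel_total:
  assumes "x \<in> R"
  shows "(\<integral>\<^sup>+y. ennreal (kernel x y) \<partial>hausdorff_surface) =
    (\<integral>\<^sup>+u. ennreal (1 / norm (u :: real ^ 'm, 1::real) ^ (CARD('m) + 2)) \<partial>hausdorff_measure CARD('m))"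
proof -
  obtain T :: "'m pt \<Rightarrow> 'm pt" where T: "orthogonal_transformation T" "T (nv x) = e_vec" "\<And>z. T (T z) = z"
    using reflection_to_e_vec[OF assms] by metis
  show ?thesis using kernel_formula[OF assms T, of UNIV] by simp
qed

text \<open>Seen from \<open>x\<close>, the horizontal directions satisfy one affine equation in
  \<open>u\<close>, which defines a hyperplane or the empty set. This disposes of the chords that no
  direction \<open>(u, 1)\<close> describes.\<close>

lemma kernel_horizontal:
  assumes "x \<in> R"
  shows "(\<integral>\<^sup>+y. ennreal (kernel x y) * indicator {y. snd y = snd x} y \<partial>hausdorff_surface) = 0"
proof -
  obtain T :: "'m pt \<Rightarrow> 'm pt" where T: "orthogonal_transformation T" "T (nv x) = e_vec" "\<And>z. T (T z) = z"
    using reflection_to_e_vec[OF assms] by metis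
  have Tinner: "T a \<bullet> T b = a \<bullet> b" for a b using T(1) unfolding orthogonal_transformation_def by metis
  have linT: "linear T" using T(1) by (rule orthogonal_transformation_linear)
  define C where "C = {z :: 'm pt. snd z = 0}"
  have "closed C" unfolding C_def by (intro closed_Collect_eq continuous_intros)
  then have Cb: "C \<in> sets borel" by simp
  have ind: "indicator {y. snd y = snd x} y = (indicator C (y - x) :: ennreal)" for y
    by (auto simp: C_def indicator_def)
  define N where "N = {u :: real ^ 'm. T (u, 1) \<in> C}"
  obtain a c where ac: "T e_vec = (a, c)" by (cases "T e_vec") auto
  have sndT: "snd (T (u, 1)) = a \<bullet> u + c" for u
  proof -
    have "snd (T (u, 1)) = T e_vec \<bullet> T (T (u, 1))" by (simp only: Tinner inner_e_vec)
    then show ?thesis by (simp add: T(3) ac)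
  qed
  have N: "N = {u. a \<bullet> u = - c}" by (auto simp: N_def C_def sndT)
  have "negligible N"
  proof (cases "a = 0")
    case True
    have "c \<noteq> 0"
    proof
      assume "c = 0"
      then have "T e_vec = 0" using ac True by (simp add: prod_eq_iff)
      then have "e_vec = (0 :: 'm pt)" using T(3)[of e_vec] linear_0[OF linT] by simp
      then show False by (simp add: e_vec_def prod_eq_iff)
    qed
    then show ?thesis using True by (simp add: N)
  qed (simp add: N negligible_hyperplane)
  then have "N \<in> null_sets lborel"
    unfolding N by (simp add: negligible_iff_null_sets null_sets_completion_iff)
  then have Nn: "N \<in> null_sets (hausdorff_measure CARD('m))" by (simp add: null_sets_hausdorff_iff_lborel)
  have "(\<integral>\<^sup>+y. ennreal (kernel x y) * indicator {y. snd y = snd x} y \<partial>hausdorff_surface) =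
      (\<integral>\<^sup>+u. ennreal (1 / norm (u, 1::real) ^ (CARD('m) + 2)) * indicator C (T (u, 1)) \<partial>hausdorff_measure CARD('m))"
    unfolding ind by (rule kernel_formula[OF assms T Cb]) (simp add: C_def)
  also have "\<dots> = (\<integral>\<^sup>+u. 0 \<partial>(hausdorff_measure CARD('m) :: (real ^ 'm) measure))"
    by (intro nn_integral_cong_AE AE_I'[OF Nn]) (auto simp: N_def indicator_def)
  finally show ?thesis by simp
qed

end

section \<open>Integration over lines\<close>

definition line_point :: "real ^ 'm::finite \<Rightarrow> real ^ 'm \<Rightarrow> real \<Rightarrow> 'm pt" where
  "line_point u v s = (v + s *\<^sub>R u, s)"

lemma line_point_hproj: "x + s *\<^sub>R (u, 1) = line_point u (hproj u x) (snd x + s)"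
  by (simp add: line_point_def hproj_def prod_eq_iff algebra_simps)

lemma line_point_self [simp]: "line_point u (hproj u x) (snd x) = x"
  by (simp add: line_point_def hproj_def prod_eq_iff)

lemma line_point_eq: "line_point u v s = (v, 0) + s *\<^sub>R (u, 1)"
  by (simp add: line_point_def)

lemma line_point_convex:
  assumes E: "convex E" and st: "line_point u v s \<in> E" "line_point u v t \<in> E" "s \<le> r" "r \<le> t"
  shows "line_point u v r \<in> E"
proof (cases "s = t")
  case False
  define \<theta> where "\<theta> = (r - s) / (t - s)"
  have "\<theta> * (t - s) = r - s" using False by (simp add: \<theta>_def)
  then have "r = (1 - \<theta>) * s + \<theta> * t" by (simp add: algebra_simps)
  moreover have "0 \<le> \<theta>" "\<theta> \<le> 1" using False st(3,4) by (auto simp: \<theta>_def)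
  ultimately have \<theta>: "0 \<le> \<theta>" "\<theta> \<le> 1" "r = (1 - \<theta>) * s + \<theta> * t" by simp_all
  have "(1 - \<theta>) *\<^sub>R line_point u v s + \<theta> *\<^sub>R line_point u v t \<in> E"
    using convexD_alt[OF E st(1,2) \<theta>(1,2)] .
  moreover have "(1 - \<theta>) *\<^sub>R line_point u v s + \<theta> *\<^sub>R line_point u v t = line_point u v r"
    unfolding line_point_def by (simp add: \<theta>(3) algebra_simps)
  ultimately show ?thesis by simp
qed (use st in simp)

text \<open>Its expectation over the random chord of a larger domain is the unnormalised law of the
  induced chord, tested against \<open>F\<close>; the default 0 encodes the restriction to the event
  that \<open>E\<close> is hit.\<close>

definition chord_value :: "'m::finite pt set \<Rightarrow> ('m pt \<times> 'm pt \<Rightarrow> ennreal) \<Rightarrow> 'm pt \<times> 'm pt \<Rightarrow> ennreal" where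
  "chord_value E F p = (if closed_segment (fst p) (snd p) \<inter> E \<noteq> {}
     then F (entry_point E (fst p) (snd p), exit_point E (fst p) (snd p)) else 0)"

lemma closed_segment_meets_iff: "closed_segment x y \<inter> E \<noteq> {} \<longleftrightarrow> segment_times E x y \<noteq> {}"
proof -
  have "(1 - t) *\<^sub>R x + t *\<^sub>R y = x + t *\<^sub>R (y - x)" for t by (simp add: algebra_simps)
  then show ?thesis by (force simp: segment_times_def closed_segment_image_interval)
qed

lemma segment_times_bdd: "bdd_below (segment_times E x y)" "bdd_above (segment_times E x y)"
  by (auto simp: segment_times_def intro: bdd_belowI[of _ 0] bdd_aboveI[of _ 1])

section \<open>Measurability and location of the end points\<close>

lemma open_segment_times:
  fixes E :: "'m::finite pt set"
  assumes "open E"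
  shows "open {p. \<exists>t\<in>segment_times E (fst p) (snd p). P t}"
proof -
  have "{p. \<exists>t\<in>segment_times E (fst p) (snd p). P t} =
      (\<Union>t\<in>{t \<in> {0..1}. P t}. (\<lambda>p. fst p + t *\<^sub>R (snd p - fst p)) -` E)"
    by (auto simp: segment_times_def)
  also have "open \<dots>" using assms by (intro open_UN ballI open_vimage continuous_intros)
  finally show ?thesis .
qed

lemma endpoints_measurable:
  fixes E :: "'m::finite pt set"
  assumes E: "open E"
  shows "{p. segment_times E (fst p) (snd p) \<noteq> {}} \<in> sets borel"
    and "(\<lambda>p. (entry_point E (fst p) (snd p), exit_point E (fst p) (snd p))) \<in> borel_measurable borel"
proof -
  define T where "T p = segment_times E (fst p) (snd p)" for p :: "'m pt \<times> 'm pt"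
  define A where "A = {p. T p \<noteq> {}}"
  have "A = {p. \<exists>t\<in>segment_times E (fst p) (snd p). True}" by (auto simp: A_def T_def)
  then have A [measurable]: "A \<in> sets borel" using open_segment_times[OF E, of "\<lambda>_. True"] by simp
  then show "{p. segment_times E (fst p) (snd p) \<noteq> {}} \<in> sets borel" by (simp add: A_def T_def)
  define a where "a p = Inf (T p)" for p
  define b where "b p = Sup (T p)" for p
  have [measurable]: "a \<in> borel_measurable borel"
    unfolding borel_measurable_iff_less
  proof
    fix c :: real
    \<comment> \<open>Off \<open>A\<close> the infimum is that of the empty set, an unspecified but
      fixed real number, so it contributes a set that is empty or the complement of
      \<open>A\<close>.\<close>
    have "a p < c \<longleftrightarrow> (\<exists>t\<in>T p. t < c) \<or> (p \<notin> A \<and> Inf {} < c)" for p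
      using cInf_less_iff[OF _ segment_times_bdd(1), of E "fst p" "snd p" c]
      by (cases "T p = {}") (simp_all add: a_def A_def T_def)
    then have "{p. a p < c} = {p. \<exists>t\<in>segment_times E (fst p) (snd p). t < c} \<union> {p. p \<notin> A \<and> Inf {} < c}"
      by (simp add: T_def Collect_disj_eq)
    moreover have "{p. \<exists>t\<in>segment_times E (fst p) (snd p). t < c} \<in> sets borel"
      using open_segment_times[OF E] by simp
    moreover have "{p. p \<notin> A \<and> Inf {} < c} \<in> sets borel" by measurable
    ultimately show "{p \<in> space borel. a p < c} \<in> sets borel" by simp
  qed
  have [measurable]: "b \<in> borel_measurable borel"
    unfolding borel_measurable_iff_greater
  proof
    fix c :: real
    have "c < b p \<longleftrightarrow> (\<exists>t\<in>T p. c < t) \<or> (p \<notin> A \<and> c < Sup {})" for p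
      using less_cSup_iff[OF _ segment_times_bdd(2), of E "fst p" "snd p" c]
      by (cases "T p = {}") (simp_all add: b_def A_def T_def)
    then have "{p. c < b p} = {p. \<exists>t\<in>segment_times E (fst p) (snd p). c < t} \<union> {p. p \<notin> A \<and> c < Sup {}}"
      by (simp add: T_def Collect_disj_eq)
    moreover have "{p. \<exists>t\<in>segment_times E (fst p) (snd p). c < t} \<in> sets borel"
      using open_segment_times[OF E] by simp
    moreover have "{p. p \<notin> A \<and> c < Sup {}} \<in> sets borel" by measurable
    ultimately show "{p \<in> space borel. c < b p} \<in> sets borel" by simp
  qed
  have [measurable]: "(fst :: 'm pt \<times> 'm pt \<Rightarrow> _) \<in> borel_measurable borel" "(snd :: 'm pt \<times> 'm pt \<Rightarrow> _) \<in> borel_measurable borel"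
    by (intro borel_measurable_continuous_onI continuous_intros)+
  have "(\<lambda>p. (fst p + a p *\<^sub>R (snd p - fst p), fst p + b p *\<^sub>R (snd p - fst p))) \<in> borel_measurable borel"
    by (intro borel_measurable_Pair) measurable
  then show "(\<lambda>p. (entry_point E (fst p) (snd p), exit_point E (fst p) (snd p))) \<in> borel_measurable borel"
    by (simp add: a_def b_def T_def entry_point_def exit_point_def)
qed

lemma chord_value_measurable:
  fixes E :: "'m::finite pt set"
  assumes E: "open E" and F: "F \<in> borel_measurable borel"
  shows "chord_value E F \<in> borel_measurable borel"
proof -
  define A where "A = {p :: 'm pt \<times> 'm pt. segment_times E (fst p) (snd p) \<noteq> {}}"
  define f where "f p = (entry_point E (fst p) (snd p), exit_point E (fst p) (snd p))" for p :: "'m pt \<times> 'm pt"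
  have [measurable]: "A \<in> sets borel" unfolding A_def by (rule endpoints_measurable[OF E])
  have [measurable]: "(\<lambda>p. F (f p)) \<in> borel_measurable borel"
    unfolding f_def by (rule measurable_compose[OF endpoints_measurable(2)[OF E] F])
  have "chord_value E F = (\<lambda>p. if p \<in> A then F (f p) else 0)"
    by (simp add: chord_value_def closed_segment_meets_iff A_def f_def fun_eq_iff)
  then show ?thesis by simp
qed

text \<open>Entry and exit depend on the line alone once the segment covers all of its intersection
  with \<open>E\<close>: the affine reparametrisation \<open>f\<close> is increasing and continuous,
  so it commutes with \<open>Inf\<close> and \<open>Sup\<close>. Applied both to a chord of
  \<open>D\<close> and to a long segment on the same line, it identifies the two induced
  chords.\<close>

lemma entry_exit_on_line:
  assumes S: "S = {s. p + s *\<^sub>R w \<in> E}" "S \<noteq> {}" "S \<subseteq> {\<alpha>..\<beta>}" and ab: "\<alpha> < \<beta>"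
    and xy: "x = p + \<alpha> *\<^sub>R w" "y = p + \<beta> *\<^sub>R w"
  shows "segment_times E x y \<noteq> {}" "entry_point E x y = p + Inf S *\<^sub>R w" "exit_point E x y = p + Sup S *\<^sub>R w"
proof -
  define f where "f s = (s - \<alpha>) / (\<beta> - \<alpha>)" for s
  have f: "\<alpha> + f s * (\<beta> - \<alpha>) = s" for s using ab by (simp add: f_def)
  have pt: "x + t *\<^sub>R (y - x) = p + (\<alpha> + t * (\<beta> - \<alpha>)) *\<^sub>R w" for t
    by (simp add: xy algebra_simps)
  have T: "segment_times E x y = f ` S"
  proof (intro equalityI subsetI)
    fix t assume t: "t \<in> segment_times E x y"
    define s where "s = \<alpha> + t * (\<beta> - \<alpha>)"
    have "f s = t" using ab by (simp add: f_def s_def)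
    moreover have "s \<in> S" using t by (simp add: S(1) segment_times_def pt s_def)
    ultimately show "t \<in> f ` S" by blast
  next
    fix t assume "t \<in> f ` S"
    then obtain s where s: "s \<in> S" "t = f s" by blast
    then have "\<alpha> \<le> s" "s \<le> \<beta>" using S(3) by auto
    then have "t \<in> {0..1}" using ab by (simp add: s(2) f_def field_simps)
    moreover have "x + t *\<^sub>R (y - x) \<in> E" unfolding pt using s(1) by (simp add: s(2) f S(1))
    ultimately show "t \<in> segment_times E x y" by (simp add: segment_times_def)
  qed
  then show "segment_times E x y \<noteq> {}" using S(2) by simp
  have bdd: "bdd_below S" "bdd_above S" using S(3) by (meson bdd_below_Icc bdd_above_Icc bdd_below_mono bdd_above_mono)+
  have mono: "mono f" using ab by (auto simp: f_def mono_def divide_right_mono)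
  have "isCont f a" for a unfolding f_def using ab by (intro continuous_intros) auto
  then have cont: "continuous (at a within X) f" for a X by (rule continuous_at_imp_continuous_at_within)
  have "Inf (segment_times E x y) = f (Inf S)" "Sup (segment_times E x y) = f (Sup S)"
    unfolding T using continuous_at_Inf_mono[OF mono cont S(2) bdd(1)] continuous_at_Sup_mono[OF mono cont S(2) bdd(2)] by simp_all
  then show "entry_point E x y = p + Inf S *\<^sub>R w" "exit_point E x y = p + Sup S *\<^sub>R w"
    by (simp_all add: entry_point_def exit_point_def pt f)
qed

text \<open>The reversal \<open>1 - t\<close> exchanges \<open>Inf\<close> and \<open>Sup\<close>,
  hence entry and exit.\<close>

lemma chord_value_swap: "chord_value E F (y, x) = chord_value E (F \<circ> prod.swap) (x, y)"
proof (cases "segment_times E x y = {}")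
  case False
  define T where "T = segment_times E x y"
  have TT: "segment_times E y x = (\<lambda>t. 1 - t) ` T"
  proof (intro equalityI subsetI)
    have *: "y + t *\<^sub>R (x - y) = x + (1 - t) *\<^sub>R (y - x)" for t by (simp add: algebra_simps)
    fix t
    { assume "t \<in> segment_times E y x"
      then have "1 - t \<in> T" by (simp add: T_def segment_times_def *)
      then show "t \<in> (\<lambda>t. 1 - t) ` T" by (intro image_eqI[of _ _ "1 - t"]) auto }
    { assume "t \<in> (\<lambda>t. 1 - t) ` T"
      then show "t \<in> segment_times E y x" by (auto simp: T_def segment_times_def *) }
  qed
  have am: "antimono (\<lambda>t::real. 1 - t)" by (auto simp: antimono_def)
  have cont: "continuous (at a within X) (\<lambda>t::real. 1 - t)" for a X by (intro continuous_intros)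
  have "T \<noteq> {}" "bdd_below T" "bdd_above T" using False segment_times_bdd[of E x y] by (simp_all add: T_def)
  then have IS: "Inf (segment_times E y x) = 1 - Sup T" "Sup (segment_times E y x) = 1 - Inf T"
    unfolding TT using continuous_at_Sup_antimono[OF am cont] continuous_at_Inf_antimono[OF am cont] by simp_all
  have "entry_point E y x = exit_point E x y" "exit_point E y x = entry_point E x y"
    unfolding entry_point_def exit_point_def IS T_def by (simp_all add: algebra_simps)
  then show ?thesis by (simp add: chord_value_def closed_segment_commute)
next
  case True
  then have "closed_segment x y \<inter> E = {}" using closed_segment_meets_iff by blast
  then show ?thesis by (simp add: chord_value_def closed_segment_commute)
qed

text \<open>The integral of \<open>F\<close> over the upward oriented lines through
  \<open>E\<close>, against the invariant measure on lines. Each line is represented by its part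
  between heights \<open>- K\<close> and \<open>K\<close>, so no trace of a surrounding domain is
  left.\<close>

definition line_integral :: "'m::finite pt set \<Rightarrow> real \<Rightarrow> ('m pt \<times> 'm pt \<Rightarrow> ennreal) \<Rightarrow> ennreal" where
  "line_integral E K F = (\<integral>\<^sup>+u. ennreal (1 / norm (u :: real ^ 'm, 1::real) ^ (CARD('m) + 2)) *
     (\<integral>\<^sup>+v. chord_value E F (line_point u v (- K), line_point u v K) \<partial>hausdorff_measure CARD('m)) \<partial>hausdorff_measure CARD('m))"

lemma sets_boundary_measure [simp, measurable_cong]: "sets (boundary_measure D) = sets borel"
  by (simp add: boundary_measure_def)

lemma space_boundary_measure [simp]: "space (boundary_measure D) = UNIV"
  by (simp add: boundary_measure_def)

lemma nn_integral_boundary_measure: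
  assumes [measurable]: "f \<in> borel_measurable borel"
  shows "(\<integral>\<^sup>+x. f x \<partial>boundary_measure D) = (\<integral>\<^sup>+x\<in>frontier D. f x \<partial>hausdorff_surface)"
proof -
  have [measurable]: "frontier D \<in> sets borel" by (intro borel_closed frontier_closed)
  show ?thesis unfolding boundary_measure_def by (subst nn_integral_density) (auto simp: mult.commute)
qed

section \<open>Chords of \<open>D\<close> that meet a convex subset\<close>

context regular_domain
begin

lemma finite_boundary_measure: "finite_measure (boundary_measure D)"
proof
  have "emeasure (boundary_measure D) UNIV = emeasure hausdorff_surface (frontier D)"
    unfolding boundary_measure_def by (subst emeasure_density) auto
  also have "\<dots> < \<infinity>"
    using hausdorff_outer_frontier_finite[OF open_D bounded_D cone_D] by (simp add: emeasure_hausdorff_measure)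
  finally show "emeasure (boundary_measure D) (space (boundary_measure D)) \<noteq> \<infinity>" by simp
qed

lemma sigma_finite_boundary_measure: "sigma_finite_measure (boundary_measure D)"
  using finite_boundary_measure by (rule finite_measure.sigma_finite_measure)

lemma notin_D: "x \<in> R \<Longrightarrow> x \<notin> D"
  using R_sub frontier_not_in_open[OF open_D] by blast

text \<open>The end points of the chord are not in \<open>E\<close>. By convexity all of
  \<open>E\<close> on the line then lies between them as soon as some point of the chord is in
  \<open>E\<close>, so the chord and the long segment induce the same chord on
  \<open>E\<close>.\<close>

lemma chord_value_line:
  assumes E: "convex E" "E \<subseteq> D" and K: "\<And>z. z \<in> E \<Longrightarrow> \<bar>snd z\<bar> < K" "0 < K"
    and xy: "x \<in> R" "y \<in> R" "visible D x y" "0 < snd (y - x)"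
  defines "u \<equiv> slope (\<lambda>z. z) x y"
  shows "chord_value E F (x, y) =
    (if reaches D E x (u, 1) then chord_value E F (line_point u (hproj u x) (- K), line_point u (hproj u x) K) else 0)"
proof -
  define \<tau> where "\<tau> = snd (y - x)"
  define v where "v = hproj u x"
  define S where "S = {s. (v, 0) + s *\<^sub>R (u, 1) \<in> E}"
  have \<tau>: "0 < \<tau>" using xy by (simp add: \<tau>_def)
  have w: "(u, 1) = inverse \<tau> *\<^sub>R (y - x)"
    using slope_direction[of "\<lambda>z. z" y x] xy(4) by (simp add: u_def \<tau>_def)
  have pt: "x + s *\<^sub>R (u, 1) = line_point u v (snd x + s)" for s
    unfolding v_def by (rule line_point_hproj)
  have x: "x = line_point u v (snd x)" by (simp add: v_def)
  have yw: "y = x + \<tau> *\<^sub>R (u, 1)" using \<tau> by (simp add: w)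
  have "snd x + \<tau> = snd y" by (simp add: \<tau>_def)
  then have y: "y = line_point u v (snd y)" using pt[of \<tau>] yw by metis
  have notE: "x \<notin> E" "y \<notin> E" using notin_D xy(1,2) E(2) by blast+
  show ?thesis
  proof (cases "reaches D E x (u, 1)")
    case True
    then obtain s1 where s1: "0 < s1" "clear D x (u, 1) s1" "x + s1 *\<^sub>R (u, 1) \<in> E" by (auto simp: reaches_def)
    have "s1 < \<tau>"
    proof (rule ccontr)
      assume "\<not> s1 < \<tau>"
      then have "x + \<tau> *\<^sub>R (u, 1) \<in> D" using s1(2) \<tau> by (simp add: clear_def)
      then have "y \<in> D" by (simp only: yw)
      then show False using notin_D xy by blast
    qed
    have s1S: "line_point u v (snd x + s1) \<in> E" using s1(3) pt by simp
    have SE: "s \<in> S \<longleftrightarrow> line_point u v s \<in> E" for s by (simp add: S_def line_point_eq)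
    have Sne: "S \<noteq> {}" using s1S SE by blast
    have Ssub: "S \<subseteq> {snd x..snd y}"
    proof
      fix s assume s: "s \<in> S"
      have "\<not> s < snd x"
      proof
        assume "s < snd x"
        then have "line_point u v (snd x) \<in> E"
          using line_point_convex[OF E(1) SE[THEN iffD1, OF s] s1S, of "snd x"] s1(1) by simp
        then show False using x notE(1) by metis
      qed
      moreover have "\<not> snd y < s"
      proof
        assume "snd y < s"
        then have "line_point u v (snd y) \<in> E"
          using line_point_convex[OF E(1) s1S SE[THEN iffD1, OF s], of "snd y"] \<open>s1 < \<tau>\<close> by (simp add: \<tau>_def)
        then show False using y notE(2) by metis
      qed
      ultimately show "s \<in> {snd x..snd y}" by simp
    qed
    have SK: "S \<subseteq> {- K..K}"
    proof
      fix s assume "s \<in> S"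
      then have "\<bar>snd (line_point u v s)\<bar> < K" using K(1) SE by blast
      then show "s \<in> {- K..K}" by (auto simp: line_point_def)
    qed
    have xy': "x = (v, 0) + snd x *\<^sub>R (u, 1)" "y = (v, 0) + snd y *\<^sub>R (u, 1)" "snd x < snd y"
      using x y xy(4) unfolding line_point_eq by simp_all
    have "- K < K" using K(2) by simp
    note 1 = entry_exit_on_line[OF S_def Sne Ssub xy'(3,1,2)]
    note 2 = entry_exit_on_line[OF S_def Sne SK \<open>- K < K\<close> line_point_eq line_point_eq]
    show ?thesis using True 1 2 by (simp add: chord_value_def closed_segment_meets_iff v_def)
  next
    case False
    have "segment_times E x y = {}"
    proof (rule ccontr)
      assume "segment_times E x y \<noteq> {}"
      then obtain t where t: "0 \<le> t" "t \<le> 1" "x + t *\<^sub>R (y - x) \<in> E" by (auto simp: segment_times_def)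
      have "t \<noteq> 0" "t \<noteq> 1" using t(3) notE by auto
      then have t': "0 < t" "t < 1" using t by auto
      have yx: "y - x = \<tau> *\<^sub>R (u, 1)" using yw by simp
      have "clear D x (u, 1) (t * \<tau>)"
        unfolding clear_def
      proof (intro allI impI)
        fix s assume s: "0 < s \<and> s \<le> t * \<tau>"
        have "s / \<tau> \<le> t" using s \<tau> by (simp add: field_simps)
        then have "s / \<tau> < 1" using t'(2) by (rule le_less_trans)
        moreover have "0 < s / \<tau>" using s \<tau> by simp
        ultimately
        have "x + (s / \<tau>) *\<^sub>R (y - x) \<in> D" using xy(3) unfolding visible_iff by blast
        then show "x + s *\<^sub>R (u, 1) \<in> D" using \<tau> by (simp add: yx)
      qed
      moreover have "x + (t * \<tau>) *\<^sub>R (u, 1) \<in> E" using t(3) by (simp add: yx)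
      ultimately have "reaches D E x (u, 1)" unfolding reaches_def using t'(1) \<tau> by (intro exI[of _ "t * \<tau>"]) auto
      then show False using False by blast
    qed
    then show ?thesis using False by (simp add: chord_value_def closed_segment_meets_iff)
  qed
qed

text \<open>Of two such starting points on one line, the upper one would lie between a point of
  \<open>E\<close> reached earlier from the lower one and a point of \<open>E\<close> above itself.
  By convexity it would belong to \<open>E\<close>, hence to \<open>D\<close>.\<close>

lemma reaches_inj_on:
  assumes E: "convex E" "E \<subseteq> D"
  shows "inj_on (hproj u) {x \<in> frontier D. reaches D E x (u, 1)}"
proof (rule inj_onI)
  have le: "snd b \<le> snd a"
    if ab: "a \<in> frontier D" "b \<in> frontier D" "reaches D E a (u, 1)" "reaches D E b (u, 1)" "hproj u a = hproj u b" for a b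
  proof (rule ccontr)
    assume "\<not> snd b \<le> snd a"
    then have t: "0 < snd b - snd a" by simp
    obtain s where s: "0 < s" "clear D a (u, 1) s" "a + s *\<^sub>R (u, 1) \<in> E" using ab(3) by (auto simp: reaches_def)
    obtain r where r: "0 < r" "b + r *\<^sub>R (u, 1) \<in> E" using ab(4) by (auto simp: reaches_def)
    have b: "b = a + (snd b - snd a) *\<^sub>R (u, 1)"
      using line_point_self[of u b] line_point_hproj[of a "snd b - snd a" u] ab(5) by simp
    have "b \<notin> D" using ab(2) frontier_not_in_open[OF open_D] by blast
    then have "s < snd b - snd a" using s(2) t b by (metis clear_def not_less)
    moreover have "line_point u (hproj u b) (snd a + s) \<in> E" using s(3) unfolding line_point_hproj ab(5) .
    moreover have "line_point u (hproj u b) (snd b + r) \<in> E" using r(2) unfolding line_point_hproj .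
    ultimately have "line_point u (hproj u b) (snd b) \<in> E"
      using line_point_convex[OF E(1), of u "hproj u b" "snd a + s" "snd b + r" "snd b"] r(1) by simp
    then have "b \<in> E" by (simp only: line_point_self)
    then show False using \<open>b \<notin> D\<close> E(2) by blast
  qed
  fix a b assume ab: "a \<in> {x \<in> frontier D. reaches D E x (u, 1)}" "b \<in> {x \<in> frontier D. reaches D E x (u, 1)}" "hproj u a = hproj u b"
  then have "snd b \<le> snd a" "snd a \<le> snd b" using le[of a b] le[of b a] by simp_all
  then have "snd a = snd b" by simp
  then show "a = b" using ab(3) line_point_self by metis
qed

text \<open>From a point of \<open>E\<close> on the line one goes backwards until \<open>D\<close>
  is left for the first time; the boundary point found there is the required starting point.\<close>

lemma reaches_image:
  assumes E: "E \<subseteq> D"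
  shows "hproj u ` {x \<in> frontier D. reaches D E x (u, 1)} = {v. \<exists>s. line_point u v s \<in> E}"
proof (intro equalityI subsetI)
  fix v assume "v \<in> hproj u ` {x \<in> frontier D. reaches D E x (u, 1)}"
  then obtain x where x: "reaches D E x (u, 1)" "v = hproj u x" by blast
  then obtain s where "x + s *\<^sub>R (u, 1) \<in> E" by (auto simp: reaches_def)
  then have "line_point u v (snd x + s) \<in> E" using line_point_hproj[of x s u] x(2) by simp
  then show "v \<in> {v. \<exists>s. line_point u v s \<in> E}" by blast
next
  fix v assume "v \<in> {v. \<exists>s. line_point u v s \<in> E}"
  then obtain s where s: "line_point u v s \<in> E" by blast
  define z where "z = line_point u v s"
  have z: "z \<in> E" "z \<in> D" using s E by (auto simp: z_def)
  obtain r where r: "0 < r" "ball z r \<subseteq> D" using open_D z(2) openE by blast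
  have ent: "enters D z (- (u, 1))"
  proof -
    have K: "0 < norm (u, 1::real)" by (simp add: prod_eq_iff)
    have "clear D z (- (u, 1)) (r / (2 * norm (u, 1::real)))"
      unfolding clear_def
    proof (intro allI impI)
      fix t assume t: "0 < t \<and> t \<le> r / (2 * norm (u, 1::real))"
      then have "t * norm (u, 1::real) \<le> r / 2" using K by (simp add: field_simps)
      then have "norm (t *\<^sub>R - (u, 1::real)) < r" using t r(1) by (simp only: norm_scaleR norm_minus_cancel) simp
      moreover have "z + q \<in> D" if "norm q < r" for q
        using that by (intro subsetD[OF r(2)]) (simp add: dist_norm)
      ultimately show "z + t *\<^sub>R - (u, 1) \<in> D" by blast
    qed
    then show ?thesis unfolding enters_def using r(1) K by (intro exI[of _ "r / (2 * norm (u, 1::real))"]) simp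
  qed
  have ne: "- (u, 1::real) \<noteq> 0" by (simp add: prod_eq_iff)
  obtain \<tau> where \<tau>: "0 < \<tau>" "\<And>t. 0 < t \<Longrightarrow> t < \<tau> \<Longrightarrow> z + t *\<^sub>R - (u, 1) \<in> D" "z + \<tau> *\<^sub>R - (u, 1) \<in> frontier D"
    using exit_time[OF open_D bounded_D ent ne] by blast
  define x where "x = z + \<tau> *\<^sub>R - (u, 1)"
  have xz: "x + t *\<^sub>R (u, 1) = z + (\<tau> - t) *\<^sub>R - (u, 1)" for t
    by (simp add: x_def scaleR_diff_left)
  have x\<tau>: "x + \<tau> *\<^sub>R (u, 1) = z" by (simp only: xz diff_self scaleR_zero_left add_0_right)
  have "clear D x (u, 1) \<tau>"
    unfolding clear_def
  proof (intro allI impI)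
    fix t assume t: "0 < t \<and> t \<le> \<tau>"
    show "x + t *\<^sub>R (u, 1) \<in> D"
    proof (cases "t = \<tau>")
      case True
      then show ?thesis using x\<tau> z(2) by simp
    next
      case False
      then show ?thesis unfolding xz using t by (intro \<tau>(2)) auto
    qed
  qed
  moreover have "x + \<tau> *\<^sub>R (u, 1) \<in> E" using x\<tau> z(1) by simp
  ultimately have "reaches D E x (u, 1)" unfolding reaches_def using \<tau>(1) by blast
  moreover have "hproj u x = v"
    by (simp add: x_def z_def line_point_def hproj_def algebra_simps)
  ultimately show "v \<in> hproj u ` {x \<in> frontier D. reaches D E x (u, 1)}" using \<tau>(3) unfolding x_def by blast
qed

end

lemma measurable_compose_continuous:
  assumes "g \<in> borel_measurable borel" "continuous_on UNIV f"
  shows "(\<lambda>x. g (f x)) \<in> borel_measurable borel"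
  using measurable_compose[OF borel_measurable_continuous_onI[OF assms(2)] assms(1)] .

lemma sets_pair_borel:
  fixes M :: "'a::second_countable_topology measure" and N :: "'b::second_countable_topology measure"
  assumes "sets M = sets borel" "sets N = sets borel"
  shows "sets (M \<Otimes>\<^sub>M N) = sets borel"
  using sets_pair_measure_cong[OF assms] by (simp only: borel_prod)

lemma open_line_shadow:
  assumes "open E"
  shows "open {v. \<exists>s. line_point u v s \<in> E}"
proof -
  have "{v. \<exists>s. line_point u v s \<in> E} = (\<Union>s. {v. line_point u v s \<in> E})" by blast
  moreover have "open {v. line_point u v s \<in> E}" for s
    using open_vimage[OF assms, of "\<lambda>v. line_point u v s"] unfolding line_point_def vimage_def
    by (simp add: continuous_intros)
  ultimately show ?thesis by (simp add: open_UN)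
qed

section \<open>From chords to lines\<close>

context regular_domain
begin

lemma kernel_zero: "x \<notin> R \<Longrightarrow> kernel x y = 0" "y \<notin> R \<Longrightarrow> kernel x y = 0"
  by (simp_all add: kernel_def)

text \<open>
  Replace the second endpoint by the direction \<open>u\<close> of the chord, interchange the integrals, and
  then replace the first endpoint by the position \<open>v\<close> of the line in direction \<open>u\<close>.
\<close>

lemma crofton_up:
  assumes E: "open E" "convex E" "E \<subseteq> D" and K: "\<And>z. z \<in> E \<Longrightarrow> \<bar>snd z\<bar> < K" "0 < K"
    and F: "F \<in> borel_measurable borel"
  shows "(\<integral>\<^sup>+x. (\<integral>\<^sup>+y. chord_value E F (x, y) * ennreal (kernel x y) * indicator {y. snd x < snd y} y \<partial>hausdorff_surface)
      \<partial>boundary_measure D) = line_integral E K F"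
proof -
  let ?HN = "hausdorff_measure CARD('m) :: (real ^ 'm) measure"
  define \<Phi> where "\<Phi> p = chord_value E F (line_point (fst p) (snd p) (- K), line_point (fst p) (snd p) K)"
    for p :: "(real ^ 'm) \<times> (real ^ 'm)"
  have \<Phi>m: "\<Phi> \<in> borel_measurable borel"
    unfolding \<Phi>_def line_point_def
    by (intro measurable_compose_continuous[OF chord_value_measurable[OF E(1) F]] continuous_intros)
  define c where "c u = 1 / norm (u, 1::real) ^ (CARD('m) + 2)" for u :: "real ^ 'm"
  have c_nonneg: "0 \<le> c u" for u by (simp add: c_def)
  define A where "A = {p :: 'm pt \<times> (real ^ 'm). reaches D E (fst p) (snd p, 1)}"
  have A [measurable]: "A \<in> sets borel"
  proof -
    have "A = (\<lambda>p. (fst p, (snd p, 1))) -` {p. reaches D E (fst p) (snd p)}" by (simp add: A_def vimage_def)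
    moreover have "continuous_on UNIV (\<lambda>p :: 'm pt \<times> (real ^ 'm). (fst p, (snd p, 1::real)))" by (intro continuous_intros)
    ultimately show ?thesis using continuous_vimage_borel borel_Collect_reaches[OF open_D E(1)] by (simp only:)
  qed
  \<comment> \<open>The cut-off to \<open>R\<close> is what makes \<open>h\<close> Borel: there the
    modulus is continuous, while elsewhere \<open>nv\<close> is a mere description.\<close>
  define h where "h p = indicator R (fst p) * \<bar>nv (fst p) \<bullet> (snd p, 1)\<bar>" for p :: "'m pt \<times> (real ^ 'm)"
  have [measurable]: "h \<in> borel_measurable borel"
  proof -
    have "continuous_on (R \<times> UNIV) (\<lambda>p :: 'm pt \<times> (real ^ 'm). \<bar>nv (fst (fst p, (snd p, 1 :: real))) \<bullet> snd (fst p, (snd p, 1))\<bar>)"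
      by (rule continuous_on_compose2[OF abs_normal_cont]) (auto intro!: continuous_intros)
    then have "continuous_on (R \<times> UNIV) (\<lambda>p :: 'm pt \<times> (real ^ 'm). \<bar>nv (fst p) \<bullet> (snd p, 1)\<bar>)" by simp
    moreover have "R \<times> (UNIV :: (real ^ 'm) set) \<in> sets borel" by (intro borel_Times R_borel) simp
    ultimately have "(\<lambda>p :: 'm pt \<times> (real ^ 'm). indicator (R \<times> UNIV) p *\<^sub>R \<bar>nv (fst p) \<bullet> (snd p, 1)\<bar>) \<in> borel_measurable borel"
      by (intro borel_measurable_continuous_on_indicator)
    also have "(\<lambda>p :: 'm pt \<times> (real ^ 'm). indicator (R \<times> UNIV) p *\<^sub>R \<bar>nv (fst p) \<bullet> (snd p, 1)\<bar>) = h"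
      by (auto simp: h_def fun_eq_iff indicator_def)
    finally show ?thesis .
  qed
  \<comment> \<open>The integrand after \<open>y\<close> has been replaced by \<open>u\<close>: the
    value of the line, the event that it is the chord from \<open>x\<close> which meets
    \<open>E\<close>, the remaining cosine at \<open>x\<close>, and the density of
    directions.\<close>
  define \<psi> where "\<psi> p = \<Phi> (snd p, hproj (snd p) (fst p)) * indicator A p * ennreal (h p * c (snd p))"
    for p :: "'m pt \<times> (real ^ 'm)"
  have \<psi>m [measurable]: "\<psi> \<in> borel_measurable borel"
  proof -
    have [measurable]: "(\<lambda>p :: 'm pt \<times> (real ^ 'm). \<Phi> (snd p, hproj (snd p) (fst p))) \<in> borel_measurable borel"
      unfolding hproj_def by (intro measurable_compose_continuous[OF \<Phi>m] continuous_intros)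
    have [measurable]: "(\<lambda>p :: 'm pt \<times> (real ^ 'm). norm (snd p, 1::real)) \<in> borel_measurable borel"
      by (intro borel_measurable_continuous_onI continuous_intros)
    show ?thesis unfolding \<psi>_def c_def by measurable
  qed
  have inner: "(\<integral>\<^sup>+y. chord_value E F (x, y) * ennreal (kernel x y) * indicator {y. snd x < snd y} y \<partial>hausdorff_surface) =
      (\<integral>\<^sup>+u. \<psi> (x, u) \<partial>?HN)" for x
  proof (cases "x \<in> R")
    case True
    define q where "q u = \<psi> (x, u)" for u
    have q: "q \<in> borel_measurable borel"
      unfolding q_def by (intro measurable_compose_continuous[OF \<psi>m] continuous_intros)
    define S where "S = {y \<in> R. 0 < snd (y - x) \<and> visible D x y}"
    have "chord_value E F (x, y) * ennreal (kernel x y) * indicator {y. snd x < snd y} y =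
      q (slope (\<lambda>z. z) x y) * ennreal (\<bar>nv y \<bullet> (y - x)\<bar> / snd (y - x) ^ (CARD('m) + 1)) * indicator S y" for y
    proof (cases "y \<in> S")
      case yS: True
      then have y: "y \<in> R" "visible D x y" "0 < snd (y - x)" by (auto simp: S_def)
      define u where "u = slope (\<lambda>z. z) x y"
      define \<tau> where "\<tau> = snd (y - x)"
      have w: "(u, 1) = inverse \<tau> *\<^sub>R (y - x)"
        using slope_direction[of "\<lambda>z. z" y x] y(3) by (simp add: u_def \<tau>_def)
      have \<tau>: "0 < \<tau>" using y(3) by (simp add: \<tau>_def)
      have ne: "norm (y - x) \<noteq> 0" using y(2) by (auto simp: visible_def)
      have ind: "indicator {y. snd x < snd y} y = (1 :: ennreal)" using y(3) by simp
      have cv: "chord_value E F (x, y) = \<Phi> (u, hproj u x) * indicator A (x, u)"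
        using chord_value_line[OF E(2,3) K True y, of F] by (simp add: \<Phi>_def A_def u_def)
      \<comment> \<open>The powers of \<tau> balance: \<open>c u\<close> supplies d + 1 of them,
        \<open>h\<close> removes one and the Jacobian of \<open>slope\<close> removes d.\<close>
      have "c u = \<tau> ^ (CARD('m) + 2) / norm (y - x) ^ (CARD('m) + 2)"
        unfolding c_def w using \<tau> by (simp add: power_divide divide_inverse power_mult_distrib power_inverse)
      moreover have "h (x, u) = \<bar>nv x \<bullet> (y - x)\<bar> / \<tau>"
        using True \<tau> by (simp only: h_def fst_conv snd_conv w inner_scaleR_right) (simp add: abs_mult divide_inverse)
      ultimately have "h (x, u) * c u * (\<bar>nv y \<bullet> (y - x)\<bar> / \<tau> ^ (CARD('m) + 1)) = kernel x y"
        using True y(1,2) \<tau> by (simp add: kernel_def)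
      then have "ennreal (kernel x y) = ennreal (h (x, u) * c u) * ennreal (\<bar>nv y \<bullet> (y - x)\<bar> / \<tau> ^ (CARD('m) + 1))"
        using \<tau> by (metis ennreal_mult'' abs_ge_zero divide_nonneg_nonneg less_imp_le zero_le_power)
      then show ?thesis
        using yS unfolding cv ind u_def[symmetric] \<tau>_def[symmetric] q_def \<psi>_def by (simp add: mult_ac)
    next
      case False
      show ?thesis
      proof (cases "snd x < snd y")
        case lt: True
        then have "kernel x y = 0" using False by (auto simp: S_def kernel_def)
        then show ?thesis using False by simp
      qed (use False in simp)
    qed
    then have "(\<integral>\<^sup>+y. chord_value E F (x, y) * ennreal (kernel x y) * indicator {y. snd x < snd y} y \<partial>hausdorff_surface) =
        (\<integral>\<^sup>+u\<in>{u. enters D x (u, 1)}. q u \<partial>?HN)"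
      using radial_formula[OF orthogonal_transformation_id refl q, of x] by (simp add: S_def)
    also have "\<dots> = (\<integral>\<^sup>+u. q u \<partial>?HN)"
    proof (intro nn_integral_cong)
      fix u
      have "reaches D E x (u, 1) \<Longrightarrow> enters D x (u, 1)" by (auto simp: reaches_def enters_def)
      then show "q u * indicator {u. enters D x (u, 1)} u = q u"
        by (auto simp: q_def \<psi>_def A_def indicator_def)
    qed
    finally show ?thesis by (simp add: q_def)
  next
    case False
    then have "\<psi> (x, u) = 0" for u by (simp add: \<psi>_def h_def)
    then show ?thesis using False by (simp add: kernel_zero)
  qed
  interpret BD: sigma_finite_measure "boundary_measure D" by (rule sigma_finite_boundary_measure)
  interpret HN: sigma_finite_measure ?HN using sigma_finite_hausdorff_measure[where 'a = "real ^ 'm"] by simp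
  interpret P: pair_sigma_finite "boundary_measure D" ?HN ..
  have setsP: "sets (boundary_measure D \<Otimes>\<^sub>M ?HN) = sets (borel :: ('m pt \<times> (real ^ 'm)) measure)"
    by (rule sets_pair_borel) simp_all
  have "\<psi> \<in> borel_measurable (boundary_measure D \<Otimes>\<^sub>M ?HN)"
    using \<psi>m by (simp only: measurable_cong_sets[OF setsP refl])
  then have "(\<integral>\<^sup>+x. (\<integral>\<^sup>+u. \<psi> (x, u) \<partial>?HN) \<partial>boundary_measure D) =
      (\<integral>\<^sup>+u. (\<integral>\<^sup>+x. \<psi> (x, u) \<partial>boundary_measure D) \<partial>?HN)"
    by (rule P.Fubini[symmetric])
  also have "\<dots> = (\<integral>\<^sup>+u. ennreal (c u) * (\<integral>\<^sup>+v. \<Phi> (u, v) \<partial>?HN) \<partial>?HN)"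
  proof (intro nn_integral_cong)
    fix u
    define P where "P = {x \<in> frontier D. reaches D E x (u, 1)}"
    define Q where "Q = {v. \<exists>s. line_point u v s \<in> E}"
    define q where "q v = ennreal (c u) * \<Phi> (u, v)" for v
    have \<Phi>u [measurable]: "(\<lambda>v. \<Phi> (u, v)) \<in> borel_measurable borel"
      by (intro measurable_compose_continuous[OF \<Phi>m] continuous_intros)
    have q: "q \<in> borel_measurable borel" unfolding q_def by measurable
    have P: "P \<in> sets borel"
    proof -
      have "P = frontier D \<inter> (\<lambda>x. (x, (u, 1))) -` {p. reaches D E (fst p) (snd p)}" by (auto simp: P_def)
      moreover have "(\<lambda>x. (x, (u, 1))) -` {p. reaches D E (fst p) (snd p)} \<in> sets borel"
        by (intro continuous_vimage_borel borel_Collect_reaches[OF open_D E(1)] continuous_intros)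
      ultimately show ?thesis by simp
    qed
    have Qb: "Q \<in> sets borel" unfolding Q_def using open_line_shadow[OF E(1)] by (rule borel_open)
    have img: "hproj u ` P = Q" unfolding P_def Q_def by (rule reaches_image[OF E(3)])
    have inj: "inj_on (hproj u) P" unfolding P_def by (rule reaches_inj_on[OF E(2,3)])
    have "(\<integral>\<^sup>+x. \<psi> (x, u) \<partial>boundary_measure D) = (\<integral>\<^sup>+x\<in>frontier D. \<psi> (x, u) \<partial>hausdorff_surface)"
      by (intro nn_integral_boundary_measure measurable_compose_continuous[OF \<psi>m] continuous_intros)
    also have "\<dots> = (\<integral>\<^sup>+x\<in>P \<inter> R. q (hproj u x) * ennreal \<bar>nv x \<bullet> (u, 1)\<bar> \<partial>hausdorff_surface)"
    proof (intro nn_integral_cong)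
      fix x
      show "\<psi> (x, u) * indicator (frontier D) x = q (hproj u x) * ennreal \<bar>nv x \<bullet> (u, 1)\<bar> * indicator (P \<inter> R) x"
      proof (cases "x \<in> R \<and> reaches D E x (u, 1)")
        case True
        then have "x \<in> frontier D" "x \<in> P \<inter> R" using R_sub by (auto simp: P_def)
        then show ?thesis using True c_nonneg[of u]
          by (simp add: \<psi>_def A_def h_def q_def ennreal_mult'' mult_ac)
      qed (auto simp: \<psi>_def A_def h_def P_def indicator_def)
    qed
    also have "\<dots> = (\<integral>\<^sup>+v\<in>Q. q v \<partial>?HN)"
      by (rule parallel_formula[OF P _ inj img Qb q]) (auto simp: P_def)
    also have "\<dots> = (\<integral>\<^sup>+v. q v \<partial>?HN)"
    proof (intro nn_integral_cong)
      fix v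
      have "\<Phi> (u, v) = 0" if "v \<notin> Q"
      proof -
        have "closed_segment (line_point u v (- K)) (line_point u v K) \<inter> E = {}"
        proof (rule ccontr)
          assume "\<not> ?thesis"
          then obtain t where t: "(1 - t) *\<^sub>R line_point u v (- K) + t *\<^sub>R line_point u v K \<in> E" by (auto simp: in_segment)
          have "(1 - t) *\<^sub>R line_point u v (- K) + t *\<^sub>R line_point u v K = line_point u v ((1 - t) * (- K) + t * K)"
          proof -
            have "(1 - t) *\<^sub>R (a + r *\<^sub>R w) + t *\<^sub>R (a + s *\<^sub>R w) = a + ((1 - t) * r + t * s) *\<^sub>R w"
              for a w :: "'m pt" and r s by (simp add: algebra_simps)
            then show ?thesis unfolding line_point_eq .
          qed
          then show False using t that by (auto simp: Q_def)
        qed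
        then show ?thesis by (simp add: \<Phi>_def chord_value_def)
      qed
      then show "q v * indicator Q v = q v" by (cases "v \<in> Q") (auto simp: q_def)
    qed
    also have "\<dots> = ennreal (c u) * (\<integral>\<^sup>+v. \<Phi> (u, v) \<partial>?HN)"
      unfolding q_def by (rule nn_integral_cmult) measurable
    finally show "(\<integral>\<^sup>+x. \<psi> (x, u) \<partial>boundary_measure D) = ennreal (c u) * (\<integral>\<^sup>+v. \<Phi> (u, v) \<partial>?HN)" .
  qed
  finally show ?thesis by (simp add: inner line_integral_def c_def \<Phi>_def)
qed

lemma nn_integral_boundary_eq_surface:
  assumes "f \<in> borel_measurable borel" "\<And>y. y \<notin> R \<Longrightarrow> f y = 0"
  shows "(\<integral>\<^sup>+y. f y \<partial>boundary_measure D) = (\<integral>\<^sup>+y. f y \<partial>hausdorff_surface)"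
  unfolding nn_integral_boundary_measure[OF assms(1)]
  using assms(2) R_sub by (intro nn_integral_cong) (auto simp: indicator_def)

text \<open>Rising chords are covered by \<open>crofton_up\<close> and horizontal ones are null.
  Falling chords become rising when the end points are exchanged; the kernel is symmetric, so after
  interchanging the integrals only \<open>F\<close> is replaced by its composition with the
  swap.\<close>

lemma crofton:
  assumes E: "open E" "convex E" "E \<subseteq> D" and K: "\<And>z. z \<in> E \<Longrightarrow> \<bar>snd z\<bar> < K" "0 < K"
    and F: "F \<in> borel_measurable borel"
  shows "(\<integral>\<^sup>+x. (\<integral>\<^sup>+y. chord_value E F (x, y) * ennreal (kernel x y) \<partial>boundary_measure D) \<partial>boundary_measure D) =
    line_integral E K F + line_integral E K (F \<circ> prod.swap)"
proof -
  let ?BD = "boundary_measure D"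
  have swap_cont: "continuous_on UNIV (prod.swap :: 'm pt \<times> 'm pt \<Rightarrow> _)"
    unfolding prod.swap_def by (intro continuous_intros)
  define h where "h p = chord_value E F p * ennreal (kernel (fst p) (snd p))" for p
  have hm [measurable]: "h \<in> borel_measurable borel"
    unfolding h_def using chord_value_measurable[OF E(1) F] kernel_measurable by measurable
  define U where "U = {p :: 'm pt \<times> 'm pt. snd (fst p) < snd (snd p)}"
  define L where "L = {p :: 'm pt \<times> 'm pt. snd (snd p) < snd (fst p)}"
  have "open U" "open L" unfolding U_def L_def by (intro open_Collect_less continuous_intros)+
  then have [measurable]: "U \<in> sets borel" "L \<in> sets borel" by auto
  have slice: "(\<lambda>y. f (x, y)) \<in> borel_measurable borel" if "f \<in> borel_measurable borel" for f :: "'m pt \<times> 'm pt \<Rightarrow> ennreal" and x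
    by (rule measurable_compose_continuous[OF that]) (intro continuous_intros)
  have hU: "(\<lambda>p. h p * indicator U p) \<in> borel_measurable borel" and hL: "(\<lambda>p. h p * indicator L p) \<in> borel_measurable borel"
    by measurable
  have zero: "h (x, y) = 0" if "x \<notin> R \<or> y \<notin> R" for x y
    using that by (auto simp: h_def kernel_zero)
  interpret BD: sigma_finite_measure ?BD by (rule sigma_finite_boundary_measure)
  interpret P: pair_sigma_finite ?BD ?BD ..
  have setsP: "sets (?BD \<Otimes>\<^sub>M ?BD) = sets (borel :: ('m pt \<times> 'm pt) measure)"
    by (rule sets_pair_borel) simp_all
  have meas: "f \<in> borel_measurable (?BD \<Otimes>\<^sub>M ?BD)" if "f \<in> borel_measurable borel" for f :: "'m pt \<times> 'm pt \<Rightarrow> ennreal"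
    using that by (simp only: measurable_cong_sets[OF setsP refl])
  have inner: "(\<integral>\<^sup>+y. h (x, y) \<partial>?BD) = (\<integral>\<^sup>+y. h (x, y) * indicator U (x, y) \<partial>?BD) + (\<integral>\<^sup>+y. h (x, y) * indicator L (x, y) \<partial>?BD)" for x
  proof (cases "x \<in> R")
    case True
    have km: "(\<lambda>y. ennreal (kernel x y)) \<in> borel_measurable borel"
      using measurable_compose_continuous[OF kernel_measurable, of "\<lambda>y. (x, y)"] by (simp add: continuous_intros)
    have "closed {y :: 'm pt. snd y = snd x}" by (intro closed_Collect_eq continuous_intros)
    then have hor: "{y :: 'm pt. snd y = snd x} \<in> sets borel" by simp
    have "AE y in hausdorff_surface. ennreal (kernel x y) * indicator {y. snd y = snd x} y = 0"
      using kernel_horizontal[OF True] km hor by (subst (asm) nn_integral_0_iff_AE) auto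
    then have "AE y in hausdorff_surface. h (x, y) = h (x, y) * indicator U (x, y) + h (x, y) * indicator L (x, y)"
    proof eventually_elim
      case (elim y)
      then show ?case
        by (cases "snd x" "snd y" rule: linorder_cases) (auto simp: U_def L_def h_def indicator_def)
    qed
    then have "(\<integral>\<^sup>+y. h (x, y) \<partial>hausdorff_surface) =
        (\<integral>\<^sup>+y. h (x, y) * indicator U (x, y) + h (x, y) * indicator L (x, y) \<partial>hausdorff_surface)"
      by (rule nn_integral_cong_AE)
    also have "\<dots> = (\<integral>\<^sup>+y. h (x, y) * indicator U (x, y) \<partial>hausdorff_surface) + (\<integral>\<^sup>+y. h (x, y) * indicator L (x, y) \<partial>hausdorff_surface)"
      using slice[OF hU, of x] slice[OF hL, of x] by (intro nn_integral_add) auto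
    finally show ?thesis
      using slice[OF hm, of x] slice[OF hU, of x] slice[OF hL, of x] zero
      by (simp add: nn_integral_boundary_eq_surface)
  qed (simp add: zero)
  have up: "(\<integral>\<^sup>+x. (\<integral>\<^sup>+y. h (x, y) * indicator U (x, y) \<partial>?BD) \<partial>?BD) = line_integral E K F"
  proof -
    have "(\<integral>\<^sup>+y. h (x, y) * indicator U (x, y) \<partial>?BD) =
        (\<integral>\<^sup>+y. chord_value E F (x, y) * ennreal (kernel x y) * indicator {y. snd x < snd y} y \<partial>hausdorff_surface)" for x
    proof -
      have "(\<integral>\<^sup>+y. h (x, y) * indicator U (x, y) \<partial>?BD) = (\<integral>\<^sup>+y. h (x, y) * indicator U (x, y) \<partial>hausdorff_surface)"
        using slice[OF hU, of x] zero by (intro nn_integral_boundary_eq_surface) auto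
      also have "\<dots> = (\<integral>\<^sup>+y. chord_value E F (x, y) * ennreal (kernel x y) * indicator {y. snd x < snd y} y \<partial>hausdorff_surface)"
        by (intro nn_integral_cong) (auto simp: h_def U_def indicator_def)
      finally show ?thesis .
    qed
    then show ?thesis using crofton_up[OF E K F] by simp
  qed
  have down: "(\<integral>\<^sup>+x. (\<integral>\<^sup>+y. h (x, y) * indicator L (x, y) \<partial>?BD) \<partial>?BD) = line_integral E K (F \<circ> prod.swap)"
  proof -
    have F': "F \<circ> prod.swap \<in> borel_measurable borel"
      unfolding comp_def by (rule measurable_compose_continuous[OF F swap_cont])
    have "(\<integral>\<^sup>+x. (\<integral>\<^sup>+y. h (x, y) * indicator L (x, y) \<partial>?BD) \<partial>?BD) = (\<integral>\<^sup>+y. (\<integral>\<^sup>+x. h (x, y) * indicator L (x, y) \<partial>?BD) \<partial>?BD)"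
      using P.Fubini[OF meas[OF hL]] by simp
    also have "\<dots> = (\<integral>\<^sup>+x. (\<integral>\<^sup>+y. chord_value E (F \<circ> prod.swap) (x, y) * ennreal (kernel x y) * indicator {y. snd x < snd y} y \<partial>hausdorff_surface) \<partial>?BD)"
    proof (intro nn_integral_cong)
      fix y
      have "(\<lambda>x. h (x, y) * indicator L (x, y)) \<in> borel_measurable borel"
        by (rule measurable_compose_continuous[OF hL]) (intro continuous_intros)
      then have "(\<integral>\<^sup>+x. h (x, y) * indicator L (x, y) \<partial>?BD) = (\<integral>\<^sup>+x. h (x, y) * indicator L (x, y) \<partial>hausdorff_surface)"
        using zero by (intro nn_integral_boundary_eq_surface) auto
      also have "\<dots> = (\<integral>\<^sup>+x. chord_value E (F \<circ> prod.swap) (y, x) * ennreal (kernel y x) * indicator {x. snd y < snd x} x \<partial>hausdorff_surface)"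
      proof (intro nn_integral_cong)
        fix x
        have "chord_value E F (x, y) = chord_value E (F \<circ> prod.swap) (y, x)" by (rule chord_value_swap)
        then show "h (x, y) * indicator L (x, y) =
            chord_value E (F \<circ> prod.swap) (y, x) * ennreal (kernel y x) * indicator {x. snd y < snd x} x"
          by (simp add: h_def L_def kernel_commute[of x y] indicator_def)
      qed
      finally show "(\<integral>\<^sup>+x. h (x, y) * indicator L (x, y) \<partial>?BD) =
          (\<integral>\<^sup>+x. chord_value E (F \<circ> prod.swap) (y, x) * ennreal (kernel y x) * indicator {x. snd y < snd x} x \<partial>hausdorff_surface)" .
    qed
    also have "\<dots> = line_integral E K (F \<circ> prod.swap)" by (rule crofton_up[OF E K F'])
    finally show ?thesis .
  qed
  have m1: "(\<lambda>x. \<integral>\<^sup>+y. f (x, y) \<partial>?BD) \<in> borel_measurable ?BD" if "f \<in> borel_measurable borel" for f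
    using BD.borel_measurable_nn_integral_fst[OF meas[OF that]] .
  have "(\<integral>\<^sup>+x. (\<integral>\<^sup>+y. h (x, y) \<partial>?BD) \<partial>?BD) =
      (\<integral>\<^sup>+x. (\<integral>\<^sup>+y. h (x, y) * indicator U (x, y) \<partial>?BD) \<partial>?BD) + (\<integral>\<^sup>+x. (\<integral>\<^sup>+y. h (x, y) * indicator L (x, y) \<partial>?BD) \<partial>?BD)"
    unfolding inner by (rule nn_integral_add[OF m1[OF hU] m1[OF hL]])
  then show ?thesis unfolding up down by (simp add: h_def)
qed

end

section \<open>Random chords\<close>

lemma gamma_const_nonneg: "0 \<le> gamma_const TYPE('m::finite)"
  unfolding gamma_const_def set_lebesgue_integral_def
  by (intro iffD2[OF inverse_nonnegative_iff_nonnegative] Bochner_Integration.integral_nonneg)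
    (auto simp: half_sphere_def indicator_def inner_commute)

text \<open>The integral of the cosine over the half sphere in gnomonic coordinates
  \<open>u\<close>: the surface element contributes the power d of \<open>1 / norm (u, 1)\<close>,
  the cosine one more.\<close>

definition chord_mass :: "'m::finite itself \<Rightarrow> ennreal" where
  "chord_mass _ = (\<integral>\<^sup>+u. ennreal (1 / norm (u, 1::real) ^ (CARD('m) + 2)) \<partial>(hausdorff_measure CARD('m) :: (real ^ 'm) measure))"

context regular_domain
begin

lemma sets_boundary_pair: "sets (boundary_measure D \<Otimes>\<^sub>M boundary_measure D) = sets (borel :: ('m pt \<times> 'm pt) measure)"
  by (rule sets_pair_borel) simp_all

lemma emeasure_boundary_UNIV: "emeasure (boundary_measure D) UNIV = ennreal (measure hausdorff_surface (frontier D))"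
proof -
  have "emeasure (boundary_measure D) UNIV = emeasure hausdorff_surface (frontier D)"
    unfolding boundary_measure_def by (subst emeasure_density) auto
  moreover have "emeasure hausdorff_surface (frontier D) \<noteq> \<infinity>"
    using hausdorff_outer_frontier_finite[OF open_D bounded_D cone_D] by (simp add: emeasure_hausdorff_measure)
  ultimately show ?thesis by (simp add: emeasure_eq_ennreal_measure)
qed

lemma AE_boundary_regular: "AE x in boundary_measure D. x \<in> R"
proof (rule AE_I)
  show "emeasure (boundary_measure D) (- R) = 0"
  proof -
    have "emeasure (boundary_measure D) (- R) = emeasure hausdorff_surface (frontier D - R)"
      unfolding boundary_measure_def using R_borel
      by (subst emeasure_density) (auto simp: Diff_eq simp flip: indicator_inter_arith)
    then show ?thesis using R_borel by (simp add: emeasure_hausdorff_measure irregular_null)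
  qed
qed (use R_borel in auto)

lemma kernel_total_boundary:
  "(\<integral>\<^sup>+x. (\<integral>\<^sup>+y. ennreal (kernel x y) \<partial>boundary_measure D) \<partial>boundary_measure D) =
    chord_mass TYPE('m) * ennreal (measure hausdorff_surface (frontier D))"
proof -
  have "(\<integral>\<^sup>+y. ennreal (kernel x y) \<partial>boundary_measure D) = chord_mass TYPE('m)" if "x \<in> R" for x
  proof -
    have "continuous_on UNIV (\<lambda>y :: 'm pt. (x, y))" by (intro continuous_intros)
    from measurable_compose_continuous[OF kernel_measurable this]
    have "(\<lambda>y. ennreal (kernel x y)) \<in> borel_measurable borel" by simp
    then show ?thesis
      using kernel_total[OF that] by (subst nn_integral_boundary_eq_surface) (auto simp: kernel_zero chord_mass_def)
  qed
  then have "(\<integral>\<^sup>+x. (\<integral>\<^sup>+y. ennreal (kernel x y) \<partial>boundary_measure D) \<partial>boundary_measure D) =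
      (\<integral>\<^sup>+x. chord_mass TYPE('m) \<partial>boundary_measure D)"
    using AE_boundary_regular by (intro nn_integral_cong_AE) auto
  then show ?thesis by (simp add: emeasure_boundary_UNIV)
qed

lemma random_chord_integral:
  assumes X: "random_chord M D R X Y" and g: "g \<in> borel_measurable borel"
  shows "(\<integral>\<^sup>+\<omega>. g (X \<omega>, Y \<omega>) \<partial>M) = ennreal (gamma_const TYPE('m) / measure hausdorff_surface (frontier D)) *
    (\<integral>\<^sup>+x. (\<integral>\<^sup>+y. g (x, y) * ennreal (kernel x y) \<partial>boundary_measure D) \<partial>boundary_measure D)"
proof -
  let ?BD = "boundary_measure D"
  let ?c = "gamma_const TYPE('m) / measure hausdorff_surface (frontier D)"
  interpret BD: sigma_finite_measure ?BD by (rule sigma_finite_boundary_measure)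
  have meas: "f \<in> borel_measurable (?BD \<Otimes>\<^sub>M ?BD)" if "f \<in> borel_measurable borel" for f :: "'m pt \<times> 'm pt \<Rightarrow> ennreal"
    using that by (simp only: measurable_cong_sets[OF sets_boundary_pair refl])
  have gk: "(\<lambda>p. g p * ennreal (kernel (fst p) (snd p))) \<in> borel_measurable borel"
    using g kernel_measurable by measurable
  have "0 \<le> ?c" by (rule divide_nonneg_nonneg[OF gamma_const_nonneg measure_nonneg])
  then have dens: "(\<lambda>(x, y). ennreal (K_tilde D R x y / measure hausdorff_surface (frontier D))) p * g p =
      ennreal ?c * (g p * ennreal (kernel (fst p) (snd p)))" for p
  proof -
    have "K_tilde D R (fst p) (snd p) / measure hausdorff_surface (frontier D) = ?c * kernel (fst p) (snd p)"
      by (simp add: K_tilde_eq_kernel)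
    then have "ennreal (K_tilde D R (fst p) (snd p) / measure hausdorff_surface (frontier D)) = ennreal ?c * ennreal (kernel (fst p) (snd p))"
      by (simp only: ennreal_mult'[OF \<open>0 \<le> ?c\<close>])
    then show ?thesis by (simp only: case_prod_beta mult_ac)
  qed
  have "(\<integral>\<^sup>+\<omega>. g (X \<omega>, Y \<omega>) \<partial>M) = (\<integral>\<^sup>+p. ennreal ?c * (g p * ennreal (kernel (fst p) (snd p))) \<partial>(?BD \<Otimes>\<^sub>M ?BD))"
    using distributed_nn_integral[OF X[unfolded random_chord_def] meas[OF g]] unfolding dens by (rule sym)
  also have "\<dots> = ennreal ?c * (\<integral>\<^sup>+p. g p * ennreal (kernel (fst p) (snd p)) \<partial>(?BD \<Otimes>\<^sub>M ?BD))"
    by (rule nn_integral_cmult[OF meas[OF gk]])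
  also have "(\<integral>\<^sup>+p. g p * ennreal (kernel (fst p) (snd p)) \<partial>(?BD \<Otimes>\<^sub>M ?BD)) =
      (\<integral>\<^sup>+x. (\<integral>\<^sup>+y. g (x, y) * ennreal (kernel x y) \<partial>?BD) \<partial>?BD)"
    using BD.nn_integral_fst[OF meas[OF gk]] by simp
  finally show ?thesis .
qed

lemma chord_value_self:
  assumes "x \<in> R" "y \<in> R" "visible D x y"
  shows "chord_value D F (x, y) = F (x, y)"
proof -
  have mem: "x + t *\<^sub>R (y - x) \<in> D \<longleftrightarrow> 0 < t \<and> t < 1" if "0 \<le> t" "t \<le> 1" for t
  proof (cases "0 < t \<and> t < 1")
    case True
    then have "x + t *\<^sub>R (y - x) \<in> open_segment x y"
      using assms(3) by (auto simp: in_segment visible_def algebra_simps intro!: exI[of _ t])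
    then show ?thesis using True assms(3) by (auto simp: visible_def)
  next
    case False
    then have "t = 0 \<or> t = 1" using that by auto
    then show ?thesis using notin_D[OF assms(1)] notin_D[OF assms(2)] by auto
  qed
  have st: "segment_times D x y = {0<..<1}"
    unfolding segment_times_def using mem by (auto simp: set_eq_iff)
  moreover have "{0<..<1::real} \<noteq> {}" by simp
  ultimately have "closed_segment x y \<inter> D \<noteq> {}" by (simp only: closed_segment_meets_iff) simp
  then show ?thesis by (simp add: chord_value_def entry_point_def exit_point_def st)
qed

text \<open>A chord of the convex set \<open>D\<close> induces itself, so this is
  \<open>crofton\<close> with \<open>D\<close> as its own subset. The right-hand side is the one
  that chords of any larger regular domain give for the same convex set.\<close>

lemma crofton_self:
  assumes "convex D" "\<And>z. z \<in> D \<Longrightarrow> \<bar>snd z\<bar> < K" "0 < K" "F \<in> borel_measurable borel"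
  shows "(\<integral>\<^sup>+x. (\<integral>\<^sup>+y. F (x, y) * ennreal (kernel x y) \<partial>boundary_measure D) \<partial>boundary_measure D) =
    line_integral D K F + line_integral D K (F \<circ> prod.swap)"
proof -
  have "F (x, y) * ennreal (kernel x y) = chord_value D F (x, y) * ennreal (kernel x y)" for x y
  proof (cases "x \<in> R \<and> y \<in> R \<and> visible D x y")
    case True
    then show ?thesis by (simp add: chord_value_self)
  next
    case False
    then have "kernel x y = 0" by (auto simp: kernel_def)
    then show ?thesis by simp
  qed
  then show ?thesis using crofton[OF open_D assms(1) order_refl assms(2-4)] by simp
qed

text \<open>The vertical shadow of \<open>D\<close> is a nonempty open set, and it is the image of a
  part of the boundary under a 1-Lipschitz projection; a null boundary would make it null.\<close>

lemma frontier_measure_pos: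
  assumes "D \<noteq> {}"
  shows "0 < measure hausdorff_surface (frontier D)"
proof (rule ccontr)
  assume "\<not> ?thesis"
  then have "measure hausdorff_surface (frontier D) = 0" using measure_nonneg[of hausdorff_surface "frontier D"] by linarith
  moreover have "emeasure hausdorff_surface (frontier D) \<noteq> \<infinity>"
    using hausdorff_outer_frontier_finite[OF open_D bounded_D cone_D] by (simp add: emeasure_hausdorff_measure)
  ultimately have "emeasure hausdorff_surface (frontier D) = 0" by (simp add: emeasure_eq_ennreal_measure)
  then have "hausdorff_outer CARD('m) (frontier D) = 0" by (simp add: emeasure_hausdorff_measure)
  then have "hausdorff_outer CARD('m) {x \<in> frontier D. reaches D D x (0, 1)} = 0"
    by (rule hausdorff_outer_zero_mono) auto
  then have "hausdorff_outer CARD('m) (hproj 0 ` {x \<in> frontier D. reaches D D x (0, 1)}) = 0"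
    by (rule hausdorff_outer_zero_lipschitz_image[where L = 1]) (simp add: hproj_def dist_fst_le)
  then have null: "hausdorff_outer CARD('m) {v. \<exists>s. line_point 0 v s \<in> D} = 0"
    by (simp only: reaches_image[OF order_refl])
  have op: "open {v. \<exists>s. line_point 0 v s \<in> D}" by (rule open_line_shadow[OF open_D])
  then have "{v. \<exists>s. line_point 0 v s \<in> D} \<in> null_sets (hausdorff_measure CARD('m))"
    using null by (simp add: null_sets_def emeasure_hausdorff_measure)
  then have "{v. \<exists>s. line_point 0 v s \<in> D} \<in> null_sets lborel" by (simp only: null_sets_hausdorff_iff_lborel)
  then have "negligible {v. \<exists>s. line_point 0 v s \<in> D}"
    by (simp add: negligible_iff_null_sets null_sets_completionI)
  moreover have "{v. \<exists>s. line_point 0 v s \<in> D} \<noteq> {}"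
  proof -
    obtain z where "z \<in> D" using assms by blast
    then have "line_point 0 (fst z) (snd z) \<in> D" by (simp add: line_point_def)
    then show ?thesis by blast
  qed
  ultimately show False using open_not_negligible[OF op] by blast
qed

end

theorem theorem2p7:
  fixes D D' R R' :: "((real ^ 'm::finite) \<times> real) set"
    and M :: "'w measure"
    and \<Xi>\<^sub>1 \<Xi>\<^sub>2 :: "'w \<Rightarrow> (real ^ 'm) \<times> real"
  assumes "open D" and "connected D" and "bounded D"
    and "lipschitz_boundary D"
    and "regular_part D R"
    and "open D'" and "convex D'" and "D' \<noteq> {}" and "D' \<subseteq> D"
    and "regular_part D' R'"
    and "prob_space M"
    and "random_chord M D R \<Xi>\<^sub>1 \<Xi>\<^sub>2"
  shows "random_chord (uniform_measure M (hits M \<Xi>\<^sub>1 \<Xi>\<^sub>2 D')) D' R'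
           (\<lambda>\<omega>. entry_point D' (\<Xi>\<^sub>1 \<omega>) (\<Xi>\<^sub>2 \<omega>)) (\<lambda>\<omega>. exit_point D' (\<Xi>\<^sub>1 \<omega>) (\<Xi>\<^sub>2 \<omega>))"
proof -
  interpret M: prob_space M by fact
  interpret A: regular_domain D R
    using assms lipschitz_boundary_imp_cone_boundary by unfold_locales auto
  interpret B: regular_domain D' R'
    using assms convex_imp_cone_boundary bounded_subset by unfold_locales auto
  let ?BD' = "boundary_measure D'" and ?H = "hits M \<Xi>\<^sub>1 \<Xi>\<^sub>2 D'"
  define m where "m = measure hausdorff_surface (frontier D)"
  define m' where "m' = measure hausdorff_surface (frontier D')"
  define \<gamma> where "\<gamma> = gamma_const TYPE('m)"
  define I where "I = chord_mass TYPE('m)"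
  define G where "G F = (\<integral>\<^sup>+x. (\<integral>\<^sup>+y. F (x, y) * ennreal (B.kernel x y) \<partial>?BD') \<partial>?BD')" for F
  define Y where "Y \<omega> = (entry_point D' (\<Xi>\<^sub>1 \<omega>) (\<Xi>\<^sub>2 \<omega>), exit_point D' (\<Xi>\<^sub>1 \<omega>) (\<Xi>\<^sub>2 \<omega>))" for \<omega>
  have \<gamma>: "0 \<le> \<gamma>" unfolding \<gamma>_def by (rule gamma_const_nonneg)
  have m: "0 < m" unfolding m_def using assms(8,9) by (intro A.frontier_measure_pos) blast
  have m': "0 < m'" unfolding m'_def by (rule B.frontier_measure_pos[OF assms(8)])
  \<comment> \<open>One height bound for \<open>D'\<close> serves in the formulas for both domains,
    so that they produce the same \<open>line_integral\<close>.\<close>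
  obtain K where K: "0 < K" "\<And>z. z \<in> D' \<Longrightarrow> \<bar>snd z\<bar> < K"
  proof -
    obtain b where b: "0 < b" "\<And>z. z \<in> D' \<Longrightarrow> norm z \<le> b"
      using B.bounded_D unfolding bounded_pos by blast
    show thesis
    proof (rule that[of "b + 1"])
      fix z assume "z \<in> D'"
      then have "norm (snd z) \<le> b" using b(2)[of z] norm_snd_le'[of z] by linarith
      then show "\<bar>snd z\<bar> < b + 1" by simp
    qed (use b in simp)
  qed
  \<comment> \<open>Chords of \<open>D\<close> seen through \<open>D'\<close> and chords of
    \<open>D'\<close> itself have the same integral over lines; the domain \<open>D\<close> survives
    only in the factor \<open>\<gamma> / m\<close>.\<close>
  have chord: "(\<integral>\<^sup>+\<omega>. chord_value D' F (\<Xi>\<^sub>1 \<omega>, \<Xi>\<^sub>2 \<omega>) \<partial>M) = ennreal (\<gamma> / m) * G F"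
    if F: "F \<in> borel_measurable borel" for F
  proof -
    have "(\<integral>\<^sup>+\<omega>. chord_value D' F (\<Xi>\<^sub>1 \<omega>, \<Xi>\<^sub>2 \<omega>) \<partial>M) = ennreal (\<gamma> / m) *
        (\<integral>\<^sup>+x. (\<integral>\<^sup>+y. chord_value D' F (x, y) * ennreal (A.kernel x y) \<partial>boundary_measure D) \<partial>boundary_measure D)"
      unfolding \<gamma>_def m_def by (rule A.random_chord_integral[OF assms(12) chord_value_measurable[OF assms(6) F]])
    also have "(\<integral>\<^sup>+x. (\<integral>\<^sup>+y. chord_value D' F (x, y) * ennreal (A.kernel x y) \<partial>boundary_measure D) \<partial>boundary_measure D) =
        line_integral D' K F + line_integral D' K (F \<circ> prod.swap)"
      by (rule A.crofton[OF assms(6,7,9) _ K(1) F]) (rule K(2))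
    also have "\<dots> = G F"
      unfolding G_def by (rule B.crofton_self[symmetric, OF assms(7) _ K(1) F]) (rule K(2))
    finally show ?thesis .
  qed
  \<comment> \<open>Testing the law of the given chord with the constant 1 yields
    \<open>\<gamma>\<close> times \<open>I\<close> equal to 1.\<close>
  have "(\<integral>\<^sup>+\<omega>. 1 \<partial>M) = ennreal (\<gamma> / m) * (I * ennreal m)"
    using A.random_chord_integral[OF assms(12), of "\<lambda>_. 1"] A.kernel_total_boundary
    by (simp add: \<gamma>_def m_def I_def)
  then have one: "ennreal (\<gamma> / m) * I * ennreal m = 1" by (simp add: M.emeasure_space_1 mult_ac)
  have mm: "ennreal m * ennreal (1 / m) = 1" using m by (simp flip: ennreal_mult)
  have \<gamma>I: "ennreal (\<gamma> / m) * I = ennreal (1 / m)"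
    using one mm by (metis mult.assoc mult.right_neutral mult.left_neutral)
  have Xm: "(\<lambda>\<omega>. (\<Xi>\<^sub>1 \<omega>, \<Xi>\<^sub>2 \<omega>)) \<in> M \<rightarrow>\<^sub>M borel"
    using distributed_measurable[OF assms(12)[unfolded random_chord_def]]
    by (simp only: measurable_cong_sets[OF refl A.sets_boundary_pair])
  have Ym: "Y \<in> M \<rightarrow>\<^sub>M borel"
    using measurable_compose[OF Xm endpoints_measurable(2)[OF assms(6)]] by (simp add: Y_def[abs_def])
  have H: "?H \<in> sets M"
  proof -
    have "?H = (\<lambda>\<omega>. (\<Xi>\<^sub>1 \<omega>, \<Xi>\<^sub>2 \<omega>)) -` {p. segment_times D' (fst p) (snd p) \<noteq> {}} \<inter> space M"
      unfolding hits_def closed_segment_meets_iff by auto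
    then show ?thesis using measurable_sets[OF Xm endpoints_measurable(1)[OF assms(6)]] by simp
  qed
  have part: "emeasure M (?H \<inter> Y -` C) = ennreal (\<gamma> / m) * G (indicator C)" if C: "C \<in> sets borel" for C
  proof -
    have "Y -` C \<inter> space M \<in> sets M" by (rule measurable_sets[OF Ym C])
    moreover have "?H \<inter> Y -` C = ?H \<inter> (Y -` C \<inter> space M)" by (auto simp: hits_def)
    ultimately have "?H \<inter> Y -` C \<in> sets M" using H by auto
    then have "emeasure M (?H \<inter> Y -` C) = (\<integral>\<^sup>+\<omega>. indicator (?H \<inter> Y -` C) \<omega> \<partial>M)" by simp
    also have "\<dots> = (\<integral>\<^sup>+\<omega>. chord_value D' (indicator C) (\<Xi>\<^sub>1 \<omega>, \<Xi>\<^sub>2 \<omega>) \<partial>M)"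
      by (intro nn_integral_cong) (simp add: chord_value_def hits_def Y_def split: split_indicator)
    also have "\<dots> = ennreal (\<gamma> / m) * G (indicator C)" using C by (intro chord) simp
    finally show ?thesis .
  qed
  \<comment> \<open>The probability of hitting \<open>D'\<close> is the ratio of the two surface
    areas. It is positive, so the conditioning is genuine, and dividing by it exchanges
    \<open>m\<close> for \<open>m'\<close> in the density.\<close>
  have PH: "emeasure M ?H = ennreal (m' / m)"
  proof -
    have "emeasure M ?H = ennreal (\<gamma> / m) * G (indicator UNIV)" using part[of UNIV] by simp
    also have "G (indicator UNIV) = I * ennreal m'"
      using B.kernel_total_boundary by (simp add: G_def I_def m'_def)
    also have "ennreal (\<gamma> / m) * (I * ennreal m') = ennreal (1 / m) * ennreal m'"
      by (simp only: \<gamma>I flip: mult.assoc)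
    also have "\<dots> = ennreal (m' / m)" using m m' by (simp flip: ennreal_mult)
    finally show ?thesis .
  qed
  define f where "f = (\<lambda>(x, y). ennreal (K_tilde D' R' x y / m'))"
  have f: "f p = ennreal (\<gamma> / m') * ennreal (B.kernel (fst p) (snd p))" for p
    unfolding f_def B.K_tilde_eq_kernel case_prod_beta \<gamma>_def[symmetric]
    using \<gamma> m' by (subst ennreal_mult'[symmetric]) auto
  have meas: "g \<in> borel_measurable (?BD' \<Otimes>\<^sub>M ?BD')" if "g \<in> borel_measurable borel" for g :: "_ \<Rightarrow> ennreal"
    using that by (simp only: measurable_cong_sets[OF B.sets_boundary_pair refl])
  have fm: "f \<in> borel_measurable borel"
    using B.kernel_measurable unfolding f[abs_def] by measurable
  interpret BD': sigma_finite_measure ?BD' by (rule B.sigma_finite_boundary_measure)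
  have dens: "emeasure (density (?BD' \<Otimes>\<^sub>M ?BD') f) C = ennreal (\<gamma> / m') * G (indicator C)" if C: "C \<in> sets borel" for C
  proof -
    have gk: "(\<lambda>p. indicator C p * ennreal (B.kernel (fst p) (snd p))) \<in> borel_measurable borel"
      using C B.kernel_measurable by measurable
    have "emeasure (density (?BD' \<Otimes>\<^sub>M ?BD') f) C = (\<integral>\<^sup>+p. f p * indicator C p \<partial>(?BD' \<Otimes>\<^sub>M ?BD'))"
      using C B.sets_boundary_pair by (intro emeasure_density meas[OF fm]) simp
    also have "\<dots> = (\<integral>\<^sup>+p. ennreal (\<gamma> / m') * (indicator C p * ennreal (B.kernel (fst p) (snd p))) \<partial>(?BD' \<Otimes>\<^sub>M ?BD'))"
      by (intro nn_integral_cong) (simp only: f mult_ac)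
    also have "\<dots> = ennreal (\<gamma> / m') * (\<integral>\<^sup>+p. indicator C p * ennreal (B.kernel (fst p) (snd p)) \<partial>(?BD' \<Otimes>\<^sub>M ?BD'))"
      by (rule nn_integral_cmult[OF meas[OF gk]])
    finally show ?thesis
      using BD'.nn_integral_fst[OF meas[OF gk]] by (simp add: G_def)
  qed
  have scale: "ennreal (\<gamma> / m) * g / ennreal (m' / m) = ennreal (\<gamma> / m') * g" for g
  proof -
    have "ennreal (\<gamma> / m) * inverse (ennreal (m' / m)) = ennreal (\<gamma> / m) * ennreal (m / m')"
      using m m' by (simp add: inverse_ennreal)
    also have "\<dots> = ennreal (\<gamma> / m')" using m m' \<gamma> by (simp flip: ennreal_mult)
    finally show ?thesis unfolding divide_ennreal_def by (metis mult.commute mult.assoc)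
  qed
  have Ym': "Y \<in> uniform_measure M ?H \<rightarrow>\<^sub>M ?BD' \<Otimes>\<^sub>M ?BD'"
    using Ym by (simp only: measurable_cong_sets[OF sets_uniform_measure B.sets_boundary_pair])
  have "distr (uniform_measure M ?H) (?BD' \<Otimes>\<^sub>M ?BD') Y = density (?BD' \<Otimes>\<^sub>M ?BD') f"
  proof (rule measure_eqI)
    fix C assume "C \<in> sets (distr (uniform_measure M ?H) (?BD' \<Otimes>\<^sub>M ?BD') Y)"
    then have CP: "C \<in> sets (?BD' \<Otimes>\<^sub>M ?BD')" by simp
    then have C: "C \<in> sets borel" by (simp only: B.sets_boundary_pair)
    have "?H \<inter> (Y -` C \<inter> space M) = ?H \<inter> Y -` C" by (auto simp: hits_def)
    moreover have "Y -` C \<inter> space M \<in> sets M" by (rule measurable_sets[OF Ym C])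
    ultimately have "emeasure (distr (uniform_measure M ?H) (?BD' \<Otimes>\<^sub>M ?BD') Y) C = emeasure M (?H \<inter> Y -` C) / emeasure M ?H"
      using emeasure_distr[OF Ym' CP] H by (simp add: space_uniform_measure)
    also have "\<dots> = ennreal (\<gamma> / m') * G (indicator C)" unfolding part[OF C] PH scale ..
    finally show "emeasure (distr (uniform_measure M ?H) (?BD' \<Otimes>\<^sub>M ?BD') Y) C = emeasure (density (?BD' \<Otimes>\<^sub>M ?BD') f) C"
      by (simp only: dens[OF C])
  qed simp
  then show ?thesis
    unfolding random_chord_def distributed_def Y_def[symmetric] m'_def[symmetric] f_def[symmetric]
    using meas[OF fm] Ym' by simp
qed

end
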